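(* Let $(V,\omega,q)$ be a finite-dimensional dg $(-1)$-shifted symplectic vector space with a cyclic special deformation retract $(p,i,k)$ to a dg $(-1)$-shifted symplectic vector space $U$, let $S_{\mathrm{free}}+S_{\mathrm{int}}$ be a quantum master action on $V$, and let $W$ be the effective interaction on $U$, $e^{W/\hbar}=P'(e^{S_{\mathrm{int}}/\hbar})$. Then the actions $e^{(S_{\mathrm{free}}+S_{\mathrm{int}})/\hbar}$ and $e^{(S_{\mathrm{free}}+I(W))/\hbar}$ are homotopic, i.e. the half-densities $e^{(S_{\mathrm{free}}+S_{\mathrm{int}})/\hbar}\sqrt{dV}$ and $e^{(S_{\mathrm{free}}+I(W))/\hbar}\sqrt{dV}$ differ by a $\Delta$-exact term.
   Context: $|\cdot|$ denotes degree. A $(-1)$-shifted symplectic vector space is a $\mathbb Z$-graded real vector space $V$ with an antisymmetric non-degenerate pairing $\omega:V\otimes V\to\mathbb R$ of degree $-1$ (vanishing on arguments of total degree $\ne1$); it is dg if it has a degree $1$ differential $q$ with $\omega(qv,w)+(-1)^{|v|}\omega(v,qw)=0$. The adjoint is defined by $\omega(Ov,w)=(-1)^{|O||v|}\omega(v,O^\dagger w)$. A cyclic special deformation retract from $V$ to $U$ consists of chain maps $p:V\to U$, $i:U\to V$ and a degree $-1$ map $k:V\to V$ with $1_V-ip=kq+qk$, $pi=1_U$, $k^2=0$, $pk=0$, $ki=0$, $k^\dagger=k$, $i^\dagger=p$. Put $V'=\operatorname{Im}(ip)$, $V''=\operatorname{Im}(kq)\oplus\operatorname{Im}(qk)$,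 so $V=V'\oplus V''$. $\mathcal F V:=\widehat{\operatorname{Sym}}\,V^*[[\hbar]]$. $Q$ is the derivation with $Q\phi=-(-1)^{|\phi|}\phi\circ q$ for $\phi\in V^*$. The BV operator is $\Delta=-\partial_{\mathcal K_0}$, where $\mathcal K_0=\sum\mathcal K'\otimes\mathcal K''\in V\otimes V$ is determined by $(-1)^{|v|}\sum\mathcal K'\,\omega(\mathcal K'',v)=v$ for all $v$, $\partial_{\mathcal K_0}=\tfrac12\sum\partial_{\mathcal K'}\partial_{\mathcal K''}$, and $\partial_v$ is the derivation with $\partial_v\phi=(-1)^{|v|}\phi(v)$. The bracket is defined by $\Delta(FG)=(\Delta F)G+(-1)^{|F|}F\Delta G+(-1)^{|F|}\{F,G\}$. $S_{\mathrm{free}}$ is the quadratic function with $\{S_{\mathrm{free}},-\}=Q$ (coming from the pairing $(-1)^{|v|}\omega(qv,w)$). $I=p^*:\mathcal F U\to\mathcal F V$ and $P=i^*:\mathcal F V\to\mathcal F U$ are algebra maps. $K_{\mathrm{un}}$ is the derivation of $\mathcal F V$ with $K_{\mathrm{un}}\phi=(-1)^{|\phi|}\phi\circ k$, $K=\frac1{\#''}K_{\mathrm{un}}$ with $\#''$ the number of factors from $(V'')^*$ in a monomial ($K=0$ if $\#''=0$), and $P'=P(1-\hbar\Delta K+(\hbar\Delta K)^2-\cdots)$. A quantum master action is $S_{\mathrm{free}}+S_{\mathrm{int}}$ with $S_{\mathrm{int}}\in\mathcal F V$ of degree $0$ satisfying $(Q+\hbar\Delta)e^{S_{\mathrm{int}}/\hbar}=0$.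 Exponentials are formal: a term of polynomial degree $n$ and order $\hbar^g$ has weight $n+2g$, $S_{\mathrm{int}}$ has only terms of weight $\ge3$, and exponentials live in $\prod_w\bigoplus_{n+2g=w}\operatorname{Sym}^nV^*\hbar^g$ with $g\in\mathbb Z$; all operators extend to this space. $\sqrt{dV}$ is a constant half-density, and $\Delta$ acts on half-densities by $\Delta(F\sqrt{dV})=(\Delta F)\sqrt{dV}$; in the perturbative setting, half-densities are of the form $e^{S_{\mathrm{free}}/\hbar}f\sqrt{dV}$ with $f\in\prod_w\bigoplus_{n+2g=w}\operatorname{Sym}^nV^*\hbar^g$ ($g\in\mathbb Z$), and $\hbar\Delta(e^{S_{\mathrm{free}}/\hbar}f\sqrt{dV})=e^{S_{\mathrm{free}}/\hbar}(Qf+\hbar\Delta f)\sqrt{dV}$. Two $\Delta$-closed half-densities are homotopic if their difference is $\Delta\varphi$ for some half-density $\varphi$. *)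

theory Defs
  imports "HOL-Analysis.Analysis" "HOL-Library.Function_Algebras"
begin

section \<open>Graded vector spaces\<close>

definition homogeneous_decomposition ::
    "(int \<Rightarrow> 'v::real_vector set) \<Rightarrow> 'v \<Rightarrow> (int \<Rightarrow> 'v) \<Rightarrow> bool" where
  "homogeneous_decomposition V v c \<longleftrightarrow>
     (\<forall>d. c d \<in> V d) \<and> finite {d. c d \<noteq> 0} \<and> v = (\<Sum>d | c d \<noteq> 0. c d)"

text \<open>The type is the total space; \<open>V d\<close> is its part of degree \<open>d\<close>.\<close>

locale graded_space =
  fixes V :: "int \<Rightarrow> 'v::real_vector set"
  assumes subspace_degree: "subspace (V d)"
    and direct_sum: "\<exists>!c. homogeneous_decomposition V v c"

definition component :: "(int \<Rightarrow> 'v::real_vector set) \<Rightarrow> 'v \<Rightarrow> int \<Rightarrow> 'v" where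
  "component V v = (THE c. homogeneous_decomposition V v c)"

text \<open>The linear map \<open>v \<mapsto> (-1)\<^bsup>|v|\<^esup> v\<close>, and the parts of \<open>v\<close> of even and of odd degree.\<close>

definition parity :: "(int \<Rightarrow> 'v::real_vector set) \<Rightarrow> 'v \<Rightarrow> 'v" where
  "parity V v = (\<Sum>d | component V v d \<noteq> 0. ((-1) powi d :: real) *\<^sub>R component V v d)"

definition even_part :: "(int \<Rightarrow> 'v::real_vector set) \<Rightarrow> 'v \<Rightarrow> 'v" where
  "even_part V v = (1/2) *\<^sub>R (v + parity V v)"

definition odd_part :: "(int \<Rightarrow> 'v::real_vector set) \<Rightarrow> 'v \<Rightarrow> 'v" where
  "odd_part V v = (1/2) *\<^sub>R (v - parity V v)"

text \<open>\<open>A'\<close> is adjoint to the map \<open>A\<close> of degree \<open>n\<close> from \<open>V\<close> (pairing \<open>\<omega>\<close>) to the space with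
  pairing \<open>\<omega>'\<close>.\<close>

definition is_adjoint :: "(int \<Rightarrow> 'v::real_vector set) \<Rightarrow> ('v \<Rightarrow> 'v \<Rightarrow> real) \<Rightarrow>
    ('w::real_vector \<Rightarrow> 'w \<Rightarrow> real) \<Rightarrow> int \<Rightarrow> ('v \<Rightarrow> 'w) \<Rightarrow> ('w \<Rightarrow> 'v) \<Rightarrow> bool" where
  "is_adjoint V \<omega> \<omega>' n A A' \<longleftrightarrow>
     (\<forall>d. \<forall>v\<in>V d. \<forall>w. \<omega>' (A v) w = (-1) powi (n * d) * \<omega> v (A' w))"

text \<open>Graded antisymmetry of the pairing is plain antisymmetry, since \<open>|v| |w|\<close> is even
  when \<open>|v| + |w| = 1\<close>.\<close>

locale dg_symplectic = graded_space V
  for V :: "int \<Rightarrow> 'v::real_vector set" +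
  fixes \<omega> :: "'v \<Rightarrow> 'v \<Rightarrow> real" and q :: "'v \<Rightarrow> 'v"
  assumes bilinear_pairing: "bilinear \<omega>"
    and pairing_degree: "\<lbrakk>v \<in> V d; w \<in> V e; d + e \<noteq> 1\<rbrakk> \<Longrightarrow> \<omega> v w = 0"
    and antisymmetric: "\<omega> v w = - \<omega> w v"
    and nondegenerate: "(\<And>w. \<omega> v w = 0) \<Longrightarrow> v = 0"
    and linear_q: "linear q"
    and q_degree: "v \<in> V d \<Longrightarrow> q v \<in> V (d + 1)"
    and q_square: "q (q v) = 0"
    and q_pairing: "v \<in> V d \<Longrightarrow> \<omega> (q v) w + (-1) powi d * \<omega> v (q w) = 0"

locale cyclic_sdr =
  V: dg_symplectic V \<omega> q + U: dg_symplectic U \<omega>U qU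
  for V :: "int \<Rightarrow> 'v::real_vector set" and \<omega> q
    and U :: "int \<Rightarrow> 'u::real_vector set" and \<omega>U qU +
  fixes p :: "'v \<Rightarrow> 'u" and i :: "'u \<Rightarrow> 'v" and k :: "'v \<Rightarrow> 'v"
  assumes linear_p: "linear p" and linear_i: "linear i" and linear_k: "linear k"
    and p_degree: "v \<in> V d \<Longrightarrow> p v \<in> U d"
    and i_degree: "u \<in> U d \<Longrightarrow> i u \<in> V d"
    and k_degree: "v \<in> V d \<Longrightarrow> k v \<in> V (d - 1)"
    and p_chain: "p (q v) = qU (p v)"
    and i_chain: "i (qU u) = q (i u)"
    and homotopy: "v - i (p v) = k (q v) + q (k v)"
    and pi_id: "p (i u) = u"
    and k_square: "k (k v) = 0"
    and pk_zero: "p (k v) = 0"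
    and ki_zero: "k (i u) = 0"
    and k_selfadjoint: "is_adjoint V \<omega> \<omega> (-1) k k"
    and i_adjoint: "is_adjoint U \<omega>U \<omega> 0 i p"

section \<open>The completed graded symmetric algebra of the dual\<close>

text \<open>A formal function on \<open>V\<close> is encoded by its Taylor coefficients
  \<open>[v\<^sub>1, \<dots>, v\<^sub>n] \<mapsto> (\<partial>\<^bsub>vn\<^esub> \<dots> \<partial>\<^bsub>v1\<^esub> F)(0)\<close> with respect to the left derivations \<open>\<partial>\<^sub>v\<close> of
  degree \<open>|v|\<close> with \<open>\<partial>\<^sub>v \<phi> = (-1)\<^bsup>|v|\<^esup> \<phi>(v)\<close>.  The coefficients on lists of length \<open>n\<close> form
  a graded symmetric \<open>n\<close>-linear form; for finite-dimensional \<open>V\<close> this identifies the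
  \<open>n\<close>-linear forms with \<open>Sym\<^sup>n V\<^sup>*\<close>.\<close>

type_synonym 'v form = "'v list \<Rightarrow> real"

definition multilinear :: "'v::real_vector form \<Rightarrow> bool" where
  "multilinear F \<longleftrightarrow> (\<forall>xs ys. linear (\<lambda>v. F (xs @ v # ys)))"

definition Sym :: "(int \<Rightarrow> 'v::real_vector set) \<Rightarrow> 'v form set" where
  "Sym V = {F. multilinear F \<and>
     (\<forall>xs ys d e. \<forall>v\<in>V d. \<forall>w\<in>V e.
        F (xs @ v # w # ys) = (-1) powi (d * e) * F (xs @ w # v # ys))}"

definition functional :: "(int \<Rightarrow> 'v::real_vector set) \<Rightarrow> ('v \<Rightarrow> real) \<Rightarrow> 'v form" where
  "functional V \<phi> vs = (case vs of [v] \<Rightarrow> \<phi> (parity V v) | _ \<Rightarrow> 0)"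

definition unit_form :: "'v form" where
  "unit_form vs = (if vs = [] then 1 else 0)"

text \<open>\<open>V\<^sup>*\<close> is graded by \<open>|\<phi>| = - |v|\<close> for \<open>\<phi>\<close> supported on degree \<open>|v|\<close>.\<close>

definition has_degree :: "(int \<Rightarrow> 'v::real_vector set) \<Rightarrow> int \<Rightarrow> 'v form \<Rightarrow> bool" where
  "has_degree V n F \<longleftrightarrow>
     (\<forall>vs ds. list_all2 (\<lambda>v d. v \<in> V d) vs ds \<and> n + sum_list ds \<noteq> 0 \<longrightarrow> F vs = 0)"

text \<open>The linear map \<open>F \<mapsto> (-1)\<^bsup>|F|\<^esup> F\<close>.\<close>

definition sgn_form :: "(int \<Rightarrow> 'v::real_vector set) \<Rightarrow> 'v form \<Rightarrow> 'v form" where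
  "sgn_form V F vs = F (map (parity V) vs)"

definition pd :: "'v \<Rightarrow> 'v form \<Rightarrow> 'v form" where
  "pd v F vs = F (v # vs)"

text \<open>The product: its constant term is the product of the constant terms, and its
  derivatives are given by
  \<open>\<partial>\<^sub>v(F H) = (\<partial>\<^sub>v F) H + (-1)\<^bsup>|v| |F|\<^esup> F \<partial>\<^sub>v H\<close>, extended to inhomogeneous \<open>v\<close> and \<open>F\<close>.\<close>

primrec prod_form :: "(int \<Rightarrow> 'v::real_vector set) \<Rightarrow> 'v form \<Rightarrow> 'v form \<Rightarrow> 'v form" where
  "prod_form V F H [] = F [] * H []"
| "prod_form V F H (v # vs) = prod_form V (pd v F) H vs + prod_form V F (pd (even_part V v) H) vs
     + prod_form V (sgn_form V F) (pd (odd_part V v) H) vs"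

text \<open>For a linear map \<open>a\<close> of odd degree, the derivation with \<open>\<phi> \<mapsto> (-1)\<^bsup>|\<phi>|\<^esup> \<phi> \<circ> a\<close> for
  \<open>\<phi> \<in> V\<^sup>*\<close>; the recursion is its commutation rule with \<open>\<partial>\<^sub>v\<close>.  See \<open>derivation_mult\<close>
  and \<open>derivation_functional\<close> below.\<close>

primrec derivation :: "(int \<Rightarrow> 'v::real_vector set) \<Rightarrow> ('v \<Rightarrow> 'v) \<Rightarrow> 'v form \<Rightarrow> 'v form" where
  "derivation V a F [] = 0"
| "derivation V a F (v # vs) =
     derivation V a (pd (parity V v) F) vs + F (a (parity V v) # vs)"

definition Q_op :: "(int \<Rightarrow> 'v::real_vector set) \<Rightarrow> ('v \<Rightarrow> 'v) \<Rightarrow> 'v form \<Rightarrow> 'v form" where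
  "Q_op V q F vs = - derivation V q F vs"

text \<open>Lists of pairs representing the tensor \<open>\<K>\<^sub>0\<close>.  The tensor is determined by the
  condition, so the choice of the list does not matter; see \<open>copairing_unique\<close> below.\<close>

definition is_copairing ::
    "(int \<Rightarrow> 'v::real_vector set) \<Rightarrow> ('v \<Rightarrow> 'v \<Rightarrow> real) \<Rightarrow> ('v \<times> 'v) list \<Rightarrow> bool" where
  "is_copairing V \<omega> K0 \<longleftrightarrow>
     (\<forall>d. \<forall>v\<in>V d. ((-1) powi d :: real) *\<^sub>R (\<Sum>(a, b)\<leftarrow>K0. \<omega> b v *\<^sub>R a) = v)"

definition copairing ::
    "(int \<Rightarrow> 'v::real_vector set) \<Rightarrow> ('v \<Rightarrow> 'v \<Rightarrow> real) \<Rightarrow> ('v \<times> 'v) list" where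
  "copairing V \<omega> = (SOME K0. is_copairing V \<omega> K0)"

definition BV :: "(int \<Rightarrow> 'v::real_vector set) \<Rightarrow> ('v \<Rightarrow> 'v \<Rightarrow> real) \<Rightarrow> 'v form \<Rightarrow> 'v form" where
  "BV V \<omega> F vs = - (1/2 * (\<Sum>(a, b)\<leftarrow>copairing V \<omega>. pd a (pd b F) vs))"

text \<open>\<open>\<Delta>(F H) = (\<Delta> F) H + (-1)\<^bsup>|F|\<^esup> F \<Delta> H + (-1)\<^bsup>|F|\<^esup> {F, H}\<close>, solved for the bracket.\<close>

definition bracket :: "(int \<Rightarrow> 'v::real_vector set) \<Rightarrow> ('v \<Rightarrow> 'v \<Rightarrow> real) \<Rightarrow>
    'v form \<Rightarrow> 'v form \<Rightarrow> 'v form" where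
  "bracket V \<omega> F H vs = BV V \<omega> (prod_form V (sgn_form V F) H) vs
     - prod_form V (BV V \<omega> (sgn_form V F)) H vs - prod_form V F (BV V \<omega> H) vs"

text \<open>The quadratic function with Taylor coefficients \<open>(-1)\<^bsup>|v|\<^esup> \<omega>(q v, w)\<close>; it satisfies
  \<open>{S\<^sub>f\<^sub>r\<^sub>e\<^sub>e, F} = Q F\<close>, see \<open>bracket_S_free\<close> below.\<close>

definition S_free_form :: "(int \<Rightarrow> 'v::real_vector set) \<Rightarrow> ('v \<Rightarrow> 'v \<Rightarrow> real) \<Rightarrow>
    ('v \<Rightarrow> 'v) \<Rightarrow> 'v form" where
  "S_free_form V \<omega> q vs = (case vs of [v, w] \<Rightarrow> \<omega> (q (parity V v)) w | _ \<Rightarrow> 0)"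

definition pullback :: "('v \<Rightarrow> 'w) \<Rightarrow> 'w form \<Rightarrow> 'v form" where
  "pullback f F vs = F (map f vs)"

text \<open>The part of \<open>F\<close> with exactly \<open>m\<close> factors from \<open>(V'')\<^sup>*\<close>, where \<open>e\<close> is the projection
  onto \<open>V''\<close> along \<open>V'\<close>: the form \<open>F\<close> with \<open>m\<close> of its arguments projected to \<open>V''\<close> and the
  others to \<open>V'\<close>, summed over all choices.\<close>

definition count_part :: "('v::real_vector \<Rightarrow> 'v) \<Rightarrow> nat \<Rightarrow> 'v form \<Rightarrow> 'v form" where
  "count_part e m F vs =
     (\<Sum>bs | length bs = length vs \<and> count_list bs True = m.
        F (map2 (\<lambda>b v. if b then e v else v - e v) bs vs))"

text \<open>\<open>K = (1/#'') K\<^sub>u\<^sub>n\<close>, and \<open>0\<close> on the part with \<open>#'' = 0\<close>.  The projection onto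
  \<open>V'' = Im(k q) \<oplus> Im(q k)\<close> along \<open>V' = Im(i p)\<close> is \<open>k q + q k\<close>; see \<open>projection\<close> and \<open>K_op_monomial\<close> below.\<close>

definition K_op :: "(int \<Rightarrow> 'v::real_vector set) \<Rightarrow> ('v \<Rightarrow> 'v) \<Rightarrow> ('v \<Rightarrow> 'v) \<Rightarrow>
    'v form \<Rightarrow> 'v form" where
  "K_op V q k F vs = (\<Sum>m = 1..length vs.
     1 / real m * derivation V k (count_part (\<lambda>v. k (q v) + q (k v)) m F) vs)"

section \<open>Formal power and Laurent series in \<open>\<hbar>\<close>\<close>

text \<open>\<open>F g\<close> is the coefficient of \<open>\<hbar>\<^sup>g\<close>.  A term of polynomial degree \<open>n\<close> in it has weight
  \<open>n + 2 g\<close>.\<close>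

type_synonym 'v formal = "int \<Rightarrow> 'v form"

text \<open>\<open>\<Prod>\<^sub>w \<Oplus>\<^bsub>n+2g=w\<^esub> Sym\<^sup>n V\<^sup>* \<hbar>\<^sup>g\<close>; for given \<open>w\<close>, the degree \<open>n\<close> is determined by \<open>g\<close>.\<close>

definition formal_space :: "(int \<Rightarrow> 'v::real_vector set) \<Rightarrow> 'v formal set" where
  "formal_space V = {F. (\<forall>g. F g \<in> Sym V) \<and>
     (\<forall>w. finite {g. \<exists>vs. int (length vs) + 2 * g = w \<and> F g vs \<noteq> 0})}"

text \<open>\<open>\<F> V\<close>, the power series in \<open>\<hbar>\<close>.\<close>

definition formal_functions :: "(int \<Rightarrow> 'v::real_vector set) \<Rightarrow> 'v formal set" where
  "formal_functions V = {F. (\<forall>g. F g \<in> Sym V) \<and> (\<forall>g<0. F g = 0)}"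

definition weight_ge :: "int \<Rightarrow> 'v formal \<Rightarrow> bool" where
  "weight_ge w F \<longleftrightarrow> (\<forall>g vs. int (length vs) + 2 * g < w \<longrightarrow> F g vs = 0)"

definition hbar :: "int \<Rightarrow> 'v formal \<Rightarrow> 'v formal" \<comment> \<open>multiplication with \<open>\<hbar>\<^sup>n\<close>\<close> where
  "hbar n F g = F (g - n)"

definition const_hbar :: "'v form \<Rightarrow> 'v formal" where
  "const_hbar F g = (if g = 0 then F else 0)"

abbreviation coeffwise :: "('v form \<Rightarrow> 'w form) \<Rightarrow> 'v formal \<Rightarrow> 'w formal" where
  "coeffwise D F \<equiv> (\<lambda>g. D (F g))"

text \<open>The sum is finite if the weights of both factors are bounded below.\<close>

definition formal_mult ::
    "(int \<Rightarrow> 'v::real_vector set) \<Rightarrow> 'v formal \<Rightarrow> 'v formal \<Rightarrow> 'v formal" where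
  "formal_mult V F H g vs =
     (\<Sum>h | prod_form V (F h) (H (g - h)) vs \<noteq> 0. prod_form V (F h) (H (g - h)) vs)"

definition formal_power ::
    "(int \<Rightarrow> 'v::real_vector set) \<Rightarrow> 'v formal \<Rightarrow> nat \<Rightarrow> 'v formal" where
  "formal_power V F m = (formal_mult V F ^^ m) (const_hbar unit_form)"

text \<open>If \<open>F\<close> has only terms of weight at least \<open>1\<close>, all but finitely many terms of this
  coefficientwise series vanish.\<close>

definition formal_exp :: "(int \<Rightarrow> 'v::real_vector set) \<Rightarrow> 'v formal \<Rightarrow> 'v formal" where
  "formal_exp V F g vs = (\<Sum>m. formal_power V F m g vs / fact m)"

text \<open>On \<open>formal_space V\<close>, all but finitely many terms of the coefficientwise series
  \<open>P' = P (1 - \<hbar>\<Delta>K + (\<hbar>\<Delta>K)\<^sup>2 - \<dots>)\<close> vanish.\<close>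

definition P_pert :: "(int \<Rightarrow> 'v::real_vector set) \<Rightarrow> ('v \<Rightarrow> 'v \<Rightarrow> real) \<Rightarrow> ('v \<Rightarrow> 'v) \<Rightarrow>
    ('u \<Rightarrow> 'v) \<Rightarrow> ('v \<Rightarrow> 'v) \<Rightarrow> 'v formal \<Rightarrow> 'u formal" where
  "P_pert V \<omega> q i k F g us = (\<Sum>m. (-1) ^ m *
     coeffwise (pullback i)
       (((\<lambda>H. hbar 1 (coeffwise (BV V \<omega>) (coeffwise (K_op V q k) H))) ^^ m) F) g us)"

definition S_free :: "(int \<Rightarrow> 'v::real_vector set) \<Rightarrow> ('v \<Rightarrow> 'v \<Rightarrow> real) \<Rightarrow>
    ('v \<Rightarrow> 'v) \<Rightarrow> 'v formal" where
  "S_free V \<omega> q = const_hbar (S_free_form V \<omega> q)"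

definition Q_hbar_BV :: "(int \<Rightarrow> 'v::real_vector set) \<Rightarrow> ('v \<Rightarrow> 'v \<Rightarrow> real) \<Rightarrow>
    ('v \<Rightarrow> 'v) \<Rightarrow> 'v formal \<Rightarrow> 'v formal" \<comment> \<open>\<open>Q + \<hbar>\<Delta>\<close>\<close> where
  "Q_hbar_BV V \<omega> q F = coeffwise (Q_op V q) F + hbar 1 (coeffwise (BV V \<omega>) F)"

definition quantum_master_action :: "(int \<Rightarrow> 'v::real_vector set) \<Rightarrow> ('v \<Rightarrow> 'v \<Rightarrow> real) \<Rightarrow>
    ('v \<Rightarrow> 'v) \<Rightarrow> 'v formal \<Rightarrow> bool" where
  "quantum_master_action V \<omega> q S \<longleftrightarrow> (\<exists>S_int. S = S_free V \<omega> q + S_int \<and>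
     S_int \<in> formal_functions V \<and> (\<forall>g. has_degree V 0 (S_int g)) \<and> weight_ge 3 S_int \<and>
     Q_hbar_BV V \<omega> q (formal_exp V (hbar (-1) S_int)) = 0)"

section \<open>Half-densities\<close>

text \<open>In the perturbative setting the half-density \<open>e\<^bsup>S_free/\<hbar>\<^esup> f \<surd>dV\<close> is represented by
  \<open>f\<close>; the first factor has infinitely many terms of weight \<open>0\<close> and remains symbolic.\<close>

type_synonym 'v half_density = "'v formal"

definition half_densities :: "(int \<Rightarrow> 'v::real_vector set) \<Rightarrow> 'v half_density set" where
  "half_densities V = formal_space V"

text \<open>\<open>\<hbar> \<Delta>(e\<^bsup>S_free/\<hbar>\<^esup> f \<surd>dV) = e\<^bsup>S_free/\<hbar>\<^esup> (Q f + \<hbar> \<Delta> f) \<surd>dV\<close>\<close>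

definition BV_half :: "(int \<Rightarrow> 'v::real_vector set) \<Rightarrow> ('v \<Rightarrow> 'v \<Rightarrow> real) \<Rightarrow>
    ('v \<Rightarrow> 'v) \<Rightarrow> 'v half_density \<Rightarrow> 'v half_density" where
  "BV_half V \<omega> q f = hbar (-1) (Q_hbar_BV V \<omega> q f)"

text \<open>\<open>e\<^bsup>S/\<hbar>\<^esup> \<surd>dV = e\<^bsup>S_free/\<hbar>\<^esup> e\<^bsup>(S - S_free)/\<hbar>\<^esup> \<surd>dV\<close> for an action \<open>S\<close>\<close>

definition exp_action :: "(int \<Rightarrow> 'v::real_vector set) \<Rightarrow> ('v \<Rightarrow> 'v \<Rightarrow> real) \<Rightarrow>
    ('v \<Rightarrow> 'v) \<Rightarrow> 'v formal \<Rightarrow> 'v half_density" where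
  "exp_action V \<omega> q S = formal_exp V (hbar (-1) (S - S_free V \<omega> q))"

definition homotopic :: "(int \<Rightarrow> 'v::real_vector set) \<Rightarrow> ('v \<Rightarrow> 'v \<Rightarrow> real) \<Rightarrow>
    ('v \<Rightarrow> 'v) \<Rightarrow> 'v half_density \<Rightarrow> 'v half_density \<Rightarrow> bool" where
  "homotopic V \<omega> q \<alpha> \<beta> \<longleftrightarrow>
     \<alpha> \<in> half_densities V \<and> \<beta> \<in> half_densities V \<and>
     BV_half V \<omega> q \<alpha> = 0 \<and> BV_half V \<omega> q \<beta> = 0 \<and>
     (\<exists>\<phi>\<in>half_densities V. \<alpha> - \<beta> = BV_half V \<omega> q \<phi>)"

section \<open>Consistency of the explicit formulas\<close>

context graded_space
begin

lemma component_decomposition: "homogeneous_decomposition V v (component V v)"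
  using theI'[OF direct_sum[of v]] by (simp add: component_def)

lemma component_unique: "homogeneous_decomposition V v c \<Longrightarrow> component V v = c"
  using component_decomposition direct_sum by blast

lemma decomposition_sum:
  assumes "homogeneous_decomposition V v c" "finite D" "{d. c d \<noteq> 0} \<subseteq> D"
  shows "v = (\<Sum>d\<in>D. c d)"
proof -
  have "(\<Sum>d | c d \<noteq> 0. c d) = (\<Sum>d\<in>D. c d)"
    by (rule sum.mono_neutral_left) (use assms in auto)
  then show ?thesis using assms unfolding homogeneous_decomposition_def by simp
qed

lemma decompositionI:
  assumes "\<And>d. c d \<in> V d" "finite D" "{d. c d \<noteq> 0} \<subseteq> D" "v = (\<Sum>d\<in>D. c d)"
  shows "homogeneous_decomposition V v c"
proof -
  have "(\<Sum>d | c d \<noteq> 0. c d) = (\<Sum>d\<in>D. c d)"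
    by (rule sum.mono_neutral_left) (use assms in auto)
  then show ?thesis using assms finite_subset[OF assms(3,2)]
    unfolding homogeneous_decomposition_def by simp
qed

lemma finite_components: "finite {d. component V v d \<noteq> 0}"
  using component_decomposition unfolding homogeneous_decomposition_def by blast

lemma component_in: "component V v d \<in> V d"
  using component_decomposition unfolding homogeneous_decomposition_def by blast

lemma sum_components: "v = (\<Sum>d | component V v d \<noteq> 0. component V v d)"
  using component_decomposition unfolding homogeneous_decomposition_def by blast

lemma component_add: "component V (v + w) d = component V v d + component V w d"
proof -
  let ?D = "{d. component V v d \<noteq> 0} \<union> {d. component V w d \<noteq> 0}"
  have "homogeneous_decomposition V (v + w) (\<lambda>d. component V v d + component V w d)"
  proof (rule decompositionI[where D = ?D])
    show "v + w = (\<Sum>d\<in>?D. component V v d + component V w d)"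
      unfolding sum.distrib
      by (intro arg_cong2[where f = plus] decomposition_sum[OF component_decomposition])
        (auto simp: finite_components)
  qed (auto simp: finite_components component_in subspace_add subspace_degree)
  from component_unique[OF this] show ?thesis by simp
qed

lemma component_scale: "component V (r *\<^sub>R v) d = r *\<^sub>R component V v d"
proof -
  have "homogeneous_decomposition V (r *\<^sub>R v) (\<lambda>d. r *\<^sub>R component V v d)"
  proof (rule decompositionI[where D = "{d. component V v d \<noteq> 0}"])
    show "r *\<^sub>R v = (\<Sum>d | component V v d \<noteq> 0. r *\<^sub>R component V v d)"
      by (subst (1) sum_components) (simp add: scaleR_sum_right)
  qed (auto simp: finite_components component_in subspace_scale subspace_degree)
  from component_unique[OF this] show ?thesis by simp
qed

lemma component_homogeneous:
  assumes "v \<in> V d" shows "component V v = (\<lambda>e. if e = d then v else 0)"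
  by (rule component_unique, rule decompositionI[where D = "{d}"])
    (use assms in \<open>auto simp: subspace_0 subspace_degree\<close>)

lemma parity_sum:
  assumes "finite D" "{d. component V v d \<noteq> 0} \<subseteq> D"
  shows "parity V v = (\<Sum>d\<in>D. ((-1) powi d :: real) *\<^sub>R component V v d)"
  unfolding parity_def by (rule sum.mono_neutral_left) (use assms in auto)

lemma linear_parity: "linear (parity V)"
proof (rule linearI)
  fix v w
  let ?D = "{d. component V v d \<noteq> 0} \<union> {d. component V w d \<noteq> 0}"
  have "parity V (v + w) = (\<Sum>d\<in>?D. ((-1) powi d :: real) *\<^sub>R component V (v + w) d)"
    by (rule parity_sum) (auto simp: finite_components component_add)
  also have "\<dots> = (\<Sum>d\<in>?D. ((-1) powi d :: real) *\<^sub>R component V v d)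
     + (\<Sum>d\<in>?D. ((-1) powi d :: real) *\<^sub>R component V w d)"
    by (simp add: component_add scaleR_add_right sum.distrib)
  also have "\<dots> = parity V v + parity V w"
    by (intro arg_cong2[where f = plus] parity_sum[symmetric]) (auto simp: finite_components)
  finally show "parity V (v + w) = parity V v + parity V w" .
next
  fix r v
  have "parity V (r *\<^sub>R v)
      = (\<Sum>d | component V v d \<noteq> 0. ((-1) powi d :: real) *\<^sub>R component V (r *\<^sub>R v) d)"
    by (rule parity_sum) (auto simp: finite_components component_scale)
  then show "parity V (r *\<^sub>R v) = r *\<^sub>R parity V v"
    by (simp add: component_scale parity_def scaleR_sum_right mult.commute)
qed

lemma parity_homogeneous:
  assumes "v \<in> V d" shows "parity V v = ((-1) powi d :: real) *\<^sub>R v"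
proof -
  have "parity V v = (\<Sum>d\<in>{d}. ((-1) powi d :: real) *\<^sub>R component V v d)"
    by (rule parity_sum) (auto simp: component_homogeneous[OF assms])
  then show ?thesis by (simp add: component_homogeneous[OF assms])
qed

lemma linear_eq_homogeneous:
  assumes "linear f" "linear g" "\<And>d v. v \<in> V d \<Longrightarrow> f v = g v"
  shows "f v = g v"
proof -
  have "f (\<Sum>d | component V v d \<noteq> 0. component V v d)
      = g (\<Sum>d | component V v d \<noteq> 0. component V v d)"
    unfolding linear_sum[OF assms(1)] linear_sum[OF assms(2)]
    by (intro sum.cong refl assms(3)[OF component_in])
  then show ?thesis using sum_components by simp
qed

lemma powi_square: "((-1) powi d :: real) * (-1) powi d = 1"
  by (simp add: power_int_minus_one_mult_self)

lemma parity_parity [simp]: "parity V (parity V v) = v"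
proof (rule linear_eq_homogeneous[where f = "\<lambda>v. parity V (parity V v)" and g = "\<lambda>v. v"])
  show "linear (\<lambda>v. parity V (parity V v))"
    using linear_compose[OF linear_parity linear_parity] by (simp add: o_def)
  fix d v assume "v \<in> V d"
  then show "parity V (parity V v) = v"
    by (simp add: parity_homogeneous linear_cmul[OF linear_parity] powi_square)
qed (rule linear_ident)

lemmas parity_add = linear_add[OF linear_parity]
lemmas parity_diff = linear_diff[OF linear_parity]
lemmas parity_neg = linear_neg[OF linear_parity]
lemmas parity_scale = linear_cmul[OF linear_parity]
lemmas parity_0 [simp] = linear_0[OF linear_parity]

lemma even_part_parity [simp]: "even_part V (parity V v) = even_part V v"
  and odd_part_parity [simp]: "odd_part V (parity V v) = - odd_part V v"
  and parity_even_part [simp]: "parity V (even_part V v) = even_part V v"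
  and parity_odd_part [simp]: "parity V (odd_part V v) = - odd_part V v"
  by (simp_all add: even_part_def odd_part_def parity_add parity_diff parity_scale
      scaleR_diff_right algebra_simps)

lemma half_double: "(1/2) *\<^sub>R (x + x) = (x :: 'v)"
  by (simp flip: scaleR_2)

lemma even_part_even_part [simp]: "even_part V (even_part V v) = even_part V v"
  and odd_part_even_part [simp]: "odd_part V (even_part V v) = 0"
  and even_part_odd_part [simp]: "even_part V (odd_part V v) = 0"
  and odd_part_odd_part [simp]: "odd_part V (odd_part V v) = odd_part V v"
  unfolding even_part_def[of V "even_part V v"] odd_part_def[of V "even_part V v"]
    even_part_def[of V "odd_part V v"] odd_part_def[of V "odd_part V v"]
  by (simp_all add: half_double)

lemma even_odd_sum: "even_part V v + odd_part V v = v"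
  unfolding even_part_def odd_part_def
  by (simp flip: scaleR_add_right add: half_double)

lemma parity_even_odd: "parity V v = even_part V v - odd_part V v"
  unfolding even_part_def odd_part_def
  by (simp flip: scaleR_diff_right add: half_double)

lemma even_part_add: "even_part V (v + w) = even_part V v + even_part V w"
  and odd_part_add: "odd_part V (v + w) = odd_part V v + odd_part V w"
  and even_part_scale: "even_part V (r *\<^sub>R v) = r *\<^sub>R even_part V v"
  and odd_part_scale: "odd_part V (r *\<^sub>R v) = r *\<^sub>R odd_part V v"
  unfolding even_part_def odd_part_def
  by (simp_all add: parity_add parity_scale algebra_simps)

lemma parts_homogeneous:
  assumes "v \<in> V d"
  shows "even_part V v = (if even d then v else 0)" "odd_part V v = (if even d then 0 else v)"
  unfolding even_part_def odd_part_def parity_homogeneous[OF assms]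
  by (auto simp: power_int_minus_left half_double)

end

lemma multilinear_pd: "multilinear F \<Longrightarrow> multilinear (pd v F)"
proof -
  assume "multilinear F"
  then have "linear (\<lambda>w. F ((v # xs) @ w # ys))" for xs ys unfolding multilinear_def by blast
  then show ?thesis by (simp add: multilinear_def pd_def)
qed

lemma multilinear_linear: "multilinear F \<Longrightarrow> linear (\<lambda>v. F (v # vs))"
proof -
  assume "multilinear F"
  then have "linear (\<lambda>w. F ([] @ w # vs))" unfolding multilinear_def by blast
  then show ?thesis by simp
qed

lemma pd_add: "multilinear F \<Longrightarrow> pd (v + w) F = pd v F + pd w F"
  by (rule ext) (simp add: pd_def linear_add[OF multilinear_linear])

lemma pd_diff: "multilinear F \<Longrightarrow> pd (v - w) F = pd v F - pd w F"
  by (rule ext) (simp add: pd_def linear_diff[OF multilinear_linear])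

lemma pd_neg: "multilinear F \<Longrightarrow> pd (- v) F = - pd v F"
  by (rule ext) (simp add: pd_def linear_neg[OF multilinear_linear])

lemma pd_scale: "multilinear F \<Longrightarrow> pd (r *\<^sub>R v) F = (\<lambda>vs. r * pd v F vs)"
  by (rule ext) (simp add: pd_def linear_cmul[OF multilinear_linear])

lemma pd_0: "multilinear F \<Longrightarrow> pd 0 F = 0"
  by (rule ext) (simp add: pd_def linear_0[OF multilinear_linear])

lemma pd_plus [simp]: "pd v (F + H) = pd v F + pd v H"
  and pd_minus [simp]: "pd v (F - H) = pd v F - pd v H"
  and pd_uminus [simp]: "pd v (- F) = - pd v F"
  and pd_zero [simp]: "pd v 0 = 0"
  and pd_scaled [simp]: "pd v (\<lambda>vs. r * F vs) = (\<lambda>vs. r * pd v F vs)"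
  by (auto simp: pd_def fun_eq_iff)

lemma multilinear_add: "multilinear F \<Longrightarrow> multilinear H \<Longrightarrow> multilinear (F + H)"
  unfolding multilinear_def by (simp add: linear_compose_add)

lemma multilinear_diff: "multilinear F \<Longrightarrow> multilinear H \<Longrightarrow> multilinear (F - H)"
  unfolding multilinear_def by (simp add: linear_compose_sub)

context graded_space
begin

lemma sgn_form_plus [simp]: "sgn_form V (F + H) = sgn_form V F + sgn_form V H"
  and sgn_form_minus [simp]: "sgn_form V (F - H) = sgn_form V F - sgn_form V H"
  and sgn_form_uminus [simp]: "sgn_form V (- F) = - sgn_form V F"
  and sgn_form_zero [simp]: "sgn_form V 0 = 0"
  and sgn_form_scaled [simp]: "sgn_form V (\<lambda>vs. r * F vs) = (\<lambda>vs. r * sgn_form V F vs)"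
  by (auto simp: sgn_form_def fun_eq_iff)

lemma sgn_form_sgn_form [simp]: "sgn_form V (sgn_form V F) = F"
  by (rule ext) (simp add: sgn_form_def o_def)

lemma pd_sgn_form: "pd v (sgn_form V F) = sgn_form V (pd (parity V v) F)"
  by (rule ext) (simp add: pd_def sgn_form_def)

lemma multilinear_sgn_form: assumes "multilinear F" shows "multilinear (sgn_form V F)"
  unfolding multilinear_def
proof (intro allI)
  fix xs ys
  have "linear ((\<lambda>v. F (map (parity V) xs @ v # map (parity V) ys)) \<circ> parity V)"
    using assms by (intro linear_compose[OF linear_parity]) (simp add: multilinear_def)
  then show "linear (\<lambda>v. sgn_form V F (xs @ v # ys))" by (simp add: sgn_form_def o_def)
qed

lemma prod_form_plus_left [simp]: "prod_form V (F + F') H = prod_form V F H + prod_form V F' H"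
proof (rule ext)
  fix vs show "prod_form V (F + F') H vs = (prod_form V F H + prod_form V F' H) vs"
    by (induction vs arbitrary: F F' H) (auto simp: algebra_simps)
qed

lemma prod_form_plus_right [simp]: "prod_form V F (H + H') = prod_form V F H + prod_form V F H'"
proof (rule ext)
  fix vs show "prod_form V F (H + H') vs = (prod_form V F H + prod_form V F H') vs"
    by (induction vs arbitrary: F H H') (auto simp: algebra_simps)
qed

lemma prod_form_scale_left [simp]:
  "prod_form V (\<lambda>vs. r * F vs) H = (\<lambda>vs. r * prod_form V F H vs)"
proof (rule ext)
  fix vs show "prod_form V (\<lambda>vs. r * F vs) H vs = r * prod_form V F H vs"
    by (induction vs arbitrary: F H) (auto simp: algebra_simps)
qed

lemma prod_form_scale_right [simp]:
  "prod_form V F (\<lambda>vs. r * H vs) = (\<lambda>vs. r * prod_form V F H vs)"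
proof (rule ext)
  fix vs show "prod_form V F (\<lambda>vs. r * H vs) vs = r * prod_form V F H vs"
    by (induction vs arbitrary: F H) (auto simp: algebra_simps)
qed

lemma uminus_scaled: "- F = (\<lambda>vs. (-1) * (F :: 'v form) vs)"
  by (simp add: fun_eq_iff)

lemma prod_form_uminus_left [simp]: "prod_form V (- F) H = - prod_form V F H"
  and prod_form_uminus_right [simp]: "prod_form V F (- H) = - prod_form V F H"
  unfolding uminus_scaled by (rule prod_form_scale_left, rule prod_form_scale_right)

lemma prod_form_minus_left [simp]:
  "prod_form V (F - F') H = prod_form V F H - prod_form V F' H"
  using prod_form_plus_left[of F "- F'" H] by simp

lemma prod_form_minus_right [simp]:
  "prod_form V F (H - H') = prod_form V F H - prod_form V F H'"
  using prod_form_plus_right[of F H "- H'"] by simp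

lemma prod_form_zero_left [simp]: "prod_form V 0 H = 0"
  using prod_form_minus_left[of 0 0 H] by simp

lemma prod_form_zero_right [simp]: "prod_form V F 0 = 0"
  using prod_form_minus_right[of F 0 0] by simp

lemma pd_prod_form: "pd v (prod_form V F H) = prod_form V (pd v F) H
    + prod_form V F (pd (even_part V v) H) + prod_form V (sgn_form V F) (pd (odd_part V v) H)"
  by (rule ext) (simp add: pd_def[of v "prod_form V F H"])

lemma sgn_form_prod_form:
  assumes "multilinear H"
  shows "sgn_form V (prod_form V F H) = prod_form V (sgn_form V F) (sgn_form V H)"
proof (rule ext)
  fix vs show "sgn_form V (prod_form V F H) vs = prod_form V (sgn_form V F) (sgn_form V H) vs"
    using assms
  proof (induction vs arbitrary: F H)
    case Nil then show ?case by (simp add: sgn_form_def)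
  next
    case (Cons v vs)
    have "sgn_form V (prod_form V F H) (v # vs)
        = sgn_form V (pd (parity V v) (prod_form V F H)) vs"
      by (simp add: sgn_form_def pd_def)
    then show ?case
      by (simp add: pd_prod_form Cons.IH Cons.prems multilinear_pd pd_sgn_form pd_neg)
  qed
qed

lemma prod_form_assoc:
  assumes "multilinear H" "multilinear L"
  shows "prod_form V (prod_form V F H) L = prod_form V F (prod_form V H L)"
proof (rule ext)
  fix vs show "prod_form V (prod_form V F H) L vs = prod_form V F (prod_form V H L) vs"
    using assms
  proof (induction vs arbitrary: F H L)
    case Nil then show ?case by simp
  next
    case (Cons v vs)
    then show ?case
      by (simp add: pd_prod_form multilinear_pd multilinear_sgn_form sgn_form_prod_form pd_0)
  qed
qed

lemma pd_unit_form [simp]: "pd v unit_form = 0"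
  and sgn_form_unit_form [simp]: "sgn_form V unit_form = unit_form"
  by (auto simp: pd_def unit_form_def sgn_form_def fun_eq_iff)

lemma prod_form_unit_left: assumes "multilinear H" shows "prod_form V unit_form H = H"
proof (rule ext)
  fix vs show "prod_form V unit_form H vs = H vs" using assms
  proof (induction vs arbitrary: H)
    case Nil then show ?case by (simp add: unit_form_def)
  next
    case (Cons v vs)
    have "prod_form V unit_form H (v # vs) = (pd (even_part V v) H + pd (odd_part V v) H) vs"
      by (simp add: Cons.IH Cons.prems multilinear_pd)
    also have "\<dots> = H (v # vs)"
      by (simp flip: pd_add[OF Cons.prems] add: even_odd_sum) (simp add: pd_def)
    finally show ?case .
  qed
qed

lemma prod_form_unit_right: assumes "multilinear F" shows "prod_form V F unit_form = F"
proof (rule ext)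
  fix vs show "prod_form V F unit_form vs = F vs"
    by (induction vs arbitrary: F) (simp_all add: unit_form_def pd_def)
qed

lemma prod_form_commute_aux:
  assumes "multilinear F" "multilinear H"
  shows "2 * prod_form V F H vs = prod_form V H F vs + prod_form V H (sgn_form V F) vs
     + prod_form V (sgn_form V H) F vs - prod_form V (sgn_form V H) (sgn_form V F) vs"
  using assms
proof (induction vs arbitrary: F H)
  case Nil then show ?case by (simp add: sgn_form_def)
next
  case (Cons v vs)
  note ml = multilinear_pd multilinear_sgn_form Cons.prems
  have F: "pd v F = pd (even_part V v) F + pd (odd_part V v) F"
    and F': "pd (parity V v) F = pd (even_part V v) F - pd (odd_part V v) F"
    and H': "pd (parity V v) H = pd (even_part V v) H - pd (odd_part V v) H"
    and H: "pd v H = pd (even_part V v) H + pd (odd_part V v) H"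
    using pd_add[OF Cons.prems(1), of "even_part V v" "odd_part V v"]
      pd_diff[OF Cons.prems(1), of "even_part V v" "odd_part V v"]
      pd_add[OF Cons.prems(2), of "even_part V v" "odd_part V v"]
      pd_diff[OF Cons.prems(2), of "even_part V v" "odd_part V v"]
    by (simp_all only: even_odd_sum parity_even_odd)
  have IH1: "2 * prod_form V (pd u F) H vs
     = prod_form V H (pd u F) vs + prod_form V H (sgn_form V (pd u F)) vs
     + prod_form V (sgn_form V H) (pd u F) vs
     - prod_form V (sgn_form V H) (sgn_form V (pd u F)) vs" for u
    by (rule Cons.IH) (auto intro: ml)
  have IH2: "2 * prod_form V F (pd u H) vs
     = prod_form V (pd u H) F vs + prod_form V (pd u H) (sgn_form V F) vs
     + prod_form V (sgn_form V (pd u H)) F vs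
     - prod_form V (sgn_form V (pd u H)) (sgn_form V F) vs" for u
    by (rule Cons.IH) (auto intro: ml)
  have IH3: "2 * prod_form V (sgn_form V F) (pd u H) vs
     = prod_form V (pd u H) (sgn_form V F) vs + prod_form V (pd u H) F vs
     + prod_form V (sgn_form V (pd u H)) (sgn_form V F) vs
     - prod_form V (sgn_form V (pd u H)) F vs" for u
    using Cons.IH[OF multilinear_sgn_form[OF Cons.prems(1)] multilinear_pd[OF Cons.prems(2)]]
    unfolding sgn_form_sgn_form .
  show ?case
    unfolding prod_form.simps pd_sgn_form parity_even_part parity_odd_part
      pd_neg[OF Cons.prems(1)] pd_neg[OF Cons.prems(2)] F H F' H' sgn_form_plus sgn_form_minus
      sgn_form_uminus sgn_form_sgn_form
      prod_form_plus_left prod_form_plus_right prod_form_minus_left prod_form_minus_right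
      prod_form_uminus_left prod_form_uminus_right plus_fun_apply minus_apply uminus_apply
    using IH1[of "even_part V v"] IH1[of "odd_part V v"] IH2[of "even_part V v"]
      IH3[of "odd_part V v"]
    by (simp only: distrib_left)
qed

text \<open>\<open>F H = (-1)\<^bsup>|F| |H|\<^esup> H F\<close>, with the parities of \<open>F\<close> and \<open>H\<close> given by \<open>sgn_form\<close>.\<close>

lemma prod_form_commute:
  assumes "multilinear F" "multilinear H"
  shows "sgn_form V F = F \<Longrightarrow> prod_form V F H = prod_form V H F"
    and "sgn_form V F = - F \<Longrightarrow> sgn_form V H = - H \<Longrightarrow> prod_form V F H = - prod_form V H F"
proof -
  assume *: "sgn_form V F = F"
  show "prod_form V F H = prod_form V H F"
    by (rule ext) (use prod_form_commute_aux[OF assms] in \<open>simp add: *\<close>)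
next
  assume *: "sgn_form V F = - F" "sgn_form V H = - H"
  show "prod_form V F H = - prod_form V H F"
    by (rule ext) (use prod_form_commute_aux[OF assms] in \<open>simp add: *\<close>)
qed

lemma Sym_multilinear: "F \<in> Sym V \<Longrightarrow> multilinear F"
  by (simp add: Sym_def)

lemma multilinear_prod_form:
  assumes "multilinear F" "multilinear H" shows "multilinear (prod_form V F H)"
  unfolding multilinear_def
proof (intro allI)
  fix xs ys
  show "linear (\<lambda>v. prod_form V F H (xs @ v # ys))" using assms
  proof (induction xs arbitrary: F H)
    case Nil
    note F = Nil.prems(1) and H = Nil.prems(2)
    show ?case
    proof (rule linearI)
      fix v w
      show "prod_form V F H ([] @ (v + w) # ys)
          = prod_form V F H ([] @ v # ys) + prod_form V F H ([] @ w # ys)"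
        unfolding append_Nil prod_form.simps even_part_add odd_part_add pd_add[OF F] pd_add[OF H]
          prod_form_plus_left prod_form_plus_right plus_fun_apply by (simp only: add_ac)
    next
      fix r v
      show "prod_form V F H ([] @ (r *\<^sub>R v) # ys) = r *\<^sub>R prod_form V F H ([] @ v # ys)"
        unfolding append_Nil prod_form.simps even_part_scale odd_part_scale pd_scale[OF F]
          pd_scale[OF H] prod_form_scale_left prod_form_scale_right real_scaleR_def
        by (simp only: distrib_left)
    qed
  next
    case (Cons x xs)
    note IH = Cons.IH[OF multilinear_pd[OF Cons.prems(1)] Cons.prems(2)]
      Cons.IH[OF Cons.prems(1) multilinear_pd[OF Cons.prems(2)]]
      Cons.IH[OF multilinear_sgn_form[OF Cons.prems(1)] multilinear_pd[OF Cons.prems(2)]]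
    show ?case unfolding append_Cons prod_form.simps
      by (rule linear_compose_add[OF linear_compose_add[OF IH(1) IH(2)] IH(3)])
  qed
qed

lemma SymI:
  assumes "multilinear F"
    and "\<And>xs ys d e v w. v \<in> V d \<Longrightarrow> w \<in> V e \<Longrightarrow>
      F (xs @ v # w # ys) = (-1) powi (d * e) * F (xs @ w # v # ys)"
  shows "F \<in> Sym V"
  unfolding Sym_def by (intro CollectI conjI allI ballI assms)

lemma Sym_swap_args:
  assumes "F \<in> Sym V" "v \<in> V d" "w \<in> V e"
  shows "F (xs @ v # w # ys) = (-1) powi (d * e) * F (xs @ w # v # ys)"
  using assms unfolding Sym_def by blast

lemma Sym_pd: assumes "F \<in> Sym V" shows "pd v F \<in> Sym V"
proof (rule SymI)
  fix xs ys d e x w assume "x \<in> V d" "w \<in> V e"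
  from Sym_swap_args[OF assms this, of "v # xs"]
  show "pd v F (xs @ x # w # ys) = (-1) powi (d * e) * pd v F (xs @ w # x # ys)"
    by (simp add: pd_def)
qed (rule multilinear_pd[OF Sym_multilinear[OF assms]])

lemma parity_in: "v \<in> V d \<Longrightarrow> parity V v \<in> V d"
  by (simp add: parity_homogeneous subspace_scale subspace_degree)

lemma Sym_sgn_form: assumes "F \<in> Sym V" shows "sgn_form V F \<in> Sym V"
proof (rule SymI)
  fix xs ys d e x w assume "x \<in> V d" "w \<in> V e"
  from Sym_swap_args[OF assms parity_in[OF this(1)] parity_in[OF this(2)]]
  show "sgn_form V F (xs @ x # w # ys) = (-1) powi (d * e) * sgn_form V F (xs @ w # x # ys)"
    by (simp add: sgn_form_def)
qed (rule multilinear_sgn_form[OF Sym_multilinear[OF assms]])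

lemma Sym_swap:
  assumes "F \<in> Sym V" "v \<in> V d" "w \<in> V e"
  shows "pd w (pd v F) = (\<lambda>vs. (-1) powi (d * e) * pd v (pd w F) vs)"
  by (rule ext) (use Sym_swap_args[OF assms, of "[]"] in \<open>simp add: pd_def\<close>)

lemma Sym_swap_cases:
  assumes "F \<in> Sym V" "v \<in> V d" "w \<in> V e"
  shows "pd w (pd v F) = (if odd d \<and> odd e then - pd v (pd w F) else pd v (pd w F))"
  unfolding Sym_swap[OF assms] by (auto simp: fun_eq_iff power_int_minus_left)

lemma Sym_prod_form:
  assumes "F \<in> Sym V" "H \<in> Sym V" shows "prod_form V F H \<in> Sym V"
proof (rule SymI)
  show "multilinear (prod_form V F H)"
    by (intro multilinear_prod_form Sym_multilinear assms)
  fix xs ys d e v w assume vw: "v \<in> V d" "w \<in> V e"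
  show "prod_form V F H (xs @ v # w # ys)
      = (-1) powi (d * e) * prod_form V F H (xs @ w # v # ys)"
    using assms
  proof (induction xs arbitrary: F H)
    case Nil
    note ml = multilinear_pd Sym_multilinear[OF Nil.prems(1)] Sym_multilinear[OF Nil.prems(2)]
    note F = Sym_swap_cases[OF Nil.prems(1) vw] and H = Sym_swap_cases[OF Nil.prems(2) vw]
    show ?case
      by (cases "even d"; cases "even e")
        (simp_all add: parts_homogeneous[OF vw(1)] parts_homogeneous[OF vw(2)] F H pd_sgn_form
          parity_homogeneous[OF vw(1)] parity_homogeneous[OF vw(2)] pd_neg pd_0 ml
          power_int_minus_left)
  next
    case (Cons x xs)
    show ?case
      by (simp add: Cons.IH[OF Sym_pd[OF Cons.prems(1)] Cons.prems(2)]
          Cons.IH[OF Cons.prems(1) Sym_pd[OF Cons.prems(2)]]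
          Cons.IH[OF Sym_sgn_form[OF Cons.prems(1)] Sym_pd[OF Cons.prems(2)]]
          distrib_left)
  qed
qed

lemma derivation_plus [simp]: "derivation V a (F + H) = derivation V a F + derivation V a H"
proof (rule ext)
  fix vs show "derivation V a (F + H) vs = (derivation V a F + derivation V a H) vs"
    by (induction vs arbitrary: F H) auto
qed

lemma derivation_uminus [simp]: "derivation V a (- F) = - derivation V a F"
proof (rule ext)
  fix vs show "derivation V a (- F) vs = (- derivation V a F) vs"
    by (induction vs arbitrary: F) auto
qed

lemma derivation_minus [simp]: "derivation V a (F - H) = derivation V a F - derivation V a H"
proof (rule ext)
  fix vs show "derivation V a (F - H) vs = (derivation V a F - derivation V a H) vs"
    by (induction vs arbitrary: F H) auto
qed

lemma pd_derivation:
  "pd v (derivation V a F) = derivation V a (pd (parity V v) F) + pd (a (parity V v)) F"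
  by (rule ext) (simp add: pd_def[of v "derivation V a F"] pd_def[of "a (parity V v)"])

lemma odd_map_parity:
  assumes "linear a" "odd e" "\<And>d v. v \<in> V d \<Longrightarrow> a v \<in> V (d + e)"
  shows "parity V (a v) = - a (parity V v)"
proof (rule linear_eq_homogeneous[where f = "\<lambda>v. parity V (a v)" and g = "\<lambda>v. - a (parity V v)"])
  show "linear (\<lambda>v. parity V (a v))"
    using linear_compose[OF assms(1) linear_parity] by (simp add: o_def)
  show "linear (\<lambda>v. - a (parity V v))"
    using linear_compose_neg[OF linear_compose[OF linear_parity assms(1)]] by (simp add: o_def)
  fix d v assume v: "v \<in> V d"
  have "parity V (a v) = ((-1) powi (d + e) :: real) *\<^sub>R a v"
    by (rule parity_homogeneous[OF assms(3)[OF v]])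
  then show "parity V (a v) = - a (parity V v)"
    using assms(2) by (simp add: parity_homogeneous[OF v] linear_cmul[OF assms(1)]
        power_int_minus_left)
qed

context
  fixes a
  assumes linear_a: "linear a" and odd_a: "\<And>v. parity V (a v) = - a (parity V v)"
begin

lemma even_part_odd_map: "even_part V (a v) = a (odd_part V v)"
  and odd_part_odd_map: "odd_part V (a v) = a (even_part V v)"
  by (simp_all add: even_part_def odd_part_def odd_a linear_cmul[OF linear_a]
      linear_add[OF linear_a] linear_diff[OF linear_a])

lemma derivation_sgn_form:
  assumes "multilinear F"
  shows "derivation V a (sgn_form V F) = - sgn_form V (derivation V a F)"
proof (rule ext)
  fix vs show "derivation V a (sgn_form V F) vs = (- sgn_form V (derivation V a F)) vs"
    using assms
  proof (induction vs arbitrary: F)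
    case Nil then show ?case by (simp add: sgn_form_def)
  next
    case (Cons v vs)
    have 1: "pd (parity V v) (sgn_form V F) = sgn_form V (pd v F)"
      by (simp add: pd_sgn_form)
    have 2: "sgn_form V F (a (parity V v) # vs) = pd (- a v) F (map (parity V) vs)"
      by (simp add: sgn_form_def pd_def odd_a)
    have "derivation V a (sgn_form V F) (v # vs)
        = (- sgn_form V (derivation V a (pd v F))) vs - pd (a v) F (map (parity V) vs)"
      unfolding derivation.simps 1 2 Cons.IH[OF multilinear_pd[OF Cons.prems], of v]
        pd_neg[OF Cons.prems] by simp
    also have "\<dots> = - (derivation V a (pd v F) (map (parity V) vs) + F (a v # map (parity V) vs))"
      by (simp only: sgn_form_def pd_def uminus_apply)
    finally show ?case
      unfolding uminus_apply sgn_form_def[of V "derivation V a F" "v # vs"] by simp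
  qed
qed

lemma derivation_mult:
  assumes "multilinear F" "multilinear H"
  shows "derivation V a (prod_form V F H)
    = prod_form V (derivation V a F) H + prod_form V (sgn_form V F) (derivation V a H)"
proof (rule ext)
  fix vs show "derivation V a (prod_form V F H) vs
      = (prod_form V (derivation V a F) H + prod_form V (sgn_form V F) (derivation V a H)) vs"
    using assms
  proof (induction vs arbitrary: F H)
    case Nil then show ?case by simp
  next
    case (Cons v vs)
    note F = Cons.prems(1) and H = Cons.prems(2)
    note IH = Cons.IH[OF multilinear_pd[OF F] H, of "parity V v"]
      Cons.IH[OF F multilinear_pd[OF H], of "even_part V v"]
      Cons.IH[OF multilinear_sgn_form[OF F] multilinear_pd[OF H], of "odd_part V v"]
    have "derivation V a (prod_form V F H) (v # vs)
        = (derivation V a (prod_form V (pd (parity V v) F) H)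
          + derivation V a (prod_form V F (pd (even_part V v) H))
          - derivation V a (prod_form V (sgn_form V F) (pd (odd_part V v) H))
          + pd (a (parity V v)) (prod_form V F H)) vs"
      by (simp add: pd_prod_form pd_neg[OF H] pd_def[of "a (parity V v)" "prod_form V F H", symmetric]
          del: prod_form.simps)
    moreover have "derivation V a (prod_form V (sgn_form V F) (pd (odd_part V v) H)) vs
        = prod_form V F (derivation V a (pd (odd_part V v) H)) vs
          - prod_form V (sgn_form V (derivation V a F)) (pd (odd_part V v) H) vs"
      unfolding IH(3) derivation_sgn_form[OF F] prod_form_uminus_left sgn_form_sgn_form
      by simp
    ultimately show ?case
      using IH(1,2)
      by (simp add: pd_prod_form pd_derivation even_part_odd_map odd_part_odd_map
          linear_neg[OF linear_a] pd_neg[OF H] pd_sgn_form)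
  qed
qed

end

lemma derivation_functional:
  assumes "linear a" "odd e" "\<And>d v. v \<in> V d \<Longrightarrow> a v \<in> V (d + e)"
    and "linear \<phi>" "\<And>d v. v \<in> V d \<Longrightarrow> d \<noteq> - n \<Longrightarrow> \<phi> v = 0"
  shows "derivation V a (functional V \<phi>) = functional V (\<lambda>v. (-1) powi n * \<phi> (a v))"
proof (rule ext)
  fix vs
  have odd_a: "parity V (a v) = - a (parity V v)" for v by (rule odd_map_parity[OF assms(1-3)])
  have 0: "derivation V a (\<lambda>ws. case ws of [] \<Rightarrow> c | _ \<Rightarrow> 0) ws = 0" for c ws
  proof (cases ws)
    case (Cons w ws')
    have "pd (parity V w) (\<lambda>ws. case ws of [] \<Rightarrow> c | _ \<Rightarrow> 0) = 0"
      by (auto simp: pd_def fun_eq_iff)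
    then show ?thesis using derivation_minus[of a 0 0] by (simp add: Cons)
  qed simp
  have *: "- \<phi> (a v) = (-1) powi n * \<phi> (a (parity V v))" for v
  proof (rule linear_eq_homogeneous[where f = "\<lambda>v. - \<phi> (a v)"
        and g = "\<lambda>v. (-1) powi n * \<phi> (a (parity V v))"])
    show "linear (\<lambda>v. - \<phi> (a v))"
      using linear_compose_neg[OF linear_compose[OF assms(1,4)]] by (simp add: o_def)
    show "linear (\<lambda>v. (-1) powi n * \<phi> (a (parity V v)))"
      using linear_compose_scale_right[OF
          linear_compose[OF linear_parity linear_compose[OF assms(1,4)]], of "(-1) powi n"]
      by (simp add: o_def)
    fix d v assume v: "v \<in> V d"
    show "- \<phi> (a v) = (-1) powi n * \<phi> (a (parity V v))"
    proof (cases "d + e = - n")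
      case True
      then have "even d \<longleftrightarrow> odd n" using assms(2) by presburger
      then show ?thesis by (simp add: parity_homogeneous[OF v] linear_cmul[OF assms(1)]
            linear_cmul[OF assms(4)] power_int_minus_left)
    next
      case False
      then show ?thesis using assms(5)[OF assms(3)[OF v]]
        by (simp add: parity_homogeneous[OF v] linear_cmul[OF assms(1)] linear_cmul[OF assms(4)])
    qed
  qed
  have pd: "pd v (functional V \<phi>) = (\<lambda>ws. case ws of [] \<Rightarrow> \<phi> (parity V v) | _ \<Rightarrow> 0)" for v
    by (auto simp: pd_def functional_def fun_eq_iff split: list.splits)
  show "derivation V a (functional V \<phi>) vs = functional V (\<lambda>v. (-1) powi n * \<phi> (a v)) vs"
  proof (cases vs)
    case Nil then show ?thesis by (simp add: functional_def)
  next
    case (Cons v ws)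
    have "derivation V a (functional V \<phi>) vs = pd (a (parity V v)) (functional V \<phi>) ws"
      by (simp add: Cons pd 0) (simp add: functional_def split: list.splits)
    then show ?thesis
      using *[of v] by (auto simp: Cons pd odd_a functional_def linear_neg[OF assms(4)]
          split: list.splits)
  qed
qed
end

lemma linear_sum_list:
  "(\<And>x. x \<in> set xs \<Longrightarrow> linear (f x)) \<Longrightarrow> linear (\<lambda>v. \<Sum>x\<leftarrow>xs. f x v)"
proof (induction xs)
  case Nil then show ?case by (simp add: linear_zero)
next
  case (Cons x xs)
  have "linear (\<lambda>v. f x v + (\<Sum>y\<leftarrow>xs. f y v))"
    by (intro linear_compose_add Cons.prems Cons.IH) auto
  then show ?case by simp
qed

lemma sum_list_pair_linear:
  "linear f \<Longrightarrow> f (\<Sum>(a, b)\<leftarrow>K0. g a b) = (\<Sum>(a, b)\<leftarrow>K0. f (g a b))"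
  by (induction K0) (auto simp: linear_0 linear_add)

lemma finite_basis:
  fixes B0 :: "'v::real_vector set"
  assumes "finite B0" "span B0 = UNIV"
  obtains B :: "'v set" where "finite B" "independent B" "span B = UNIV"
proof -
  obtain B where "B \<subseteq> B0" "independent B" "B0 \<subseteq> span B"
    using maximal_independent_subset[of B0] by blast
  moreover have "span B = UNIV"
    using span_minimal[OF \<open>B0 \<subseteq> span B\<close> subspace_span] assms(2) by (metis top.extremum_uniqueI)
  ultimately show thesis using that finite_subset[OF _ assms(1)] by blast
qed

lemma linear_representation:
  assumes "independent B" "span B = UNIV" shows "linear (\<lambda>v. representation B v b)"
  using assms by (intro linearI) (auto simp: representation_add representation_scale)

lemma bilinear_iff: "bilinear f \<longleftrightarrow> (\<forall>x. linear (f x)) \<and> (\<forall>y. linear (\<lambda>x. f x y))"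
  unfolding bilinear_def by simp

context dg_symplectic
begin

lemma linear_pairing_left: "linear (\<lambda>v. \<omega> v w)" and linear_pairing_right: "linear (\<omega> v)"
  using bilinear_pairing unfolding bilinear_iff by auto

lemmas pairing_simps =
  linear_add[OF linear_pairing_left] linear_cmul[OF linear_pairing_left]
  linear_diff[OF linear_pairing_left] linear_neg[OF linear_pairing_left]
  linear_add[OF linear_pairing_right] linear_cmul[OF linear_pairing_right]
  linear_diff[OF linear_pairing_right] linear_neg[OF linear_pairing_right]

lemma pairing_represents:
  assumes fin: "finite B0" "span B0 = (UNIV :: 'v set)" and f: "linear (f :: 'v \<Rightarrow> real)"
  shows "\<exists>b. \<forall>v. f v = \<omega> b v"
proof -
  obtain B :: "'v set" where B: "finite B" "independent B" "span B = UNIV"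
    by (rule finite_basis[OF fin])
  interpret B: finite_dimensional_vector_space "(*\<^sub>R) :: real \<Rightarrow> 'v \<Rightarrow> 'v" B
    by unfold_locales (use B in \<open>auto simp: dependent_raw_def span_raw_def\<close>)
  define T where "T v = (\<Sum>c\<in>B. \<omega> v c *\<^sub>R c)" for v
  have T: "linear T"
    by (rule linearI) (simp_all add: T_def pairing_simps scaleR_left.add sum.distrib
        scaleR_sum_right)
  have coeff: "g c = h c" if "(\<Sum>c\<in>B. g c *\<^sub>R c) = (\<Sum>c\<in>B. h c *\<^sub>R c)" "c \<in> B" for g h c
  proof -
    have "(\<Sum>c\<in>B. (g c - h c) *\<^sub>R c) = 0"
      using that(1) by (simp add: scaleR_diff_left sum_subtractf)
    then show ?thesis using independentD[OF B(2,1) subset_refl, of "\<lambda>c. g c - h c"] that(2)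
      by auto
  qed
  have on_basis: "g v = h v" if "linear (g :: 'v \<Rightarrow> real)" "linear h" "\<And>c. c \<in> B \<Longrightarrow> g c = h c" for g h v
    by (rule linear_eq_on_span[OF that(1,2,3), of B]) (simp_all add: B(3))
  have "inj T"
    unfolding linear_injective_0[OF T]
  proof (intro allI impI)
    fix v assume "T v = 0"
    then have "(\<Sum>c\<in>B. \<omega> v c *\<^sub>R c) = (\<Sum>c\<in>B. 0 *\<^sub>R c)" by (simp add: T_def)
    from coeff[OF this] have "\<omega> v w = 0" for w
      by (rule on_basis[OF linear_pairing_right linear_zero])
    then show "v = 0" by (rule nondegenerate)
  qed
  then have "surj T"
    using B.linear_inj_imp_surj[of T] T by (simp only: linear_def)
  then obtain b where b: "T b = (\<Sum>c\<in>B. f c *\<^sub>R c)" using surjD[of T] by metis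
  have "f v = \<omega> b v" for v
    by (rule on_basis[OF f linear_pairing_right], rule coeff[OF b[unfolded T_def], symmetric])
  then show ?thesis by blast
qed

lemma copairing_sum:
  assumes "is_copairing V \<omega> K0"
  shows "(\<Sum>(a, b)\<leftarrow>K0. \<omega> b v *\<^sub>R a) = parity V v"
proof (rule linear_eq_homogeneous[where f = "\<lambda>v. \<Sum>(a, b)\<leftarrow>K0. \<omega> b v *\<^sub>R a" and g = "parity V"])
  show "linear (\<lambda>v. \<Sum>(a, b)\<leftarrow>K0. \<omega> b v *\<^sub>R a)"
    by (rule linear_sum_list)
      (auto intro!: linearI simp: pairing_simps scaleR_add_left split: prod.splits)
  fix d v assume v: "v \<in> V d"
  let ?s = "\<Sum>(a, b)\<leftarrow>K0. \<omega> b v *\<^sub>R a"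
  have "v = ((-1) powi d :: real) *\<^sub>R ?s"
    using assms v unfolding is_copairing_def by simp
  then have "parity V v = ((-1) powi d :: real) *\<^sub>R (((-1) powi d :: real) *\<^sub>R ?s)"
    using parity_homogeneous[OF v] by simp
  then show "?s = parity V v" by (simp add: powi_square)
qed (rule linear_parity)

lemma copairingI:
  assumes "\<And>v. (\<Sum>(a, b)\<leftarrow>K0. \<omega> b v *\<^sub>R a) = parity V v"
  shows "is_copairing V \<omega> K0"
  unfolding is_copairing_def assms by (simp add: parity_homogeneous powi_square)

context
  fixes B0 :: "'v set"
  assumes fin: "finite B0" "span B0 = UNIV"
begin

lemma copairing_exists: "\<exists>K0. is_copairing V \<omega> K0"
proof -
  obtain B :: "'v set" where B: "finite B" "independent B" "span B = UNIV"
    by (rule finite_basis[OF fin])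
  have "\<exists>b. \<forall>v. representation B (parity V v) c = \<omega> b v" for c
    using linear_compose[OF linear_parity linear_representation[OF B(2,3)]]
    by (intro pairing_represents[OF fin]) (simp add: o_def)
  then obtain b where b: "\<And>c v. representation B (parity V v) c = \<omega> (b c) v" by metis
  obtain cs where cs: "set cs = B" "distinct cs" using finite_distinct_list[OF B(1)] by blast
  have "(\<Sum>(a, b)\<leftarrow>map (\<lambda>c. (c, b c)) cs. \<omega> b v *\<^sub>R a) = parity V v" for v
  proof -
    have "(\<Sum>(a, b)\<leftarrow>map (\<lambda>c. (c, b c)) cs. \<omega> b v *\<^sub>R a) = (\<Sum>c\<leftarrow>cs. \<omega> (b c) v *\<^sub>R c)"
      by (simp add: o_def)
    also have "\<dots> = (\<Sum>c\<in>B. representation B (parity V v) c *\<^sub>R c)"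
      using cs by (simp add: b sum_list_distinct_conv_sum_set)
    also have "\<dots> = parity V v"
      using B by (intro sum_representation_eq) auto
    finally show ?thesis .
  qed
  then show ?thesis using copairingI by blast
qed

lemma is_copairing_copairing: "is_copairing V \<omega> (copairing V \<omega>)"
  unfolding copairing_def by (rule someI_ex, rule copairing_exists)

lemma copairing_unique:
  assumes K: "is_copairing V \<omega> K1" "is_copairing V \<omega> K2" and L: "bilinear (L :: 'v \<Rightarrow> 'v \<Rightarrow> real)"
  shows "(\<Sum>(a, b)\<leftarrow>K1. L a b) = (\<Sum>(a, b)\<leftarrow>K2. L a b)"
proof -
  obtain B :: "'v set" where B: "finite B" "independent B" "span B = UNIV"
    by (rule finite_basis[OF fin])
  have L1: "linear (\<lambda>x. L x y)" and L2: "linear (L x)" for x y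
    using L unfolding bilinear_iff by auto
  have "\<exists>u. \<forall>y. representation B y c = \<omega> u y" for c
    by (intro pairing_represents[OF fin] linear_representation B)
  then obtain u where u: "\<And>y c. representation B y c = \<omega> (u c) y" by metis
  have *: "L a b = (\<Sum>c\<in>B. L (\<omega> b (- u c) *\<^sub>R a) c)" for a b
  proof -
    have "b = (\<Sum>c\<in>B. representation B b c *\<^sub>R c)"
      using B by (intro sum_representation_eq[symmetric]) auto
    also have "\<dots> = (\<Sum>c\<in>B. \<omega> b (- u c) *\<^sub>R c)"
      by (intro sum.cong refl) (simp add: u pairing_simps antisymmetric[of b])
    finally have "L a b = L a (\<Sum>c\<in>B. \<omega> b (- u c) *\<^sub>R c)" by simp
    then show ?thesis by (simp add: linear_sum[OF L2] linear_cmul[OF L1] linear_cmul[OF L2])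
  qed
  have "(\<Sum>(a, b)\<leftarrow>K0. L a b) = (\<Sum>c\<in>B. L (parity V (- u c)) c)"
    if "is_copairing V \<omega> K0" for K0
  proof -
    have "(\<Sum>(a, b)\<leftarrow>K0. L a b) = (\<Sum>(a, b)\<leftarrow>K0. \<Sum>c\<in>B. L (\<omega> b (- u c) *\<^sub>R a) c)"
      by (simp only: *[symmetric])
    also have "\<dots> = (\<Sum>c\<in>B. \<Sum>(a, b)\<leftarrow>K0. L (\<omega> b (- u c) *\<^sub>R a) c)"
      by (induction K0) (auto simp: sum.distrib)
    also have "\<dots> = (\<Sum>c\<in>B. L (parity V (- u c)) c)"
      unfolding copairing_sum[OF that, symmetric] sum_list_pair_linear[OF L1] ..
    finally show ?thesis .
  qed
  then show ?thesis using K by simp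
qed

lemma bilinear_pd_pd: "multilinear F \<Longrightarrow> bilinear (\<lambda>a b. pd a (pd b F) vs)"
  unfolding bilinear_iff
  by (auto intro!: linearI simp: pd_add pd_scale multilinear_pd)

lemma BV_copairing:
  assumes "is_copairing V \<omega> K0" "multilinear F"
  shows "BV V \<omega> F vs = - (1/2 * (\<Sum>(a, b)\<leftarrow>K0. pd a (pd b F) vs))"
  unfolding BV_def
  using copairing_unique[OF is_copairing_copairing assms(1) bilinear_pd_pd[OF assms(2)]] by simp

end

end

lemma bracket_arith: "- 1/2 * (A + B + (C + D) + E) - - 1/2 * A - - 1/2 * B
    = - 1/2 * (C + D) - 1/2 * (E :: real)"
  by (simp add: field_simps)

context dg_symplectic
begin

lemma q_parity: "parity V (q v) = - q (parity V v)"
  by (rule odd_map_parity[OF linear_q, of 1]) (auto simp: q_degree)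

lemma Q_prod_form:
  assumes "multilinear F" "multilinear H"
  shows "Q_op V q (prod_form V F H)
    = prod_form V (Q_op V q F) H + prod_form V (sgn_form V F) (Q_op V q H)"
proof -
  have *: "Q_op V q F = - derivation V q F" for F by (rule ext) (simp add: Q_op_def)
  show ?thesis
    unfolding * derivation_mult[OF linear_q q_parity assms] prod_form_uminus_left
      prod_form_uminus_right by simp
qed

lemma Q_functional:
  assumes "linear \<phi>" "\<And>d v. v \<in> V d \<Longrightarrow> d \<noteq> - n \<Longrightarrow> \<phi> v = 0"
  shows "Q_op V q (functional V \<phi>) = functional V (\<lambda>v. - ((-1) powi n) * \<phi> (q v))"
  using derivation_functional[OF linear_q _ q_degree assms]
  by (auto simp: Q_op_def functional_def fun_eq_iff split: list.splits)

lemma pairing_parity: "\<omega> (parity V v) (parity V w) = - \<omega> v w"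
proof (rule linear_eq_homogeneous[where f = "\<lambda>v. \<omega> (parity V v) (parity V w)" and g = "\<lambda>v. - \<omega> v w"])
  show "linear (\<lambda>v. \<omega> (parity V v) (parity V w))"
    using linear_compose[OF linear_parity linear_pairing_left] by (simp add: o_def)
  show "linear (\<lambda>v. - \<omega> v w)" by (intro linear_compose_neg linear_pairing_left)
  fix d v assume v: "v \<in> V d"
  show "\<omega> (parity V v) (parity V w) = - \<omega> v w"
  proof (rule linear_eq_homogeneous[where f = "\<lambda>w. \<omega> (parity V v) (parity V w)" and g = "\<lambda>w. - \<omega> v w"])
    show "linear (\<lambda>w. \<omega> (parity V v) (parity V w))"
      using linear_compose[OF linear_parity linear_pairing_right] by (simp add: o_def)
    show "linear (\<lambda>w. - \<omega> v w)" by (intro linear_compose_neg linear_pairing_right)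
    fix e w assume w: "w \<in> V e"
    show "\<omega> (parity V v) (parity V w) = - \<omega> v w"
    proof (cases "d + e = 1")
      case True
      then have "even d \<longleftrightarrow> odd e" by presburger
      then show ?thesis
        by (simp add: parity_homogeneous[OF v] parity_homogeneous[OF w] pairing_simps
            power_int_minus_left)
    next
      case False
      then show ?thesis
        using pairing_degree[OF v w] pairing_degree[OF parity_in[OF v] parity_in[OF w]] by simp
    qed
  qed
qed

lemma pairing_parity_left: "\<omega> (parity V v) w = - \<omega> v (parity V w)"
  using pairing_parity[of v "parity V w"] by simp

lemma pairing_q: "\<omega> (q (parity V v)) w = - \<omega> v (q w)"
proof (rule linear_eq_homogeneous[where f = "\<lambda>v. \<omega> (q (parity V v)) w" and g = "\<lambda>v. - \<omega> v (q w)"])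
  show "linear (\<lambda>v. \<omega> (q (parity V v)) w)"
    using linear_compose[OF linear_compose[OF linear_parity linear_q] linear_pairing_left]
    by (simp add: o_def)
  show "linear (\<lambda>v. - \<omega> v (q w))" by (intro linear_compose_neg linear_pairing_left)
  fix d v assume v: "v \<in> V d"
  have "\<omega> (q v) w = - ((-1) powi d * \<omega> v (q w))" using q_pairing[OF v, of w] by simp
  then show "\<omega> (q (parity V v)) w = - \<omega> v (q w)"
    by (simp add: parity_homogeneous[OF v] linear_cmul[OF linear_q] pairing_simps
        power_int_minus_left)
qed

lemma S_free_pair: "S_free_form V \<omega> q [v, w] = - \<omega> v (q w)"
  by (simp add: S_free_form_def pairing_q)

lemma S_free_other: "length vs \<noteq> 2 \<Longrightarrow> S_free_form V \<omega> q vs = 0"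
  by (auto simp: S_free_form_def numeral_2_eq_2 split: list.splits)

lemma multilinear_S_free: "multilinear (S_free_form V \<omega> q)"
  unfolding multilinear_def
proof (intro allI)
  fix xs ys :: "'v list"
  have zero: "linear (\<lambda>v. (S_free_form V \<omega> q) (xs @ v # ys))" if "length xs + length ys \<noteq> 1"
    using that by (simp add: S_free_other linear_zero)
  have left: "linear (\<lambda>v. S_free_form V \<omega> q [v, w])" for w
    unfolding S_free_pair by (intro linear_compose_neg linear_pairing_left)
  have right: "linear (\<lambda>w. S_free_form V \<omega> q [v, w])" for v
    unfolding S_free_pair
    using linear_compose_neg[OF linear_compose[OF linear_q linear_pairing_right]]
    by (simp add: o_def)
  consider "length xs + length ys \<noteq> 1" | w where "xs = [w]" "ys = []" | w where "xs = []" "ys = [w]"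
    by (cases xs; cases ys) auto
  then show "linear (\<lambda>v. (S_free_form V \<omega> q) (xs @ v # ys))"
    by cases (use zero left right in auto)
qed

lemma sgn_form_S_free: "sgn_form V (S_free_form V \<omega> q) = (S_free_form V \<omega> q)"
proof (rule ext)
  fix vs
  show "sgn_form V (S_free_form V \<omega> q) vs = S_free_form V \<omega> q vs"
  proof (cases "length vs = 2")
    case True
    then obtain v w where "vs = [v, w]" by (auto simp: numeral_2_eq_2 length_Suc_conv)
    moreover have "\<omega> (parity V v) (q (parity V w)) = \<omega> v (q w)"
      using pairing_parity[of v "q w"] by (simp add: q_parity pairing_simps)
    ultimately show ?thesis by (simp add: sgn_form_def S_free_pair)
  qed (simp add: sgn_form_def S_free_other)
qed

lemma pd_pd_S_free: "pd v (pd a (S_free_form V \<omega> q)) = (\<lambda>vs. - \<omega> a (q v) * unit_form vs)"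
proof (rule ext)
  fix vs show "pd v (pd a (S_free_form V \<omega> q)) vs = - \<omega> a (q v) * unit_form vs"
    by (cases vs) (simp_all add: pd_def S_free_pair unit_form_def S_free_other)
qed

lemma prod_form_sum_left:
  "prod_form V (\<lambda>vs. \<Sum>(a, b)\<leftarrow>L. f a b vs) H = (\<lambda>vs. \<Sum>(a, b)\<leftarrow>L. prod_form V (f a b) H vs)"
proof (induction L)
  case Nil show ?case using prod_form_zero_left[of H] by (simp add: fun_eq_iff zero_fun_def)
next
  case (Cons x L)
  obtain a b where x: "x = (a, b)" by (cases x)
  have *: "(\<lambda>vs. \<Sum>(a, b)\<leftarrow>x # L. f a b vs) = f a b + (\<lambda>vs. \<Sum>(a, b)\<leftarrow>L. f a b vs)"
    by (simp add: x fun_eq_iff)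
  show ?case unfolding * prod_form_plus_left Cons.IH by (simp add: x fun_eq_iff)
qed

lemma prod_form_sum_right:
  "prod_form V F (\<lambda>vs. \<Sum>(a, b)\<leftarrow>L. f a b vs) = (\<lambda>vs. \<Sum>(a, b)\<leftarrow>L. prod_form V F (f a b) vs)"
proof (induction L)
  case Nil show ?case using prod_form_zero_right[of F] by (simp add: fun_eq_iff zero_fun_def)
next
  case (Cons x L)
  obtain a b where x: "x = (a, b)" by (cases x)
  have *: "(\<lambda>vs. \<Sum>(a, b)\<leftarrow>x # L. f a b vs) = f a b + (\<lambda>vs. \<Sum>(a, b)\<leftarrow>L. f a b vs)"
    by (simp add: x fun_eq_iff)
  show ?case unfolding * prod_form_plus_right Cons.IH by (simp add: x fun_eq_iff)
qed

lemma pair_sum_add: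
  "(\<Sum>(a, b)\<leftarrow>L. f a b + g a b :: real) = (\<Sum>(a, b)\<leftarrow>L. f a b) + (\<Sum>(a, b)\<leftarrow>L. g a b)"
  by (induction L) auto

lemma pair_sum_neg:
  "(\<Sum>(a, b)\<leftarrow>L. - f a b :: real) = - (\<Sum>(a, b)\<leftarrow>L. f a b)"
  by (induction L) auto

lemma bilinear_prod_form_pd:
  assumes "multilinear F" "multilinear H" "linear f" "linear g"
  shows "bilinear (\<lambda>a b. prod_form V (pd (f a) F) (pd (g b) H) vs)"
  unfolding bilinear_iff
  by (auto intro!: linearI simp: linear_add[OF assms(3)] linear_add[OF assms(4)]
      linear_cmul[OF assms(3)] linear_cmul[OF assms(4)] pd_add[OF assms(1)] pd_add[OF assms(2)]
      pd_scale[OF assms(1)] pd_scale[OF assms(2)])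

lemma bilinear_flip: "bilinear (\<lambda>a b. L b a) \<longleftrightarrow> bilinear L"
  unfolding bilinear_iff by auto

context
  fixes B0 :: "'v set"
  assumes fin: "finite B0" "span B0 = UNIV"
begin

lemma copairing_swap_sum: "(\<Sum>(a, b)\<leftarrow>copairing V \<omega>. \<omega> a v *\<^sub>R b) = parity V v"
proof -
  have "\<omega> ((\<Sum>(a, b)\<leftarrow>copairing V \<omega>. \<omega> a v *\<^sub>R b) - parity V v) u = 0" for u
  proof -
    have "\<omega> (\<Sum>(a, b)\<leftarrow>copairing V \<omega>. \<omega> a v *\<^sub>R b) u = (\<Sum>(a, b)\<leftarrow>copairing V \<omega>. \<omega> (\<omega> a v *\<^sub>R b) u)"
      by (rule sum_list_pair_linear[OF linear_pairing_left])
    also have "\<dots> = (\<Sum>(a, b)\<leftarrow>copairing V \<omega>. \<omega> (\<omega> b u *\<^sub>R a) v)"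
      by (simp add: pairing_simps mult.commute)
    also have "\<dots> = \<omega> (parity V u) v"
      unfolding copairing_sum[OF is_copairing_copairing[OF fin], symmetric]
      by (rule sum_list_pair_linear[OF linear_pairing_left, symmetric])
    also have "\<dots> = \<omega> (parity V v) u"
      using pairing_parity_left[of u v] antisymmetric[of u "parity V v"] by simp
    finally show ?thesis by (simp add: pairing_simps)
  qed
  from nondegenerate[OF this] show ?thesis by simp
qed

lemma copairing_swap:
  assumes "bilinear (L :: 'v \<Rightarrow> 'v \<Rightarrow> real)"
  shows "(\<Sum>(a, b)\<leftarrow>copairing V \<omega>. L b a) = (\<Sum>(a, b)\<leftarrow>copairing V \<omega>. L a b)"
proof -
  have "is_copairing V \<omega> (map (\<lambda>(a, b). (b, a)) (copairing V \<omega>))"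
    by (rule copairingI) (simp add: copairing_swap_sum[symmetric] o_def case_prod_beta')
  from copairing_unique[OF fin this is_copairing_copairing[OF fin] assms] show ?thesis
    by (simp add: o_def case_prod_beta')
qed

lemma copairing_parity:
  assumes "bilinear (L :: 'v \<Rightarrow> 'v \<Rightarrow> real)"
  shows "(\<Sum>(a, b)\<leftarrow>copairing V \<omega>. L (parity V a) (- parity V b)) = (\<Sum>(a, b)\<leftarrow>copairing V \<omega>. L a b)"
proof -
  have "is_copairing V \<omega> (map (\<lambda>(a, b). (parity V a, - parity V b)) (copairing V \<omega>))"
  proof (rule copairingI)
    fix v
    have "(\<Sum>(a, b)\<leftarrow>map (\<lambda>(a, b). (parity V a, - parity V b)) (copairing V \<omega>). \<omega> b v *\<^sub>R a)
        = (\<Sum>(a, b)\<leftarrow>copairing V \<omega>. parity V (\<omega> b (parity V v) *\<^sub>R a))"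
      by (simp add: o_def case_prod_beta' pairing_simps pairing_parity_left parity_scale)
    also have "\<dots> = parity V (\<Sum>(a, b)\<leftarrow>copairing V \<omega>. \<omega> b (parity V v) *\<^sub>R a)"
      by (rule sum_list_pair_linear[OF linear_parity, symmetric])
    finally show "(\<Sum>(a, b)\<leftarrow>map (\<lambda>(a, b). (parity V a, - parity V b)) (copairing V \<omega>). \<omega> b v *\<^sub>R a)
        = parity V v"
      by (simp add: copairing_sum[OF is_copairing_copairing[OF fin]])
  qed
  from copairing_unique[OF fin this is_copairing_copairing[OF fin] assms] show ?thesis
    by (simp add: o_def case_prod_beta')
qed

lemma linear_even_part: "linear (even_part V)" and linear_odd_part: "linear (odd_part V)"
  by (auto intro!: linearI simp: even_part_add odd_part_add even_part_scale odd_part_scale)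

lemma pd_pd_sign: assumes "F \<in> Sym V"
  shows "pd (even_part V v) (pd b F) = pd b (pd (even_part V v) F)"
    and "pd (odd_part V v) (pd b F) = pd (parity V b) (pd (odd_part V v) F)"
proof -
  note ml = Sym_multilinear[OF assms] multilinear_pd
  show "pd (even_part V v) (pd b F) = pd b (pd (even_part V v) F)"
  proof (rule ext)
    fix vs
    show "pd (even_part V v) (pd b F) vs = pd b (pd (even_part V v) F) vs"
    proof (rule linear_eq_homogeneous[where f = "\<lambda>b. pd (even_part V v) (pd b F) vs"
          and g = "\<lambda>b. pd b (pd (even_part V v) F) vs"])
      fix d b assume b: "b \<in> V d"
      show "pd (even_part V v) (pd b F) vs = pd b (pd (even_part V v) F) vs"
      proof (rule linear_eq_homogeneous[where f = "\<lambda>v. pd (even_part V v) (pd b F) vs"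
            and g = "\<lambda>v. pd b (pd (even_part V v) F) vs"])
        fix e v assume v: "v \<in> V e"
        show "pd (even_part V v) (pd b F) vs = pd b (pd (even_part V v) F) vs"
          using Sym_swap_cases[OF assms b v] by (simp add: parts_homogeneous[OF v] pd_0 ml)
      qed (auto intro!: linearI simp: even_part_add even_part_scale pd_add pd_scale ml)
    qed (auto intro!: linearI simp: pd_add pd_scale ml)
  qed
  show "pd (odd_part V v) (pd b F) = pd (parity V b) (pd (odd_part V v) F)"
  proof (rule ext)
    fix vs
    show "pd (odd_part V v) (pd b F) vs = pd (parity V b) (pd (odd_part V v) F) vs"
    proof (rule linear_eq_homogeneous[where f = "\<lambda>b. pd (odd_part V v) (pd b F) vs"
          and g = "\<lambda>b. pd (parity V b) (pd (odd_part V v) F) vs"])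
      fix d b assume b: "b \<in> V d"
      show "pd (odd_part V v) (pd b F) vs = pd (parity V b) (pd (odd_part V v) F) vs"
      proof (rule linear_eq_homogeneous[where f = "\<lambda>v. pd (odd_part V v) (pd b F) vs"
            and g = "\<lambda>v. pd (parity V b) (pd (odd_part V v) F) vs"])
        fix e v assume v: "v \<in> V e"
        show "pd (odd_part V v) (pd b F) vs = pd (parity V b) (pd (odd_part V v) F) vs"
          using Sym_swap_cases[OF assms b v]
          by (simp add: parts_homogeneous[OF v] parity_homogeneous[OF b] pd_0 pd_neg ml
              power_int_minus_left)
      qed (auto intro!: linearI simp: odd_part_add odd_part_scale pd_add pd_scale ml)
    qed (auto intro!: linearI simp: parity_add parity_scale pd_add pd_scale ml)
  qed
qed

lemma S_free_derivation:
  assumes "F \<in> Sym V"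
  shows "(\<Sum>(a, b)\<leftarrow>copairing V \<omega>. prod_form V (pd a (S_free_form V \<omega> q)) (pd b F) vs) = derivation V q F vs"
  using assms
proof (induction vs arbitrary: F)
  case Nil
  then show ?case by (simp add: pd_def S_free_other)
next
  case (Cons v vs)
  note F = Cons.prems and ml = Sym_multilinear[OF Cons.prems] multilinear_pd multilinear_S_free
  let ?E = "\<lambda>H a b. prod_form V (pd a (S_free_form V \<omega> q)) (pd b H) vs"
  have sgn: "sgn_form V (pd b (S_free_form V \<omega> q)) = pd (parity V b) (S_free_form V \<omega> q)" for b
    using pd_sgn_form[of "parity V b" "S_free_form V \<omega> q"] by (simp add: sgn_form_S_free)
  have "prod_form V (pd a (S_free_form V \<omega> q)) (pd b F) (v # vs)
      = - \<omega> a (q v) * pd b F vs + ?E (pd (even_part V v) F) a b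
        + ?E (pd (odd_part V v) F) (parity V a) (parity V b)" for a b
    unfolding prod_form.simps pd_pd_S_free prod_form_scale_left pd_pd_sign[OF F] sgn
      prod_form_unit_left[OF ml(2)[OF ml(1)]] by simp
  then have "(\<Sum>(a, b)\<leftarrow>copairing V \<omega>. prod_form V (pd a (S_free_form V \<omega> q)) (pd b F) (v # vs))
      = (\<Sum>(a, b)\<leftarrow>copairing V \<omega>. - \<omega> a (q v) * pd b F vs) + (\<Sum>(a, b)\<leftarrow>copairing V \<omega>. ?E (pd (even_part V v) F) a b)
        + (\<Sum>(a, b)\<leftarrow>copairing V \<omega>. ?E (pd (odd_part V v) F) (parity V a) (parity V b))"
    by (simp only: pair_sum_add)
  also have "(\<Sum>(a, b)\<leftarrow>copairing V \<omega>. - \<omega> a (q v) * pd b F vs) = F (q (parity V v) # vs)"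
  proof -
    have "F ((\<Sum>(a, b)\<leftarrow>copairing V \<omega>. \<omega> a (q v) *\<^sub>R b) # vs) = (\<Sum>(a, b)\<leftarrow>copairing V \<omega>. F ((\<omega> a (q v) *\<^sub>R b) # vs))"
      by (rule sum_list_pair_linear[OF multilinear_linear[OF ml(1)]])
    also have "\<dots> = (\<Sum>(a, b)\<leftarrow>copairing V \<omega>. \<omega> a (q v) * F (b # vs))"
      by (simp add: linear_cmul[OF multilinear_linear[OF ml(1)]])
    finally have "F (- q (parity V v) # vs) = (\<Sum>(a, b)\<leftarrow>copairing V \<omega>. \<omega> a (q v) * F (b # vs))"
      unfolding copairing_swap_sum q_parity .
    then show ?thesis
      by (simp add: linear_neg[OF multilinear_linear[OF ml(1)]] pd_def pair_sum_neg)
  qed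
  also have "(\<Sum>(a, b)\<leftarrow>copairing V \<omega>. ?E (pd (odd_part V v) F) (parity V a) (parity V b))
      = - (\<Sum>(a, b)\<leftarrow>copairing V \<omega>. ?E (pd (odd_part V v) F) a b)"
  proof -
    have "bilinear (?E (pd (odd_part V v) F))"
      by (rule bilinear_prod_form_pd[OF ml(3) ml(2)[OF ml(1)] linear_ident linear_ident])
    from copairing_parity[OF this] show ?thesis
      by (simp add: pd_neg ml pair_sum_neg)
  qed
  finally show ?case
    by (simp add: Cons.IH[OF Sym_pd[OF F]] parity_even_odd pd_diff ml del: prod_form.simps)
qed

lemma bracket_S_free:
  assumes F: "F \<in> Sym V"
  shows "bracket V \<omega> (S_free_form V \<omega> q) F = Q_op V q F"
proof (rule ext)
  fix vs
  note ml = Sym_multilinear[OF F] multilinear_pd multilinear_S_free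
  let ?E = "\<lambda>a b. prod_form V (pd a (S_free_form V \<omega> q)) (pd b F) vs"
  have BV: "BV V \<omega> H = (\<lambda>vs. (-1/2) * (\<Sum>(a, b)\<leftarrow>copairing V \<omega>. pd a (pd b H) vs))" for H
    by (rule ext) (simp add: BV_def)
  have pdS: "pd b (prod_form V (S_free_form V \<omega> q) F) = prod_form V (pd b (S_free_form V \<omega> q)) F + prod_form V (S_free_form V \<omega> q) (pd b F)" for b
  proof -
    have "pd b F = pd (even_part V b) F + pd (odd_part V b) F"
      by (simp flip: pd_add[OF ml(1)] add: even_odd_sum)
    then show ?thesis by (simp add: pd_prod_form sgn_form_S_free)
  qed
  have pdS': "pd a (prod_form V (S_free_form V \<omega> q) (pd b F))
      = prod_form V (pd a (S_free_form V \<omega> q)) (pd b F) + prod_form V (S_free_form V \<omega> q) (pd a (pd b F))" for a b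
  proof -
    have "pd a (pd b F) = pd (even_part V a) (pd b F) + pd (odd_part V a) (pd b F)"
      by (simp flip: pd_add[OF ml(2)[OF ml(1)]] add: even_odd_sum)
    then show ?thesis by (simp add: pd_prod_form sgn_form_S_free)
  qed
  have sgn: "sgn_form V (pd b (S_free_form V \<omega> q)) = pd (parity V b) (S_free_form V \<omega> q)" for b
    using pd_sgn_form[of "parity V b" "S_free_form V \<omega> q"] by (simp add: sgn_form_S_free)
  have "pd a (pd b (prod_form V (S_free_form V \<omega> q) F)) vs = prod_form V (pd a (pd b (S_free_form V \<omega> q))) F vs
      + prod_form V (S_free_form V \<omega> q) (pd a (pd b F)) vs
      + (?E b (even_part V a) + ?E (parity V b) (odd_part V a)) + ?E a b" for a b
    unfolding pdS pd_plus pdS' pd_prod_form[of a "pd b (S_free_form V \<omega> q)"] sgn plus_fun_apply by simp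
  note pds = this
  have "bracket V \<omega> (S_free_form V \<omega> q) F vs = - 1/2 * (\<Sum>(a, b)\<leftarrow>copairing V \<omega>. ?E b (even_part V a)
      + ?E (parity V b) (odd_part V a)) - 1/2 * (\<Sum>(a, b)\<leftarrow>copairing V \<omega>. ?E a b)"
    unfolding bracket_def sgn_form_S_free BV prod_form_scale_left prod_form_scale_right
      prod_form_sum_left prod_form_sum_right pds pair_sum_add
    by (rule bracket_arith)
  also have "(\<Sum>(a, b)\<leftarrow>copairing V \<omega>. ?E b (even_part V a) + ?E (parity V b) (odd_part V a))
      = (\<Sum>(a, b)\<leftarrow>copairing V \<omega>. ?E b (even_part V a)) + (\<Sum>(a, b)\<leftarrow>copairing V \<omega>. ?E (parity V b) (odd_part V a))"
    by (rule pair_sum_add)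
  also have "(\<Sum>(a, b)\<leftarrow>copairing V \<omega>. ?E (parity V b) (odd_part V a)) = (\<Sum>(a, b)\<leftarrow>copairing V \<omega>. ?E b (odd_part V a))"
  proof -
    have "bilinear (\<lambda>b a. ?E (parity V b) (odd_part V a))"
      by (rule bilinear_prod_form_pd[OF ml(3) ml(1) linear_parity linear_odd_part])
    then have "bilinear (\<lambda>a b. ?E (parity V b) (odd_part V a))"
      by (subst bilinear_flip)
    from copairing_parity[OF this] show ?thesis
      by (simp add: parity_neg pd_neg ml)
  qed
  also have "(\<Sum>(a, b)\<leftarrow>copairing V \<omega>. ?E b (even_part V a)) + (\<Sum>(a, b)\<leftarrow>copairing V \<omega>. ?E b (odd_part V a))
      = (\<Sum>(a, b)\<leftarrow>copairing V \<omega>. ?E b a)"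
  proof -
    have "?E b (even_part V a) + ?E b (odd_part V a) = ?E b a" for a b
    proof -
      have "pd a F = pd (even_part V a) F + pd (odd_part V a) F"
        by (simp flip: pd_add[OF ml(1)] add: even_odd_sum)
      then show ?thesis by simp
    qed
    then show ?thesis by (simp only: pair_sum_add[symmetric])
  qed
  also have "(\<Sum>(a, b)\<leftarrow>copairing V \<omega>. ?E b a) = (\<Sum>(a, b)\<leftarrow>copairing V \<omega>. ?E a b)"
    by (rule copairing_swap[OF bilinear_prod_form_pd[OF ml(3) ml(1) linear_ident linear_ident]])
  finally show "bracket V \<omega> (S_free_form V \<omega> q) F vs = Q_op V q F vs"
    by (simp add: S_free_derivation[OF F] Q_op_def)
qed

end

end

lemma finite_choices: "finite {bs :: bool list. length bs = n \<and> count_list bs True = m}"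
  by (rule finite_subset[OF _ finite_lists_length_eq[of "UNIV :: bool set" n]]) auto

lemma count_part_Nil: "count_part e m F [] = (if m = 0 then F [] else 0)"
proof -
  have "{bs :: bool list. length bs = 0 \<and> count_list bs True = m} = (if m = 0 then {[]} else {})"
    by auto
  then show ?thesis by (simp add: count_part_def)
qed

lemma count_part_Cons:
  "count_part e m F (v # vs) = count_part e m (pd (v - e v) F) vs
     + (if m = 0 then 0 else count_part e (m - 1) (pd (e v) F) vs)"
proof -
  let ?f = "\<lambda>bs vs. F (map2 (\<lambda>b v. if b then e v else v - e v) bs vs)"
  define A where "A m = {bs :: bool list. length bs = length vs \<and> count_list bs True = m}" for m
  define B where "B = (if m = 0 then {} else A (m - 1))"
  have "{bs. length bs = length (v # vs) \<and> count_list bs True = m}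
      = (#) False ` A m \<union> (#) True ` B" (is "?L = _")
  proof (rule set_eqI)
    fix bs :: "bool list"
    show "bs \<in> ?L \<longleftrightarrow> bs \<in> (#) False ` A m \<union> (#) True ` B"
    proof (cases bs)
      case (Cons b bs')
      then show ?thesis by (cases b; cases m) (auto simp: A_def B_def)
    qed auto
  qed
  then have "count_part e m F (v # vs)
      = (\<Sum>bs\<in>(#) False ` A m \<union> (#) True ` B. ?f bs (v # vs))"
    by (simp only: count_part_def)
  also have "\<dots> = (\<Sum>bs\<in>(#) False ` A m. ?f bs (v # vs)) + (\<Sum>bs\<in>(#) True ` B. ?f bs (v # vs))"
    by (rule sum.union_disjoint) (auto simp: A_def B_def finite_choices)
  also have "\<dots> = (\<Sum>bs\<in>A m. ?f (False # bs) (v # vs)) + (\<Sum>bs\<in>B. ?f (True # bs) (v # vs))"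
    by (simp add: sum.reindex)
  finally show ?thesis by (simp add: count_part_def pd_def B_def A_def)
qed

lemma pd_count_part:
  "pd v (count_part e m F) = (\<lambda>vs. count_part e m (pd (v - e v) F) vs
     + (if m = 0 then 0 else count_part e (m - 1) (pd (e v) F) vs))"
  by (rule ext) (simp only: pd_def[of v "count_part e m F"] count_part_Cons)

lemma count_part_add: "count_part e m (F + H) = count_part e m F + count_part e m H"
  by (simp add: count_part_def fun_eq_iff sum.distrib)

lemma count_part_scale: "count_part e m (\<lambda>vs. r * F vs) = (\<lambda>vs. r * count_part e m F vs)"
  by (simp add: count_part_def fun_eq_iff sum_distrib_left)

lemma count_part_short:
  assumes "length vs < m" shows "count_part e m F vs = 0"
proof -
  have "count_list bs True \<noteq> m" if "length bs = length vs" for bs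
    using count_le_length[of bs True] that assms by simp
  then have "{bs. length bs = length vs \<and> count_list bs True = m} = {}" by blast
  then show ?thesis by (simp only: count_part_def sum.empty)
qed

lemma pd_unit: "pd v unit_form = 0"
  by (rule ext) (simp add: pd_def unit_form_def)

lemma count_part_unit: "count_part e m unit_form = (if m = 0 then unit_form else 0)"
proof (rule ext)
  fix vs
  show "count_part e m unit_form vs = (if m = 0 then unit_form else 0) vs"
  proof (cases vs)
    case Nil then show ?thesis by (simp add: count_part_Nil)
  next
    case (Cons v ws)
    have "count_part e m 0 ws = 0" for m by (simp add: count_part_def)
    then show ?thesis by (simp add: Cons count_part_Cons pd_unit) (simp add: unit_form_def)
  qed
qed

context graded_space
begin

lemma derivation_degree_zero:
  assumes "\<And>vs. length vs = n \<Longrightarrow> F vs = 0" "length vs = n"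
  shows "derivation V a F vs = 0"
  using assms
proof (induction vs arbitrary: F n)
  case (Cons v vs)
  have "derivation V a (pd (parity V v) F) vs = 0"
    by (rule Cons.IH[of "length vs"]) (use Cons.prems in \<open>auto simp: pd_def\<close>)
  then show ?case using Cons.prems by simp
qed simp

lemma multilinear_functional: "linear \<phi> \<Longrightarrow> multilinear (functional V \<phi>)"
  unfolding multilinear_def
proof (intro allI)
  fix xs ys :: "'v list" assume \<phi>: "linear \<phi>"
  have "linear (\<lambda>v. \<phi> (parity V v))"
    using linear_compose[OF linear_parity \<phi>] by (simp add: o_def)
  then show "linear (\<lambda>v. functional V \<phi> (xs @ v # ys))"
    by (cases xs; cases ys; cases "tl xs") (auto simp: functional_def linear_zero)
qed

lemma pd_functional: "pd v (functional V \<phi>) = (\<lambda>vs. \<phi> (parity V v) * unit_form vs)"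
  by (auto simp: pd_def functional_def unit_form_def fun_eq_iff split: list.splits)

lemma sgn_form_functional: "sgn_form V (functional V \<phi>) = functional V (\<lambda>v. \<phi> (parity V v))"
  by (auto simp: sgn_form_def functional_def fun_eq_iff split: list.splits)

lemma multilinear_count_part:
  assumes e: "linear e" and "multilinear F"
  shows "multilinear (count_part e m F)"
  unfolding multilinear_def
proof (intro allI)
  fix xs ys
  show "linear (\<lambda>v. count_part e m F (xs @ v # ys))" using assms(2)
  proof (induction xs arbitrary: F m)
    case Nil
    have *: "linear (\<lambda>v. count_part e m (pd (f v) F) ys)" if f: "linear f" for f m
      by (rule linearI) (simp_all only: linear_add[OF f] linear_cmul[OF f] pd_add[OF Nil]
          pd_scale[OF Nil] count_part_add count_part_scale plus_fun_apply real_scaleR_def)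
    have "linear (\<lambda>v. v - e v)" by (rule linear_compose_sub[OF linear_ident e])
    then show ?case
      unfolding append_Nil count_part_Cons
      by (cases "m = 0") (simp_all add: linear_compose_add * e)
  next
    case (Cons x xs)
    show ?case
      unfolding append_Cons count_part_Cons
      using Cons.IH[OF multilinear_pd[OF Cons.prems]]
      by (cases "m = 0") (simp_all add: linear_compose_add)
  qed
qed

context
  fixes e assumes e: "linear e" "\<And>v. e (parity V v) = parity V (e v)"
begin

lemma e_parts: "even_part V (e v) = e (even_part V v)" "odd_part V (e v) = e (odd_part V v)"
  by (simp_all add: even_part_def odd_part_def e linear_cmul[OF e(1)]
      linear_add[OF e(1)] linear_diff[OF e(1)])

lemma e_parts': "even_part V (v - e v) = even_part V v - e (even_part V v)"
  "odd_part V (v - e v) = odd_part V v - e (odd_part V v)"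
  by (simp_all add: even_part_def odd_part_def e linear_cmul[OF e(1)] parity_diff
      linear_add[OF e(1)] linear_diff[OF e(1)] scaleR_diff_right scaleR_add_right)

lemma count_part_functional_new:
  assumes "linear \<phi>" "\<And>v. \<phi> (v - e v) = 0" "multilinear H"
  shows "count_part e m (prod_form V (functional V \<phi>) H) vs
    = (if m = 0 then 0 else prod_form V (functional V \<phi>) (count_part e (m - 1) H) vs)"
  using assms
proof (induction vs arbitrary: \<phi> H m)
  case Nil then show ?case by (simp add: count_part_Nil functional_def)
next
  case (Cons v vs)
  note \<phi> = Cons.prems(1) and H = Cons.prems(3)
  have \<phi>': "linear (\<lambda>v. \<phi> (parity V v))" "\<And>v. \<phi> (parity V (v - e v)) = 0"
    using linear_compose[OF linear_parity \<phi>] Cons.prems(2)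
    by (simp_all add: o_def parity_diff flip: e(2))
  have \<phi>e: "\<phi> (e v) = \<phi> v" for v using Cons.prems(2)[of v] by (simp add: linear_diff[OF \<phi>])
  note ml = H multilinear_pd[OF H]
  have pd: "pd u (prod_form V (functional V \<phi>) H) = (\<lambda>vs. \<phi> (parity V u) * H vs)
      + prod_form V (functional V \<phi>) (pd (even_part V u) H)
      + prod_form V (functional V (\<lambda>v. \<phi> (parity V v))) (pd (odd_part V u) H)" for u
    by (simp only: pd_prod_form pd_functional prod_form_scale_left prod_form_unit_left[OF H]
        sgn_form_functional)
  have parts: "count_part e m (pd u (prod_form V (functional V \<phi>) H)) vs
      = \<phi> (parity V u) * count_part e m H vs
      + (if m = 0 then 0 else
          prod_form V (functional V \<phi>) (count_part e (m - 1) (pd (even_part V u) H)) vs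
        + prod_form V (functional V (\<lambda>v. \<phi> (parity V v)))
            (count_part e (m - 1) (pd (odd_part V u) H)) vs)" for u m
    unfolding pd count_part_add count_part_scale plus_fun_apply
      Cons.IH[OF \<phi> Cons.prems(2) ml(2)] Cons.IH[OF \<phi>' ml(2)] by simp
  have pdc: "pd u (count_part e n H) = (\<lambda>vs. 1 * count_part e n (pd (u - e u) H) vs)
      + (\<lambda>vs. (if n = 0 then 0 else 1) * count_part e (n - 1) (pd (e u) H) vs)" for u n
    by (rule ext) (simp add: pd_count_part)
  show ?case
  proof (cases m)
    case 0
    then show ?thesis
      by (simp only: count_part_Cons parts \<phi>'(2)) simp
  next
    case (Suc n)
    have unit: "prod_form V unit_form (count_part e n H) = count_part e n H"
      by (rule prod_form_unit_left[OF multilinear_count_part[OF e(1) H]])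
    show ?thesis
      unfolding count_part_Cons parts Suc diff_Suc_1 prod_form.simps pd_functional
        prod_form_scale_left pdc prod_form_plus_right prod_form_scale_right plus_fun_apply
        e_parts e_parts' sgn_form_functional \<phi>'(2) unit
      by (cases n) (simp_all add: \<phi>e flip: e(2))
  qed
qed

lemma count_part_functional_old:
  assumes "linear \<phi>" "\<And>v. \<phi> (e v) = 0" "multilinear H"
  shows "count_part e m (prod_form V (functional V \<phi>) H) vs
    = prod_form V (functional V \<phi>) (count_part e m H) vs"
  using assms
proof (induction vs arbitrary: \<phi> H m)
  case Nil then show ?case by (simp add: count_part_Nil functional_def)
next
  case (Cons v vs)
  note \<phi> = Cons.prems(1) and H = Cons.prems(3)
  have \<phi>': "linear (\<lambda>v. \<phi> (parity V v))" "\<And>v. \<phi> (parity V (e v)) = 0"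
    using linear_compose[OF linear_parity \<phi>] Cons.prems(2)
    by (simp_all add: o_def flip: e(2))
  have \<phi>e: "\<phi> (v - e v) = \<phi> v" "\<phi> (parity V (v - e v)) = \<phi> (parity V v)" for v
    using Cons.prems(2)[of v] \<phi>'(2)[of v] by (simp_all add: linear_diff[OF \<phi>] parity_diff)
  note ml = H multilinear_pd[OF H]
  have pd: "pd u (prod_form V (functional V \<phi>) H) = (\<lambda>vs. \<phi> (parity V u) * H vs)
      + prod_form V (functional V \<phi>) (pd (even_part V u) H)
      + prod_form V (functional V (\<lambda>v. \<phi> (parity V v))) (pd (odd_part V u) H)" for u
    by (simp only: pd_prod_form pd_functional prod_form_scale_left prod_form_unit_left[OF H]
        sgn_form_functional)
  have parts: "count_part e m (pd u (prod_form V (functional V \<phi>) H)) vs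
      = \<phi> (parity V u) * count_part e m H vs
      + prod_form V (functional V \<phi>) (count_part e m (pd (even_part V u) H)) vs
      + prod_form V (functional V (\<lambda>v. \<phi> (parity V v)))
            (count_part e m (pd (odd_part V u) H)) vs" for u m
    unfolding pd count_part_add count_part_scale plus_fun_apply
      Cons.IH[OF \<phi> Cons.prems(2) ml(2)] Cons.IH[OF \<phi>' ml(2)] by simp
  have pdc: "pd u (count_part e n H) = (\<lambda>vs. 1 * count_part e n (pd (u - e u) H) vs)
      + (\<lambda>vs. (if n = 0 then 0 else 1) * count_part e (n - 1) (pd (e u) H) vs)" for u n
    by (rule ext) (simp add: pd_count_part)
  have unit: "prod_form V unit_form (count_part e m H) = count_part e m H"
    by (rule prod_form_unit_left[OF multilinear_count_part[OF e(1) H]])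
  show ?case
    unfolding count_part_Cons parts prod_form.simps pd_functional
      prod_form_scale_left pdc prod_form_plus_right prod_form_scale_right plus_fun_apply
      e_parts e_parts' sgn_form_functional \<phi>'(2) \<phi>e unit
    by (cases m) simp_all
qed

end

abbreviation monomial :: "('v \<Rightarrow> real) list \<Rightarrow> 'v form" where
  "monomial \<phi>s \<equiv> foldr (prod_form V) (map (functional V) \<phi>s) unit_form"

lemma multilinear_unit_form: "multilinear (unit_form :: 'v form)"
  by (auto simp: multilinear_def unit_form_def linear_zero)

lemma multilinear_monomial: "(\<And>\<phi>. \<phi> \<in> set \<phi>s \<Longrightarrow> linear \<phi>) \<Longrightarrow> multilinear (monomial \<phi>s)"
  by (induction \<phi>s) (auto intro: multilinear_prod_form multilinear_functional multilinear_unit_form)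

lemma count_part_monomial:
  assumes e: "linear e" "\<And>v. e (parity V v) = parity V (e v)"
    and \<phi>s: "\<And>\<phi>. \<phi> \<in> set \<phi>s \<Longrightarrow> linear \<phi>" "\<And>\<phi> v. \<phi> \<in> set \<phi>s \<Longrightarrow> \<phi> (v - e v) = 0"
    and \<psi>s: "\<And>\<psi>. \<psi> \<in> set \<psi>s \<Longrightarrow> linear \<psi>" "\<And>\<psi> v. \<psi> \<in> set \<psi>s \<Longrightarrow> \<psi> (e v) = 0"
  shows "count_part e m (monomial (\<phi>s @ \<psi>s)) = (if m = length \<phi>s then monomial (\<phi>s @ \<psi>s) else 0)"
  using \<phi>s
proof (induction \<phi>s arbitrary: m)
  case Nil
  show ?case using \<psi>s
  proof (induction \<psi>s)
    case Nil then show ?case by (simp add: count_part_unit)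
  next
    case (Cons \<psi> \<psi>s)
    have "count_part e m (prod_form V (functional V \<psi>) (monomial \<psi>s))
        = prod_form V (functional V \<psi>) (count_part e m (monomial \<psi>s))"
      by (rule ext, rule count_part_functional_old[OF e])
        (use Cons.prems in \<open>auto intro: multilinear_monomial\<close>)
    with Cons show ?case by simp
  qed
next
  case (Cons \<phi> \<phi>s)
  have ml: "multilinear (monomial (\<phi>s @ \<psi>s))"
    by (rule multilinear_monomial) (use Cons.prems \<psi>s in auto)
  have A: "count_part e m (prod_form V (functional V \<phi>) (monomial (\<phi>s @ \<psi>s)))
      = (\<lambda>vs. if m = 0 then 0
          else prod_form V (functional V \<phi>) (count_part e (m - 1) (monomial (\<phi>s @ \<psi>s))) vs)"
    by (rule ext, rule count_part_functional_new[OF e _ _ ml]) (use Cons.prems in auto)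
  have B: "count_part e (m - 1) (monomial (\<phi>s @ \<psi>s))
      = (if m - 1 = length \<phi>s then monomial (\<phi>s @ \<psi>s) else 0)"
    by (rule Cons.IH) (use Cons.prems in auto)
  have eq: "monomial ((\<phi> # \<phi>s) @ \<psi>s) = prod_form V (functional V \<phi>) (monomial (\<phi>s @ \<psi>s))"
    by simp
  show ?case unfolding eq A B by (cases m) (auto simp: fun_eq_iff)
qed

end

context cyclic_sdr
begin

lemma linear_projection: "linear (\<lambda>v. k (q v) + q (k v))"
  using linear_compose_add[OF linear_compose[OF V.linear_q linear_k]
      linear_compose[OF linear_k V.linear_q]] by (simp add: o_def)

lemma projection_parity:
  "k (q (parity V v)) + q (k (parity V v)) = parity V (k (q v) + q (k v))"
proof -
  have "parity V (k v) = - k (parity V v)" for v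
    by (rule V.odd_map_parity[OF linear_k, of "-1"]) (use k_degree in auto)
  then show ?thesis
    by (simp add: V.parity_add V.q_parity linear_neg[OF linear_k] linear_neg[OF V.linear_q])
qed

text \<open>\<open>k q + q k\<close> is the projection onto \<open>V'' = Im(k q) \<oplus> Im(q k)\<close> along \<open>V' = Im(i p)\<close>.\<close>

lemma projection:
  "range (\<lambda>v. k (q v) + q (k v)) = {x + y | x y. x \<in> range (\<lambda>v. k (q v)) \<and> y \<in> range (\<lambda>v. q (k v))}"
  "range (\<lambda>v. k (q v)) \<inter> range (\<lambda>v. q (k v)) = {0}"
  "x \<in> range (\<lambda>v. k (q v) + q (k v)) \<Longrightarrow> k (q x) + q (k x) = x"
  "k (q (i (p v))) + q (k (i (p v))) = 0"
proof -
  have lin: "k 0 = 0" "q 0 = 0" by (rule linear_0[OF linear_k], rule linear_0[OF V.linear_q])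
  have kq: "k (q (k (q v))) = k (q v)" for v
    using homotopy[of "k (q v)"]
    by (simp add: pk_zero k_square lin linear_0[OF linear_i])
  have qk: "q (k (q (k v))) = q (k v)" for v
    using homotopy[of "q (k v)"]
    by (simp add: p_chain pk_zero V.q_square lin linear_0[OF linear_i] linear_0[OF U.linear_q])
  have e: "k (q (k (q v) + q (k w))) + q (k (k (q v) + q (k w))) = k (q v) + q (k w)" for v w
    by (simp add: linear_add[OF linear_k] linear_add[OF V.linear_q] V.q_square k_square lin kq qk)
  show "range (\<lambda>v. k (q v) + q (k v))
      = {x + y | x y. x \<in> range (\<lambda>v. k (q v)) \<and> y \<in> range (\<lambda>v. q (k v))}"
  proof (intro equalityI subsetI)
    fix x assume "x \<in> {x + y | x y. x \<in> range (\<lambda>v. k (q v)) \<and> y \<in> range (\<lambda>v. q (k v))}"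
    then obtain v w where "x = k (q v) + q (k w)" by auto
    then have "x = k (q x) + q (k x)" by (simp only: e)
    then show "x \<in> range (\<lambda>v. k (q v) + q (k v))" by (rule range_eqI)
  qed auto
  show "range (\<lambda>v. k (q v)) \<inter> range (\<lambda>v. q (k v)) = {0}"
  proof
    show "range (\<lambda>v. k (q v)) \<inter> range (\<lambda>v. q (k v)) \<subseteq> {0}"
    proof
      fix x assume "x \<in> range (\<lambda>v. k (q v)) \<inter> range (\<lambda>v. q (k v))"
      then have "x \<in> range (\<lambda>v. k (q v))" "x \<in> range (\<lambda>v. q (k v))" by simp_all
      then obtain v w where "x = k (q v)" "x = q (k w)" by (elim rangeE)
      have "k (q x) = x" unfolding \<open>x = k (q v)\<close> by (rule kq)
      moreover have "q x = 0" unfolding \<open>x = q (k w)\<close> by (rule V.q_square)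
      ultimately show "x \<in> {0}" by (simp add: lin)
    qed
    have "0 = k (q 0)" "0 = q (k 0)" by (simp_all add: lin)
    then show "{0} \<subseteq> range (\<lambda>v. k (q v)) \<inter> range (\<lambda>v. q (k v))" by blast
  qed
  show "k (q x) + q (k x) = x" if "x \<in> range (\<lambda>v. k (q v) + q (k v))" for x
    using that e by auto
  show "k (q (i (p v))) + q (k (i (p v))) = 0"
    using homotopy[of "i (p v)"] by (simp add: pi_id)
qed

text \<open>The value of \<open>K\<close> on \<open>\<phi>\<^sub>1 \<dots> \<phi>\<^sub>m \<psi>\<^sub>1 \<dots> \<psi>\<^sub>n\<close> with \<open>\<phi>\<^sub>j \<in> (V'')\<^sup>*\<close> and \<open>\<psi>\<^sub>j \<in> (V')\<^sup>*\<close>, that is,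
  with \<open>\<phi>\<^sub>j = 0\<close> on \<open>V'\<close> and \<open>\<psi>\<^sub>j = 0\<close> on \<open>V''\<close>.\<close>

lemma K_op_monomial:
  assumes \<phi>s: "\<And>\<phi>. \<phi> \<in> set \<phi>s \<Longrightarrow> linear \<phi>" "\<And>\<phi> v. \<phi> \<in> set \<phi>s \<Longrightarrow> \<phi> (i (p v)) = 0"
    and \<psi>s: "\<And>\<psi>. \<psi> \<in> set \<psi>s \<Longrightarrow> linear \<psi>" "\<And>\<psi> v. \<psi> \<in> set \<psi>s \<Longrightarrow> \<psi> (k (q v) + q (k v)) = 0"
  shows "K_op V q k (V.monomial (\<phi>s @ \<psi>s)) vs
    = (if length \<phi>s = 0 then 0
       else 1 / real (length \<phi>s) * derivation V k (V.monomial (\<phi>s @ \<psi>s)) vs)"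
proof -
  let ?e = "\<lambda>v. k (q v) + q (k v)" and ?F = "V.monomial (\<phi>s @ \<psi>s)" and ?m = "length \<phi>s"
  have "v - ?e v = i (p v)" for v using homotopy[of v] by (simp add: algebra_simps)
  then have \<phi>e: "\<And>\<phi> v. \<phi> \<in> set \<phi>s \<Longrightarrow> \<phi> (v - ?e v) = 0" using \<phi>s(2) by simp
  have cp: "count_part ?e m ?F = (if m = ?m then ?F else 0)" for m
    by (rule V.count_part_monomial[where e = ?e])
      (fact linear_projection projection_parity \<phi>s(1) \<phi>e \<psi>s)+
  have zero: "derivation V k 0 vs = 0"
    by (rule V.derivation_degree_zero[of "length vs"]) auto
  have "K_op V q k ?F vs
      = (\<Sum>m = 1..length vs. if m = ?m then 1 / real m * derivation V k ?F vs else 0)"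
    unfolding K_op_def cp by (intro sum.cong refl) (simp add: zero)
  also have "\<dots> = (if ?m \<in> {1..length vs} then 1 / real ?m * derivation V k ?F vs else 0)"
    by (subst sum.delta) auto
  also have "\<dots> = (if ?m = 0 then 0 else 1 / real ?m * derivation V k ?F vs)"
  proof (cases "?m \<le> length vs")
    case False
    have "derivation V k ?F vs = 0"
    proof (rule V.derivation_degree_zero[of "length vs"])
      fix ws :: "'v list" assume "length ws = length vs"
      then have "count_part ?e ?m ?F ws = 0" using False by (intro count_part_short) simp
      then show "?F ws = 0" using cp[of ?m] by simp
    qed simp
    then show ?thesis by simp
  qed (auto simp: Suc_le_eq)
  finally show ?thesis .
qed

end

end

(* The operators K and D = Q + hbar Delta form a perturbation problem: Q K + K Q = 1 - I P, because
   [Q, K_un] multiplies a monomial by #''.  Put G = (1 + hbar Delta K)^(-1) F for a D-closed F, so that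
   P' F = P G.  As Delta I = I Delta and K I = 0, the obstruction K Q G to G - I P G = Q K G satisfies
   K Q G = - K hbar Delta (K Q G).  Iterating this lowers the power of hbar at constant weight, so
   K Q G = 0 and F - I P' F = D K G.  Finally I is an algebra map, so I P' e^(S_int/hbar) = e^(I(W)/hbar). *)

theory Submission
  imports Defs
begin

text \<open>Forms may have terms of every polynomial degree, and the sums in \<open>K_op\<close>,
  the products, the exponentials and the perturbation series are finite only on arguments of one
  length or in one weight. What controls them is locality: the coefficients of Q F and K F at length
  n depend on F at length n alone, those of Delta F on length n + 2. Claims are therefore checked
  one length at a time, where a series can be replaced by a finite sum of forms. The facts about
  Delta come from identities of the tensor \<open>copairing\<close>: it is odd, it is invariant
  under q, and p carries it to a copairing of U. The master equation on U is not verified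
  separately: the second half-density is F - D K G, which is closed because D squares to
  zero.\<close>

section \<open>Even derivations and the decomposition by number of projected arguments\<close>

lemma multilinear_scale: "multilinear F \<Longrightarrow> multilinear (\<lambda>vs. r * F vs)"
  unfolding multilinear_def real_scaleR_def[symmetric]
  by (intro allI linear_compose_scale_right) blast

lemma pd_sum_list: "pd v (\<lambda>vs. \<Sum>(a, b)\<leftarrow>L. f a b vs) = (\<lambda>vs. \<Sum>(a, b)\<leftarrow>L. pd v (f a b) vs)"
  by (simp add: pd_def fun_eq_iff)

text \<open>Serves to move \<open>derivation V q\<close> and \<open>BV\<close> under the sum over
  the copairing that defines \<open>BV\<close>.\<close>

lemma linear_form_operator_sum_list:
  fixes T :: "'v form \<Rightarrow> 'w form"
  assumes "\<And>F H. T (F + H) = T F + T H" "\<And>r F. T (\<lambda>vs. r * F vs) = (\<lambda>vs. r * T F vs)"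
  shows "T (\<lambda>vs. \<Sum>(a, b)\<leftarrow>L. f a b vs) = (\<lambda>vs. \<Sum>(a, b)\<leftarrow>L. T (f a b) vs)"
proof (induction L)
  case Nil show ?case using assms(2)[of 0 "\<lambda>_. 0"] by simp
next
  case (Cons x L)
  obtain a b where x: "x = (a, b)" by (cases x)
  have *: "(\<lambda>vs. \<Sum>(a, b)\<leftarrow>x # L. f a b vs) = f a b + (\<lambda>vs. \<Sum>(a, b)\<leftarrow>L. f a b vs)"
    by (simp add: x fun_eq_iff)
  show ?case unfolding * assms(1) Cons.IH by (simp add: x fun_eq_iff)
qed

text \<open>The degree 0 counterpart of \<open>derivation\<close>: an even map passes arguments
  without sign, so no parity appears. It arises as the anticommutator of two odd derivations; for a
  projection \<open>c\<close> it is the Euler operator counting the factors that live on the image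
  of \<open>c\<close>.\<close>

primrec even_derivation :: "('v \<Rightarrow> 'v) \<Rightarrow> 'v form \<Rightarrow> 'v form" where
  "even_derivation c F [] = 0"
| "even_derivation c F (v # vs) = even_derivation c (pd v F) vs + F (c v # vs)"

lemma even_derivation_add:
  "even_derivation c (F + H) vs = even_derivation c F vs + even_derivation c H vs"
  by (induction vs arbitrary: F H) auto

lemma even_derivation_scale:
  "even_derivation c (\<lambda>vs. r * F vs) vs = r * even_derivation c F vs"
  by (induction vs arbitrary: F) (auto simp: distrib_left)

lemma even_derivation_zero_map:
  assumes "multilinear F" shows "even_derivation (\<lambda>v. 0) F vs = 0"
  using assms
proof (induction vs arbitrary: F)
  case (Cons v vs)
  then show ?case by (simp add: multilinear_pd linear_0[OF multilinear_linear])
qed simp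

text \<open>Inserting \<open>e\<close> into an argument already projected by \<open>e\<close>
  changes nothing, and into one projected by \<open>1 - e\<close> gives zero. Exactly m arguments
  are of the first kind, whence the eigenvalue m.\<close>

lemma even_derivation_count_part:
  assumes e: "linear e" "\<And>v. e (e v) = e v" and F: "multilinear F"
  shows "even_derivation e (count_part e m F) vs = real m * count_part e m F vs"
  using F
proof (induction vs arbitrary: F m)
  case Nil then show ?case by (simp add: count_part_Nil)
next
  case (Cons v vs)
  note F = Cons.prems
  have ev: "pd (e v - e v) F = 0" by (simp add: pd_0[OF F])
  have pdc: "pd v (count_part e m F) = count_part e m (pd (v - e v) F)
      + (\<lambda>vs. (if m = 0 then 0 else 1) * count_part e (m - 1) (pd (e v) F) vs)"
    by (rule ext) (simp add: pd_count_part)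
  have zero: "count_part e m 0 vs = 0" by (simp add: count_part_def)
  have "even_derivation e (count_part e m F) (v # vs) = real m * count_part e m (pd (v - e v) F) vs
      + (if m = 0 then 0 else 1) * (real (m - 1) * count_part e (m - 1) (pd (e v) F) vs)
      + (if m = 0 then 0 else 1) * count_part e (m - 1) (pd (e v) F) vs"
    unfolding even_derivation.simps pdc even_derivation_add even_derivation_scale
      Cons.IH[OF multilinear_pd[OF F]] count_part_Cons e(2) ev zero by simp
  then show ?case by (cases m) (simp_all add: count_part_Cons algebra_simps)
qed

text \<open>Multilinear expansion along \<open>v = e v + (v - e v)\<close> in every argument. Any
  bound from the length upwards will do, since no more arguments than that can be projected.\<close>

lemma sum_count_part:
  assumes e: "linear e" and F: "multilinear F" and n: "length vs \<le> n"
  shows "(\<Sum>m\<le>n. count_part e m F vs) = F vs"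
  using F n
proof (induction vs arbitrary: F n)
  case Nil
  then show ?case by (simp add: count_part_Nil)
next
  case (Cons v vs)
  note F = Cons.prems(1)
  obtain n' where n: "n = Suc n'" using Cons.prems(2) by (cases n) auto
  have "(\<Sum>m\<le>n. if m = 0 then 0 else count_part e (m - 1) (pd (e v) F) vs)
      = (\<Sum>m\<le>n'. count_part e m (pd (e v) F) vs)"
    unfolding n by (subst sum.atMost_Suc_shift) simp
  then have "(\<Sum>m\<le>n. count_part e m F (v # vs)) = pd (v - e v) F vs + pd (e v) F vs"
    unfolding count_part_Cons sum.distrib
    using Cons.IH[OF multilinear_pd[OF F], of n "v - e v"] Cons.IH[OF multilinear_pd[OF F], of n' "e v"]
      Cons.prems(2) n by simp
  then show ?case by (simp add: pd_diff[OF F]) (simp add: pd_def)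
qed

text \<open>For \<open>e = k q + q k\<close> the complement \<open>v - e v\<close> is
  \<open>i (p v)\<close>, so this part becomes the term I P of the homotopy formula.\<close>

lemma count_part_0: "count_part e 0 F vs = F (map (\<lambda>v. v - e v) vs)"
  by (induction vs arbitrary: F) (simp_all add: count_part_Nil count_part_Cons pd_def)

lemma count_part_cong:
  assumes "\<And>ws. length ws = length vs \<Longrightarrow> F ws = H ws"
  shows "count_part e m F vs = count_part e m H vs"
  unfolding count_part_def by (intro sum.cong refl assms) auto

section \<open>Graded symmetry and commutation rules of derivations\<close>

context graded_space
begin

lemma derivation_scaled [simp]: "derivation V a (\<lambda>vs. r * F vs) = (\<lambda>vs. r * derivation V a F vs)"
proof (rule ext)
  fix vs show "derivation V a (\<lambda>vs. r * F vs) vs = r * derivation V a F vs"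
    by (induction vs arbitrary: F) (auto simp: distrib_left)
qed

lemma derivation_zero [simp]: "derivation V a 0 = 0"
  using derivation_minus[of a 0 0] by simp

lemma derivation_cong:
  assumes "\<And>ws. length ws = length vs \<Longrightarrow> F ws = H ws"
  shows "derivation V a F vs = derivation V a H vs"
proof -
  have "derivation V a (F - H) vs = 0"
    by (rule derivation_degree_zero[OF _ refl]) (simp add: assms)
  then show ?thesis by simp
qed

lemma Sym_add: assumes "F \<in> Sym V" "H \<in> Sym V" shows "F + H \<in> Sym V"
proof (rule SymI)
  fix xs ys d e v w assume vw: "v \<in> V d" "w \<in> V e"
  show "(F + H) (xs @ v # w # ys) = (-1) powi (d * e) * (F + H) (xs @ w # v # ys)"
    by (simp add: Sym_swap_args[OF assms(1) vw, of xs ys] Sym_swap_args[OF assms(2) vw, of xs ys]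
        distrib_left)
qed (intro multilinear_add Sym_multilinear assms)

lemma Sym_scale: assumes "F \<in> Sym V" shows "(\<lambda>vs. r * F vs) \<in> Sym V"
proof (rule SymI)
  fix xs ys d e v w assume vw: "v \<in> V d" "w \<in> V e"
  show "r * F (xs @ v # w # ys) = (-1) powi (d * e) * (r * F (xs @ w # v # ys))"
    by (simp add: Sym_swap_args[OF assms vw, of xs ys])
qed (intro multilinear_scale Sym_multilinear assms)

lemma Sym_zero: "0 \<in> Sym V"
  by (rule SymI) (simp_all add: multilinear_def linear_zero)

lemma Sym_uminus: "F \<in> Sym V \<Longrightarrow> - F \<in> Sym V"
  using Sym_scale[of F "-1"] by (simp add: fun_Compl_def)

lemma Sym_unit_form: "unit_form \<in> Sym V"
  by (rule SymI) (simp_all add: multilinear_unit_form unit_form_def)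

lemma Sym_sum: "(\<And>x. x \<in> X \<Longrightarrow> f x \<in> Sym V) \<Longrightarrow> (\<Sum>x\<in>X. f x) \<in> Sym V"
  by (induction X rule: infinite_finite_induct) (auto intro: Sym_add Sym_zero)

text \<open>Multilinearity and graded symmetry only compare values on lists of equal length, so the
  symmetric form that represents F may vary with the length. This handles operations whose defining
  sums become fixed finite sums of forms only after the length is fixed.\<close>

lemma Sym_locally:
  assumes "\<And>n. \<exists>H\<in>Sym V. \<forall>vs. length vs = n \<longrightarrow> F vs = H vs"
  shows "F \<in> Sym V"
proof -
  obtain H where H: "\<And>n. H n \<in> Sym V" "\<And>vs. F vs = H (length vs) vs" using assms by metis
  show ?thesis
  proof (rule SymI)
    have "linear (\<lambda>v. H (Suc (length xs + length ys)) (xs @ v # ys))" for xs ys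
      using Sym_multilinear[OF H(1)] unfolding multilinear_def by blast
    then show "multilinear F" by (simp add: multilinear_def H(2))
  next
    fix xs ys d e v w assume "v \<in> V d" "w \<in> V e"
    from Sym_swap_args[OF H(1) this, of "length xs + length ys + 2" xs ys]
    show "F (xs @ v # w # ys) = (-1) powi (d * e) * F (xs @ w # v # ys)"
      by (simp add: H(2))
  qed
qed

lemma multilinear_derivation:
  assumes a: "linear a" and F: "multilinear F"
  shows "multilinear (derivation V a F)"
  unfolding multilinear_def
proof (intro allI)
  fix xs ys
  show "linear (\<lambda>v. derivation V a F (xs @ v # ys))" using F
  proof (induction xs arbitrary: F)
    case Nil
    then show ?case
      by (intro linearI) (simp_all add: parity_add parity_scale pd_add pd_scale
          linear_add[OF a] linear_cmul[OF a] linear_add[OF multilinear_linear]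
          linear_cmul[OF multilinear_linear] algebra_simps)
  next
    case (Cons x xs)
    have "linear (\<lambda>v. F ((a (parity V x) # xs) @ v # ys))"
      using Cons.prems unfolding multilinear_def by blast
    then show ?case
      using linear_compose_add[OF Cons.IH[OF multilinear_pd[OF Cons.prems]]] by simp
  qed
qed

text \<open>Moving \<open>a v\<close> instead of \<open>v\<close> past \<open>w\<close> costs the
  additional sign of \<open>n * e\<close>, which is the parity of \<open>w\<close> because n is odd.
  The \<open>parity\<close> in the recursion of \<open>derivation\<close> supplies exactly this
  sign.\<close>

lemma Sym_derivation:
  assumes a: "linear a" "odd n" "\<And>d v. v \<in> V d \<Longrightarrow> a v \<in> V (d + n)" and F: "F \<in> Sym V"
  shows "derivation V a F \<in> Sym V"
proof (rule SymI)
  show "multilinear (derivation V a F)"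
    by (rule multilinear_derivation[OF a(1) Sym_multilinear[OF F]])
  fix xs ys d e v w assume v: "v \<in> V d" and w: "w \<in> V e"
  show "derivation V a F (xs @ v # w # ys)
      = (-1) powi (d * e) * derivation V a F (xs @ w # v # ys)"
    using F
  proof (induction xs arbitrary: F)
    case Nil
    note ml = Sym_multilinear[OF Nil] multilinear_pd[OF Sym_multilinear[OF Nil]]
    note lin = linear_neg[OF multilinear_linear[OF ml(1)]]
      linear_neg[OF multilinear_linear[OF ml(2)]]
    have 1: "pd w (pd v F) = (if odd d \<and> odd e then - pd v (pd w F) else pd v (pd w F))"
      by (rule Sym_swap_cases[OF Nil v w])
    have 2: "F (a v # w # ys) = (-1) powi ((d + n) * e) * pd w F (a v # ys)"
      and 3: "F (a w # v # ys) = (-1) powi ((e + n) * d) * pd v F (a w # ys)"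
      using Sym_swap_args[OF Nil a(3)[OF v] w, of "[]" ys]
        Sym_swap_args[OF Nil a(3)[OF w] v, of "[]" ys] by (simp_all add: pd_def)
    show ?case
      using a(2)
      by (cases "even d"; cases "even e")
        (auto simp: parity_homogeneous[OF v] parity_homogeneous[OF w] pd_neg ml 1 2 3
          linear_neg[OF a(1)] lin power_int_minus_left)
  next
    case (Cons x xs)
    show ?case
      using Cons.IH[OF Sym_pd[OF Cons.prems]]
        Sym_swap_args[OF Cons.prems v w, of "a (parity V x) # xs"]
      by (simp add: distrib_left)
  qed
qed

text \<open>Insertions of \<open>a\<close> and \<open>b\<close> into different arguments cancel,
  both maps being odd. Only the insertions into the same argument survive; their minus sign comes
  from \<open>parity V (a v) = - a (parity V v)\<close>. With \<open>a = b = q\<close> this gives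
  that Q squares to zero, with \<open>k\<close> and \<open>q\<close> the homotopy formula.\<close>

lemma derivation_anticommutator:
  assumes a: "linear a" "\<And>v. parity V (a v) = - a (parity V v)"
    and b: "linear b" "\<And>v. parity V (b v) = - b (parity V v)"
    and F: "multilinear F"
  shows "derivation V a (derivation V b F) vs + derivation V b (derivation V a F) vs
    = - even_derivation (\<lambda>v. a (b v) + b (a v)) F vs"
  using F
proof (induction vs arbitrary: F)
  case (Cons v vs)
  note F = Cons.prems
  show ?case
    using Cons.IH[OF multilinear_pd[OF F], of v]
    by (simp add: pd_derivation a(2) b(2) linear_neg[OF a(1)] linear_neg[OF b(1)] pd_neg[OF F]
        linear_neg[OF multilinear_linear[OF F]] linear_add[OF multilinear_linear[OF F]])
qed simp

text \<open>A map commuting with \<open>e\<close> preserves both summands, so its derivation keeps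
  the number of factors from each. For \<open>q\<close> this lets Q pass through the factor 1/#'' in
  K.\<close>

lemma derivation_count_part:
  assumes a: "linear a" "\<And>v. parity V (a v) = - a (parity V v)"
    and e: "linear e" "\<And>v. e (parity V v) = parity V (e v)" and ae: "\<And>v. a (e v) = e (a v)"
    and F: "multilinear F"
  shows "derivation V a (count_part e m F) vs = count_part e m (derivation V a F) vs"
  using F
proof (induction vs arbitrary: F m)
  case Nil then show ?case by (simp add: count_part_Nil)
next
  case (Cons v vs)
  note F = Cons.prems
  have pdc: "pd u (count_part e m F) = count_part e m (pd (u - e u) F)
      + (\<lambda>vs. (if m = 0 then 0 else 1) * count_part e (m - 1) (pd (e u) F) vs)" for u
    by (rule ext) (simp add: pd_count_part)
  note IH = Cons.IH[OF multilinear_pd[OF F]]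
  show ?case
    unfolding derivation.simps pdc derivation_plus derivation_scaled plus_fun_apply IH
      count_part_Cons pd_derivation count_part_add
    by (simp add: e(2) parity_diff ae[symmetric] linear_diff[OF a(1)])
qed

lemma Sym_count_part:
  assumes e: "linear e" "\<And>d v. v \<in> V d \<Longrightarrow> e v \<in> V d" and F: "F \<in> Sym V"
  shows "count_part e m F \<in> Sym V"
proof (rule SymI)
  show "multilinear (count_part e m F)"
    by (rule multilinear_count_part[OF e(1) Sym_multilinear[OF F]])
  fix xs ys d d' v w assume v: "v \<in> V d" and w: "w \<in> V d'"
  have v': "v - e v \<in> V d" "e v \<in> V d" "w - e w \<in> V d'" "e w \<in> V d'"
    using e(2) v w by (auto intro: subspace_diff subspace_degree)
  show "count_part e m F (xs @ v # w # ys) = (-1) powi (d * d') * count_part e m F (xs @ w # v # ys)"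
    using F
  proof (induction xs arbitrary: F m)
    case Nil
    have "pd y (pd x F) = (\<lambda>vs. (-1) powi (d * d') * pd x (pd y F) vs)"
      if "x \<in> V d" "y \<in> V d'" for x y
      by (rule Sym_swap[OF Nil that])
    then show ?case
      using v' by (simp add: count_part_Cons count_part_scale distrib_left)
  next
    case (Cons x xs)
    show ?case
      using Cons.IH[OF Sym_pd[OF Cons.prems]]
      by (simp add: count_part_Cons distrib_left)
  qed
qed

end

lemma (in graded_space) Sym_sum_list:
  "(\<And>a b. f a b \<in> Sym V) \<Longrightarrow> (\<lambda>vs. \<Sum>(a, b)\<leftarrow>L. f a b vs) \<in> Sym V"
proof (induction L)
  case Nil show ?case using Sym_zero by (simp add: zero_fun_def)
next
  case (Cons x L)
  obtain a b where x: "x = (a, b)" by (cases x)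
  have *: "(\<lambda>vs. \<Sum>(a, b)\<leftarrow>x # L. f a b vs) = f a b + (\<lambda>vs. \<Sum>(a, b)\<leftarrow>L. f a b vs)"
    by (simp add: x fun_eq_iff)
  show ?case unfolding * by (intro Sym_add Cons)
qed

section \<open>The BV operator through tensor identities of the copairing\<close>

lemma BV_eq: "BV V \<omega> F = (\<lambda>vs. (-1/2) * (\<Sum>(a, b)\<leftarrow>copairing V \<omega>. pd a (pd b F) vs))"
  by (simp add: BV_def fun_eq_iff)

lemma BV_cong:
  assumes "\<And>ws. length ws = length vs + 2 \<Longrightarrow> F ws = H ws"
  shows "BV V \<omega> F vs = BV V \<omega> H vs"
  using assms by (simp add: BV_def pd_def)

context dg_symplectic
begin

lemma BV_plus: "BV V \<omega> (F + H) = BV V \<omega> F + BV V \<omega> H"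
  by (rule ext) (simp add: BV_eq pair_sum_add algebra_simps)

lemma BV_scaled: "BV V \<omega> (\<lambda>vs. r * F vs) = (\<lambda>vs. r * BV V \<omega> F vs)"
  by (rule ext) (simp add: BV_eq case_prod_beta' sum_list_const_mult)

lemma Sym_BV: "F \<in> Sym V \<Longrightarrow> BV V \<omega> F \<in> Sym V"
  unfolding BV_eq by (intro Sym_scale Sym_sum_list Sym_pd)

lemma Q_op_eq: "Q_op V q F = - derivation V q F"
  by (rule ext) (simp add: Q_op_def)

lemma Sym_Q_op: "F \<in> Sym V \<Longrightarrow> Q_op V q F \<in> Sym V"
  unfolding Q_op_eq by (rule Sym_uminus, rule Sym_derivation[of q 1])
    (auto simp: linear_q q_degree)

lemma Q_op_Q_op:
  assumes "multilinear F" shows "Q_op V q (Q_op V q F) = 0"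
proof (rule ext)
  fix vs
  have "derivation V q (derivation V q F) vs = 0"
    using derivation_anticommutator[OF linear_q q_parity linear_q q_parity assms, of vs]
    by (simp add: q_square even_derivation_zero_map[OF assms])
  then show "Q_op V q (Q_op V q F) vs = 0 vs" by (simp add: Q_op_eq)
qed

context
  fixes B0 :: "'v set"
  assumes fin: "finite B0" "span B0 = UNIV"
begin

text \<open>By nondegeneracy the coordinates of the second factor are pairings with fixed vectors
  \<open>- u c\<close>. A tensor is therefore determined by its contractions in the second factor,
  for arbitrary lists and not only for copairings.\<close>

lemma pairing_tensor_eqI:
  assumes L: "bilinear (L :: 'v \<Rightarrow> 'v \<Rightarrow> real)"
    and eq: "\<And>v. (\<Sum>(a, b)\<leftarrow>K1. \<omega> b v *\<^sub>R a) = (\<Sum>(a, b)\<leftarrow>K2. \<omega> b v *\<^sub>R a)"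
  shows "(\<Sum>(a, b)\<leftarrow>K1. L a b) = (\<Sum>(a, b)\<leftarrow>K2. L a b)"
proof -
  obtain B :: "'v set" where B: "finite B" "independent B" "span B = UNIV"
    by (rule finite_basis[OF fin])
  have L1: "linear (\<lambda>x. L x y)" and L2: "linear (L x)" for x y
    using L unfolding bilinear_iff by auto
  have "\<exists>u. \<forall>y. representation B y c = \<omega> u y" for c
    by (intro pairing_represents[OF fin] linear_representation B)
  then obtain u where u: "\<And>y c. representation B y c = \<omega> (u c) y" by metis
  have *: "L a b = (\<Sum>c\<in>B. L (\<omega> b (- u c) *\<^sub>R a) c)" for a b
  proof -
    have "b = (\<Sum>c\<in>B. representation B b c *\<^sub>R c)"
      using B by (intro sum_representation_eq[symmetric]) auto
    also have "\<dots> = (\<Sum>c\<in>B. \<omega> b (- u c) *\<^sub>R c)"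
      by (intro sum.cong refl) (simp add: u pairing_simps antisymmetric[of b])
    finally have "L a b = L a (\<Sum>c\<in>B. \<omega> b (- u c) *\<^sub>R c)" by simp
    then show ?thesis by (simp add: linear_sum[OF L2] linear_cmul[OF L1] linear_cmul[OF L2])
  qed
  have "(\<Sum>(a, b)\<leftarrow>K0. L a b) = (\<Sum>c\<in>B. L (\<Sum>(a, b)\<leftarrow>K0. \<omega> b (- u c) *\<^sub>R a) c)" for K0
  proof -
    have "(\<Sum>(a, b)\<leftarrow>K0. L a b) = (\<Sum>(a, b)\<leftarrow>K0. \<Sum>c\<in>B. L (\<omega> b (- u c) *\<^sub>R a) c)"
      by (simp only: *[symmetric])
    also have "\<dots> = (\<Sum>c\<in>B. \<Sum>(a, b)\<leftarrow>K0. L (\<omega> b (- u c) *\<^sub>R a) c)"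
      by (induction K0) (auto simp: sum.distrib)
    finally show ?thesis unfolding sum_list_pair_linear[OF L1] .
  qed
  then show ?thesis by (simp only: eq)
qed

text \<open>The pairing lives on total degree 1, so the tensor has degree 1 as well and the parity
  map, applied to both factors, acts on it by -1.\<close>

lemma copairing_parity_neg:
  assumes L: "bilinear (L :: 'v \<Rightarrow> 'v \<Rightarrow> real)"
  shows "(\<Sum>(a, b)\<leftarrow>copairing V \<omega>. L (parity V a) (parity V b)) = - (\<Sum>(a, b)\<leftarrow>copairing V \<omega>. L a b)"
proof -
  have "linear (L x)" for x using L unfolding bilinear_iff by auto
  then show ?thesis
    using copairing_parity[OF fin L] by (simp add: linear_neg pair_sum_neg)
qed

text \<open>The compatibility of \<open>q\<close> with the pairing, written for the inverse tensor:
  contracted with \<open>v\<close>, both sides give \<open>q (parity V v)\<close>.\<close>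

lemma copairing_q:
  assumes L: "bilinear (L :: 'v \<Rightarrow> 'v \<Rightarrow> real)"
  shows "(\<Sum>(a, b)\<leftarrow>copairing V \<omega>. L (q a) b) = (\<Sum>(a, b)\<leftarrow>copairing V \<omega>. L a (q (parity V b)))"
proof -
  have "(\<Sum>(a, b)\<leftarrow>map (\<lambda>(a, b). (q a, b)) (copairing V \<omega>). L a b)
      = (\<Sum>(a, b)\<leftarrow>map (\<lambda>(a, b). (a, q (parity V b))) (copairing V \<omega>). L a b)"
  proof (rule pairing_tensor_eqI[OF L])
    fix v
    note K = copairing_sum[OF is_copairing_copairing[OF fin]]
    have "(\<Sum>(a, b)\<leftarrow>map (\<lambda>(a, b). (q a, b)) (copairing V \<omega>). \<omega> b v *\<^sub>R a)
        = (\<Sum>(a, b)\<leftarrow>copairing V \<omega>. q (\<omega> b v *\<^sub>R a))"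
      by (simp add: o_def case_prod_beta' linear_cmul[OF linear_q])
    also have "\<dots> = q (parity V v)"
      unfolding K[symmetric] by (rule sum_list_pair_linear[OF linear_q, symmetric])
    also have "\<dots> = - parity V (q v)"
      by (simp add: q_parity)
    also have "\<dots> = (\<Sum>(a, b)\<leftarrow>copairing V \<omega>. - (\<omega> b (q v) *\<^sub>R a))"
      unfolding K[symmetric] by (rule sum_list_pair_linear) (intro linearI; simp)
    also have "\<dots> = (\<Sum>(a, b)\<leftarrow>map (\<lambda>(a, b). (a, q (parity V b))) (copairing V \<omega>). \<omega> b v *\<^sub>R a)"
      by (simp add: o_def case_prod_beta' pairing_q)
    finally show "(\<Sum>(a, b)\<leftarrow>map (\<lambda>(a, b). (q a, b)) (copairing V \<omega>). \<omega> b v *\<^sub>R a)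
        = (\<Sum>(a, b)\<leftarrow>map (\<lambda>(a, b). (a, q (parity V b))) (copairing V \<omega>). \<omega> b v *\<^sub>R a)" .
  qed
  then show ?thesis by (simp add: o_def case_prod_beta')
qed

text \<open>Pulling both partial derivatives through the derivation leaves one term with the
  derivation outside, whose sign is that of the odd tensor, and two terms with \<open>q\<close> on
  one tensor factor. The latter cancel by \<open>copairing_q\<close>.\<close>

lemma BV_Q_op:
  assumes F: "multilinear F" shows "BV V \<omega> (Q_op V q F) = - Q_op V q (BV V \<omega> F)"
proof (rule ext)
  fix vs
  let ?S = "\<lambda>L. \<Sum>(a, b)\<leftarrow>copairing V \<omega>. L a b :: real"
  note ml = F multilinear_pd[OF F]
  have "pd a (pd b (derivation V q F)) vs
      = derivation V q (pd (parity V a) (pd (parity V b) F)) vs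
        + (pd (q (parity V a)) (pd (parity V b) F) vs + pd a (pd (q (parity V b)) F) vs)" for a b
    by (simp add: pd_derivation)
  then have "?S (\<lambda>a b. pd a (pd b (derivation V q F)) vs)
      = ?S (\<lambda>a b. derivation V q (pd (parity V a) (pd (parity V b) F)) vs)
        + (?S (\<lambda>a b. pd (q (parity V a)) (pd (parity V b) F) vs)
          + ?S (\<lambda>a b. pd a (pd (q (parity V b)) F) vs))"
    by (simp only: pair_sum_add)
  also have "?S (\<lambda>a b. derivation V q (pd (parity V a) (pd (parity V b) F)) vs)
      = - ?S (\<lambda>a b. derivation V q (pd a (pd b F)) vs)"
    by (rule copairing_parity_neg) (auto simp: bilinear_iff intro!: linearI
        simp: pd_add[OF ml(1)] pd_add[OF ml(2)] pd_scale[OF ml(1)] pd_scale[OF ml(2)])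
  also have "?S (\<lambda>a b. pd (q (parity V a)) (pd (parity V b) F) vs)
      = - ?S (\<lambda>a b. pd (q a) (pd b F) vs)"
    by (rule copairing_parity_neg) (auto simp: bilinear_iff intro!: linearI
        simp: pd_add[OF ml(1)] pd_add[OF ml(2)] pd_scale[OF ml(1)] pd_scale[OF ml(2)]
        linear_add[OF linear_q] linear_cmul[OF linear_q])
  also have "?S (\<lambda>a b. pd (q a) (pd b F) vs) = ?S (\<lambda>a b. pd a (pd (q (parity V b)) F) vs)"
    by (rule copairing_q) (auto simp: bilinear_iff intro!: linearI
        simp: pd_add[OF ml(1)] pd_add[OF ml(2)] pd_scale[OF ml(1)] pd_scale[OF ml(2)])
  finally have *: "?S (\<lambda>a b. pd a (pd b (derivation V q F)) vs)
      = - ?S (\<lambda>a b. derivation V q (pd a (pd b F)) vs)" by simp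
  have "derivation V q (BV V \<omega> F) vs
      = (-1/2) * ?S (\<lambda>a b. derivation V q (pd a (pd b F)) vs)"
    unfolding BV_eq derivation_scaled
      linear_form_operator_sum_list[of "derivation V q", OF derivation_plus derivation_scaled] ..
  moreover have "BV V \<omega> (derivation V q F) vs = (-1/2) * ?S (\<lambda>a b. pd a (pd b (derivation V q F)) vs)"
    unfolding BV_eq ..
  ultimately have "BV V \<omega> (derivation V q F) vs = - derivation V q (BV V \<omega> F) vs"
    using * by simp
  moreover have "BV V \<omega> (- derivation V q F) = - BV V \<omega> (derivation V q F)"
    using BV_scaled[of "-1" "derivation V q F"] by (simp add: fun_Compl_def)
  ultimately show "BV V \<omega> (Q_op V q F) vs = (- Q_op V q (BV V \<omega> F)) vs"
    by (simp add: Q_op_eq)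
qed

text \<open>The even part of \<open>v\<close> commutes with both derivatives in Delta. Its odd part
  passes them at the price of \<open>parity\<close> on both tensor factors, that is, of a minus
  sign.\<close>

lemma pd_BV:
  assumes F: "F \<in> Sym V" shows "pd v (BV V \<omega> F) = BV V \<omega> (pd (parity V v) F)"
proof (rule ext)
  fix vs
  let ?S = "\<lambda>L. \<Sum>(a, b)\<leftarrow>copairing V \<omega>. L a b :: real"
  note ml = Sym_multilinear[OF Sym_pd[OF F]] multilinear_pd[OF Sym_multilinear[OF Sym_pd[OF F]]]
  have "pd v (pd a (pd b F)) vs = pd a (pd b (pd (even_part V v) F)) vs
      + pd (parity V a) (pd (parity V b) (pd (odd_part V v) F)) vs" for a b
  proof -
    have "pd v (pd a (pd b F)) = pd (even_part V v) (pd a (pd b F)) + pd (odd_part V v) (pd a (pd b F))"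
      by (simp flip: pd_add[OF Sym_multilinear[OF Sym_pd[OF Sym_pd[OF F]]]] add: even_odd_sum)
    then show ?thesis
      by (simp add: pd_pd_sign[OF fin Sym_pd[OF F]] pd_pd_sign[OF fin F])
  qed
  then have "?S (\<lambda>a b. pd v (pd a (pd b F)) vs) = ?S (\<lambda>a b. pd a (pd b (pd (even_part V v) F)) vs)
      + ?S (\<lambda>a b. pd (parity V a) (pd (parity V b) (pd (odd_part V v) F)) vs)"
    by (simp only: pair_sum_add)
  also have "?S (\<lambda>a b. pd (parity V a) (pd (parity V b) (pd (odd_part V v) F)) vs)
      = - ?S (\<lambda>a b. pd a (pd b (pd (odd_part V v) F)) vs)"
    by (rule copairing_parity_neg) (auto simp: bilinear_iff intro!: linearI
        simp: pd_add[OF ml(1)] pd_add[OF ml(2)] pd_scale[OF ml(1)] pd_scale[OF ml(2)])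
  also have "?S (\<lambda>a b. pd a (pd b (pd (even_part V v) F)) vs)
      + - ?S (\<lambda>a b. pd a (pd b (pd (odd_part V v) F)) vs)
      = ?S (\<lambda>a b. pd a (pd b (pd (parity V v) F)) vs)"
    by (simp add: parity_even_odd pd_diff[OF Sym_multilinear[OF F]]
        flip: pair_sum_neg pair_sum_add)
  finally show "pd v (BV V \<omega> F) vs = BV V \<omega> (pd (parity V v) F) vs"
    by (simp only: BV_eq pd_scaled pd_sum_list)
qed

text \<open>\<open>\<Delta>\<close> commutes with each \<open>\<partial>\<^sub>v\<close> up to parity, and the parity map changes the sign of \<open>\<K>\<^sub>0\<close>;
  hence \<open>\<Delta>\<^sup>2 = - \<Delta>\<^sup>2\<close>.\<close>

lemma BV_BV:
  assumes F: "F \<in> Sym V" shows "BV V \<omega> (BV V \<omega> F) = 0"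
proof (rule ext)
  fix vs
  let ?S = "\<lambda>L. \<Sum>(a, b)\<leftarrow>copairing V \<omega>. L a b :: real"
  note ml = Sym_multilinear[OF F] multilinear_pd[OF Sym_multilinear[OF F]]
  have "BV V \<omega> (BV V \<omega> F) vs = (-1/2) * ?S (\<lambda>a b. pd a (pd b (BV V \<omega> F)) vs)"
    by (simp only: BV_eq)
  also have "\<dots> = (-1/2) * ?S (\<lambda>a b. BV V \<omega> (pd (parity V a) (pd (parity V b) F)) vs)"
    by (simp only: pd_BV[OF F] pd_BV[OF Sym_pd[OF F]])
  also have "?S (\<lambda>a b. BV V \<omega> (pd (parity V a) (pd (parity V b) F)) vs)
      = - ?S (\<lambda>a b. BV V \<omega> (pd a (pd b F)) vs)"
    by (rule copairing_parity_neg) (auto simp: bilinear_iff intro!: linearI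
        simp: pd_add[OF ml(1)] pd_add[OF ml(2)] pd_scale[OF ml(1)] pd_scale[OF ml(2)]
          BV_plus BV_scaled)
  also have "(-1/2) * - ?S (\<lambda>a b. BV V \<omega> (pd a (pd b F)) vs) = - BV V \<omega> (BV V \<omega> F) vs"
    unfolding BV_eq[of V \<omega> F] BV_scaled
      linear_form_operator_sum_list[of "BV V \<omega>", OF BV_plus BV_scaled] by simp
  finally show "BV V \<omega> (BV V \<omega> F) vs = 0 vs" by simp
qed

end

end

section \<open>Pullbacks along degree-preserving maps\<close>

lemma sum_form_apply: "(\<Sum>x\<in>X. f x :: 'v form) vs = (\<Sum>x\<in>X. f x vs)"
  by (induction X rule: infinite_finite_induct) auto

lemma pd_pullback: "pd v (pullback f F) = pullback f (pd (f v) F)"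
  by (rule ext) (simp add: pd_def pullback_def)

text \<open>Instantiated for both \<open>p\<close> and \<open>i\<close>. Preserving degrees makes
  \<open>f\<close> commute with \<open>parity\<close>, the only part of the grading that enters the
  product, and so pullback is an algebra map.\<close>

locale degree_preserving = V: graded_space V + U: graded_space U
  for V :: "int \<Rightarrow> 'v::real_vector set" and U :: "int \<Rightarrow> 'u::real_vector set" +
  fixes f :: "'v \<Rightarrow> 'u"
  assumes linear_f: "linear f" and f_degree: "v \<in> V d \<Longrightarrow> f v \<in> U d"
begin

lemma f_parity: "f (parity V v) = parity U (f v)"
proof (rule V.linear_eq_homogeneous[where f = "\<lambda>v. f (parity V v)" and g = "\<lambda>v. parity U (f v)"])
  show "linear (\<lambda>v. f (parity V v))"
    using linear_compose[OF V.linear_parity linear_f] by (simp add: o_def)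
  show "linear (\<lambda>v. parity U (f v))"
    using linear_compose[OF linear_f U.linear_parity] by (simp add: o_def)
  fix d v assume "v \<in> V d"
  then show "f (parity V v) = parity U (f v)"
    by (simp add: V.parity_homogeneous U.parity_homogeneous[OF f_degree] linear_cmul[OF linear_f])
qed

lemma f_parts: "f (even_part V v) = even_part U (f v)" "f (odd_part V v) = odd_part U (f v)"
  by (simp_all add: even_part_def odd_part_def f_parity linear_cmul[OF linear_f]
      linear_add[OF linear_f] linear_diff[OF linear_f])

lemma sgn_form_pullback: "sgn_form V (pullback f F) = pullback f (sgn_form U F)"
  by (rule ext) (simp add: sgn_form_def pullback_def f_parity o_def)

lemma prod_form_pullback:
  "prod_form V (pullback f F) (pullback f H) = pullback f (prod_form U F H)"
proof (rule ext)
  fix vs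
  show "prod_form V (pullback f F) (pullback f H) vs = pullback f (prod_form U F H) vs"
  proof (induction vs arbitrary: F H)
    case Nil then show ?case by (simp add: pullback_def)
  next
    case (Cons v vs)
    show ?case
      by (simp add: pd_pullback sgn_form_pullback Cons.IH f_parts) (simp add: pullback_def f_parts)
  qed
qed

lemma Sym_pullback:
  assumes F: "F \<in> Sym U" shows "pullback f F \<in> Sym V"
proof (rule V.SymI)
  have "linear (\<lambda>u. F (xs @ u # ys))" for xs ys
    using U.Sym_multilinear[OF F] unfolding multilinear_def by blast
  from linear_compose[OF linear_f this] show "multilinear (pullback f F)"
    by (simp add: multilinear_def pullback_def o_def)
  fix xs ys d e v w assume "v \<in> V d" "w \<in> V e"
  from U.Sym_swap_args[OF F f_degree[OF this(1)] f_degree[OF this(2)], of "map f xs" "map f ys"]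
  show "pullback f F (xs @ v # w # ys) = (-1) powi (d * e) * pullback f F (xs @ w # v # ys)"
    by (simp add: pullback_def)
qed

lemma formal_power_pullback:
  "formal_power V (coeffwise (pullback f) F) m = coeffwise (pullback f) (formal_power U F m)"
proof (induction m)
  case 0
  show ?case by (simp add: formal_power_def const_hbar_def pullback_def unit_form_def fun_eq_iff)
next
  case (Suc m)
  have "formal_mult V (coeffwise (pullback f) F) (coeffwise (pullback f) H)
      = coeffwise (pullback f) (formal_mult U F H)" for H
    by (simp add: formal_mult_def prod_form_pullback fun_eq_iff) (simp add: pullback_def formal_mult_def)
  then show ?case using Suc by (simp add: formal_power_def)
qed

lemma formal_exp_pullback:
  "formal_exp V (coeffwise (pullback f) F) = coeffwise (pullback f) (formal_exp U F)"
  by (simp add: formal_exp_def formal_power_pullback fun_eq_iff) (simp add: pullback_def formal_exp_def)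

end

section \<open>The operator K, its homotopy formula, and Delta on pullbacks\<close>

context cyclic_sdr
begin

sublocale p: degree_preserving V U p
  by (intro degree_preserving.intro degree_preserving_axioms.intro V.graded_space_axioms
      U.graded_space_axioms linear_p p_degree)

sublocale i: degree_preserving U V i
  by (intro degree_preserving.intro degree_preserving_axioms.intro V.graded_space_axioms
      U.graded_space_axioms linear_i i_degree)

abbreviation proj :: "'v \<Rightarrow> 'v" where
  "proj v \<equiv> k (q v) + q (k v)"

lemma k_parity: "parity V (k v) = - k (parity V v)"
  by (rule V.odd_map_parity[OF linear_k, of "-1"]) (use k_degree in auto)

lemma proj_degree: "v \<in> V d \<Longrightarrow> proj v \<in> V d"
  using k_degree[OF V.q_degree] V.q_degree[OF k_degree]
  by (fastforce intro: subspace_add V.subspace_degree)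

lemma proj_idem: "proj (proj v) = proj v"
  by (rule projection(3)) blast

lemma id_minus_proj: "v - proj v = i (p v)"
  using homotopy[of v] by (simp add: algebra_simps)

lemma q_proj: "q (proj v) = proj (q v)"
  by (simp add: linear_add[OF V.linear_q] V.q_square linear_0[OF linear_k] linear_0[OF V.linear_q])

text \<open>The bound in \<open>K_op\<close> moves with the argument list. Raising it to a common n
  adds only zero terms and presents K F, on lists of length at most n, as one fixed combination of
  forms.\<close>

lemma K_op_eq:
  assumes "length vs \<le> n"
  shows "K_op V q k F vs = (\<Sum>m = 1..n. 1 / real m * derivation V k (count_part proj m F) vs)"
  unfolding K_op_def
proof (rule sum.mono_neutral_left)
  show "\<forall>m\<in>{1..n} - {1..length vs}. 1 / real m * derivation V k (count_part proj m F) vs = 0"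
  proof
    fix m assume "m \<in> {1..n} - {1..length vs}"
    then have "derivation V k (count_part proj m F) vs = 0"
      by (intro V.derivation_degree_zero[of "length vs"] count_part_short) auto
    then show "1 / real m * derivation V k (count_part proj m F) vs = 0" by simp
  qed
qed (use assms in auto)

lemma K_op_eq_sum:
  assumes "length vs \<le> n"
  shows "K_op V q k F vs = (\<Sum>m = 1..n. (\<lambda>vs. 1 / real m * derivation V k (count_part proj m F) vs)) vs"
  unfolding K_op_eq[OF assms] by (simp only: sum_form_apply)

lemma K_op_cong:
  assumes "\<And>ws. length ws = length vs \<Longrightarrow> F ws = H ws"
  shows "K_op V q k F vs = K_op V q k H vs"
  unfolding K_op_def
  by (intro sum.cong refl arg_cong2[where f = "(*)"] V.derivation_cong count_part_cong)
    (simp add: assms)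

lemma K_op_plus: "K_op V q k (F + H) = K_op V q k F + K_op V q k H"
  by (rule ext) (simp add: K_op_def count_part_add sum.distrib add_divide_distrib)

lemma K_op_scaled: "K_op V q k (\<lambda>vs. r * F vs) = (\<lambda>vs. r * K_op V q k F vs)"
  by (rule ext) (simp add: K_op_def count_part_scale sum_distrib_left)

lemma Sym_derivation_k: "F \<in> Sym V \<Longrightarrow> derivation V k F \<in> Sym V"
  by (rule V.Sym_derivation[OF linear_k, of "-1"]) (use k_degree in auto)

lemma Sym_K_op:
  assumes F: "F \<in> Sym V" shows "K_op V q k F \<in> Sym V"
proof (rule V.Sym_locally)
  fix n
  show "\<exists>H\<in>Sym V. \<forall>vs. length vs = n \<longrightarrow> K_op V q k F vs = H vs"
  proof (intro bexI allI impI)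
    show "(\<Sum>m = 1..n. (\<lambda>vs. 1 / real m * derivation V k (count_part proj m F) vs)) \<in> Sym V"
      by (intro V.Sym_sum V.Sym_scale Sym_derivation_k
          V.Sym_count_part[where e = proj, OF linear_projection proj_degree F])
  next
    fix vs :: "'v list" assume "length vs = n"
    then show "K_op V q k F vs
        = (\<Sum>m = 1..n. (\<lambda>vs. 1 / real m * derivation V k (count_part proj m F) vs)) vs"
      by (intro K_op_eq_sum) simp
  qed
qed

text \<open>As \<open>p\<close> vanishes on \<open>V''\<close>, a pulled back form has no factor
  from the dual of \<open>V''\<close>; only the part with #'' = 0 is left, where K is zero.\<close>

lemma K_op_pullback_p: "K_op V q k (pullback p F) = 0" if "multilinear F"
proof (rule ext)
  fix vs
  have pe: "p (proj v) = 0" for v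
    using p_chain by (simp add: linear_add[OF linear_p] pk_zero p_chain linear_0[OF U.linear_q])
  have "count_part proj m (pullback p F) vs = 0" if "m \<ge> 1" "multilinear F" for m vs F
    using that
  proof (induction vs arbitrary: m F)
    case Nil then show ?case by (simp add: count_part_Nil)
  next
    case (Cons v vs)
    have "count_part proj n 0 vs = 0" for n by (simp add: count_part_def)
    moreover have "pd (p (proj v)) F = 0" unfolding pe by (rule pd_0[OF Cons.prems(2)])
    moreover have "pullback p 0 = 0" by (simp add: pullback_def fun_eq_iff)
    ultimately show ?case
      using Cons.IH[OF Cons.prems(1) multilinear_pd[OF Cons.prems(2)]]
      by (simp add: count_part_Cons pd_pullback)
  qed
  then have "count_part proj m (pullback p F) = 0" if "m \<ge> 1" for m
    using that \<open>multilinear F\<close> by (simp add: fun_eq_iff)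
  then show "K_op V q k (pullback p F) vs = 0 vs"
    by (simp add: K_op_def)
qed

text \<open>\<open>[Q, K\<^sub>u\<^sub>n]\<close> is the derivation induced by \<open>k q + q k\<close>, which multiplies a monomial by
  \<open>#''\<close>.\<close>

lemma Q_K_homotopy:
  assumes F: "multilinear F"
  shows "Q_op V q (K_op V q k F) + K_op V q k (Q_op V q F) = F - pullback p (pullback i F)"
proof (rule ext)
  fix vs :: "'v list"
  let ?n = "length vs" and ?D = "derivation V"
  let ?c = "\<lambda>m. count_part proj m F"
  have ml: "multilinear (?c m)" for m
    by (rule V.multilinear_count_part[OF linear_projection F])
  have comm: "?D q (?c m) = count_part proj m (?D q F)" for m
  proof (rule ext, rule V.derivation_count_part[where e = proj])
    show "q (proj v) = proj (q v)" for v by (rule q_proj)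
    show "proj (parity V v) = parity V (proj v)" for v by (rule projection_parity)
  qed (fact V.linear_q V.q_parity linear_projection F)+
  have sum: "?D q (\<Sum>m\<in>M. f m) = (\<Sum>m\<in>M. ?D q (f m))" for M and f :: "nat \<Rightarrow> 'v form"
    by (induction M rule: infinite_finite_induct) (simp_all only: sum.infinite sum.empty
        sum.insert V.derivation_zero V.derivation_plus not_False_eq_True)
  have "?D q (K_op V q k F) vs
      = ?D q (\<Sum>m = 1..?n. (\<lambda>vs. 1 / real m * ?D k (?c m) vs)) vs"
    by (intro V.derivation_cong K_op_eq_sum) simp
  also have "\<dots> = (\<Sum>m = 1..?n. 1 / real m * ?D q (?D k (?c m)) vs)"
    by (simp only: sum sum_form_apply V.derivation_scaled)
  finally have 1: "?D q (K_op V q k F) vs = (\<Sum>m = 1..?n. 1 / real m * ?D q (?D k (?c m)) vs)" .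
  have 2: "K_op V q k (?D q F) vs = (\<Sum>m = 1..?n. 1 / real m * ?D k (?D q (?c m)) vs)"
    by (simp only: K_op_def comm)
  have "?D q (K_op V q k F) vs + K_op V q k (?D q F) vs
      = (\<Sum>m = 1..?n. 1 / real m * (?D k (?D q (?c m)) vs + ?D q (?D k (?c m)) vs))"
    unfolding 1 2 by (simp add: sum.distrib distrib_left)
  also have "\<dots> = (\<Sum>m = 1..?n. - ?c m vs)"
  proof (rule sum.cong[OF refl])
    fix m assume m: "m \<in> {1..?n}"
    \<comment> \<open>The anticommutator is minus the Euler operator of the projection, hence -m on
      this part; the weight 1/m in K cancels it.\<close>
    have "?D k (?D q (?c m)) vs + ?D q (?D k (?c m)) vs = - (real m * ?c m vs)"
      unfolding V.derivation_anticommutator[OF linear_k k_parity V.linear_q V.q_parity ml]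
        even_derivation_count_part[where e = proj, OF linear_projection proj_idem F] ..
    then show "1 / real m * (?D k (?D q (?c m)) vs + ?D q (?D k (?c m)) vs) = - ?c m vs"
      using m by simp
  qed
  \<comment> \<open>All parts together make up F, so those with m at least 1 are F without its part
    m = 0, which is I P F.\<close>
  also have "\<dots> = ?c 0 vs - (\<Sum>m\<le>?n. ?c m vs)"
    by (simp add: sum_negf atMost_atLeast0 sum.atLeast_Suc_atMost)
  also have "\<dots> = pullback p (pullback i F) vs - F vs"
    by (simp add: sum_count_part[OF linear_projection F] count_part_0 id_minus_proj pullback_def o_def)
  finally have "?D q (K_op V q k F) vs + K_op V q k (?D q F) vs = pullback p (pullback i F) vs - F vs" .
  moreover have "K_op V q k (- ?D q F) = - K_op V q k (?D q F)"
    using K_op_scaled[of "-1" "?D q F"] by (simp add: fun_Compl_def)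
  ultimately show "(Q_op V q (K_op V q k F) + K_op V q k (Q_op V q F)) vs
      = (F - pullback p (pullback i F)) vs"
    by (simp add: V.Q_op_eq)
qed

text \<open>Differentiating a pullback along \<open>v\<close> means differentiating the form along
  \<open>p v\<close>, so Delta acts through the tensor pushed forward by \<open>p\<close>. As
  \<open>p\<close> is adjoint to \<open>i\<close> and \<open>p (i u) = u\<close>, that tensor is a
  copairing of U.\<close>

lemma BV_pullback_p:
  assumes fin: "finite B0" "span B0 = (UNIV :: 'v set)" and F: "multilinear F"
  shows "BV V \<omega> (pullback p F) = pullback p (BV U \<omega>U F)"
proof (rule ext)
  fix vs
  \<comment> \<open>A spanning set of V is mapped to one of U; with U finite-dimensional, any list
    satisfying the copairing condition may be used to compute Delta there.\<close>
  have "surj p" by (rule surjI[of p i]) (rule pi_id)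
  then have finU: "finite (p ` B0)" "span (p ` B0) = (UNIV :: 'u set)"
    using fin linear_span_image[OF linear_p, of B0] by simp_all
  have adj: "\<omega>U (p v) u = \<omega> v (i u)" for u v
  proof -
    have "\<omega> (i u) v = \<omega>U u (p v)"
    proof (rule U.linear_eq_homogeneous[where f = "\<lambda>u. \<omega> (i u) v" and g = "\<lambda>u. \<omega>U u (p v)"])
      show "linear (\<lambda>u. \<omega> (i u) v)"
        using linear_compose[OF linear_i V.linear_pairing_left] by (simp add: o_def)
    qed (use i_adjoint in \<open>auto simp: is_adjoint_def U.linear_pairing_left\<close>)
    then show ?thesis using V.antisymmetric[of "i u" v] U.antisymmetric[of u "p v"] by simp
  qed
  let ?K = "map (\<lambda>(a, b). (p a, p b)) (copairing V \<omega>)"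
  have "is_copairing U \<omega>U ?K"
  proof (rule U.copairingI)
    fix u
    have "(\<Sum>(a, b)\<leftarrow>?K. \<omega>U b u *\<^sub>R a) = (\<Sum>(a, b)\<leftarrow>copairing V \<omega>. p (\<omega> b (i u) *\<^sub>R a))"
      by (simp add: o_def case_prod_beta' adj linear_cmul[OF linear_p])
    also have "\<dots> = p (parity V (i u))"
      unfolding V.copairing_sum[OF V.is_copairing_copairing[OF fin], symmetric]
      by (rule sum_list_pair_linear[OF linear_p, symmetric])
    finally show "(\<Sum>(a, b)\<leftarrow>?K. \<omega>U b u *\<^sub>R a) = parity U u"
      by (simp add: p.f_parity pi_id)
  qed
  from U.BV_copairing[OF finU this F]
  show "BV V \<omega> (pullback p F) vs = pullback p (BV U \<omega>U F) vs"
    by (simp add: BV_def[of V] pd_pullback o_def case_prod_beta') (simp add: pullback_def)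
qed

end

section \<open>Finiteness in each weight: shifts, descent, products and exponentials\<close>

definition weight_support :: "'v formal \<Rightarrow> int \<Rightarrow> int set" where
  "weight_support F w = {g. \<exists>vs. int (length vs) + 2 * g = w \<and> F g vs \<noteq> 0}"

lemma formal_space_iff:
  "F \<in> formal_space V \<longleftrightarrow> (\<forall>g. F g \<in> Sym V) \<and> (\<forall>w. finite (weight_support F w))"
  by (simp add: formal_space_def weight_support_def)

lemma formal_space_Sym: "F \<in> formal_space V \<Longrightarrow> F g \<in> Sym V"
  by (simp add: formal_space_iff)

text \<open>If coefficients of H at power g and length n can only come from those of F at g - c and
  n + s, then weight w of H comes from the single weight w + s - 2 c of F, where finitely many
  powers of hbar occur.\<close>

lemma formal_space_shift:
  assumes F: "F \<in> formal_space V" and H: "\<And>g. H g \<in> Sym V'"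
    and nonzero: "\<And>g vs. H g vs \<noteq> 0 \<Longrightarrow> \<exists>us. length us = length vs + s \<and> F (g - c) us \<noteq> 0"
  shows "H \<in> formal_space V'"
proof -
  have "finite (weight_support H w)" for w
  proof (rule finite_surj)
    show "finite (weight_support F (w + int s - 2 * c))" using F by (simp add: formal_space_iff)
    show "weight_support H w \<subseteq> (\<lambda>g. g + c) ` weight_support F (w + int s - 2 * c)"
    proof
      fix g assume "g \<in> weight_support H w"
      then obtain vs where vs: "int (length vs) + 2 * g = w" "H g vs \<noteq> 0"
        by (auto simp: weight_support_def)
      from nonzero[OF vs(2)] obtain us where us: "length us = length vs + s" "F (g - c) us \<noteq> 0"
        by blast
      have "g - c \<in> weight_support F (w + int s - 2 * c)"
        unfolding weight_support_def using us vs(1) by (intro CollectI exI[of _ us]) auto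
      then show "g \<in> (\<lambda>g. g + c) ` weight_support F (w + int s - 2 * c)"
        by (intro image_eqI[of _ _ "g - c"]) auto
    qed
  qed
  then show ?thesis using H by (simp add: formal_space_iff)
qed

lemma formal_space_lower_bound:
  assumes "F \<in> formal_space V"
  obtains b where "\<And>g vs. F g vs \<noteq> 0 \<Longrightarrow> int (length vs) + 2 * g = w \<Longrightarrow> b \<le> g"
proof -
  have "finite (weight_support F w)" using assms by (simp add: formal_space_iff)
  from bdd_below_finite[OF this] obtain b where "\<And>g. g \<in> weight_support F w \<Longrightarrow> b \<le> g"
    by (auto simp: bdd_below_def)
  then show thesis by (intro that[of b]) (auto simp: weight_support_def)
qed

text \<open>Two more arguments and one power of hbar less leave the weight unchanged, so a nonzero
  coefficient would force arbitrarily low powers of hbar in one weight.\<close>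

lemma formal_space_no_descent:
  assumes F: "F \<in> formal_space V"
    and descent: "\<And>g vs. F g vs \<noteq> 0 \<Longrightarrow> \<exists>us. length us = length vs + 2 \<and> F (g - 1) us \<noteq> 0"
  shows "F = 0"
proof (rule ccontr)
  assume "F \<noteq> 0"
  then obtain g vs where nz: "F g vs \<noteq> 0" by (auto simp: fun_eq_iff)
  obtain b where b: "\<And>h us. F h us \<noteq> 0 \<Longrightarrow> int (length us) + 2 * h = int (length vs) + 2 * g \<Longrightarrow> b \<le> h"
    by (rule formal_space_lower_bound[OF F, of "int (length vs) + 2 * g"]) blast
  have "\<exists>us. length us = length vs + 2 * m \<and> F (g - int m) us \<noteq> 0" for m
  proof (induction m)
    case 0 then show ?case using nz by auto
  next
    case (Suc m)
    then obtain us where us: "length us = length vs + 2 * m" "F (g - int m) us \<noteq> 0" by blast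
    from descent[OF us(2)] us(1) show ?case by (auto simp: algebra_simps)
  qed
  \<comment> \<open>So many steps lead from g to b - 1, just below the lower bound.\<close>
  then obtain us where "length us = length vs + 2 * nat (g - b + 1)"
      "F (g - int (nat (g - b + 1))) us \<noteq> 0" by blast
  from b[OF this(2)] b[OF nz] this(1) show False by auto
qed

lemma weight_support_mem: "F g vs \<noteq> 0 \<Longrightarrow> g \<in> weight_support F (int (length vs) + 2 * g)"
  unfolding weight_support_def by blast

lemma weight_geD: "weight_ge a F \<Longrightarrow> F g vs \<noteq> 0 \<Longrightarrow> a \<le> int (length vs) + 2 * g"
  by (rule ccontr) (simp add: weight_ge_def)

lemma hbar_formal_space:
  assumes "F \<in> formal_space V" shows "hbar n F \<in> formal_space V"
  by (rule formal_space_shift[OF assms, where s = 0 and c = n])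
    (auto simp: hbar_def formal_space_Sym[OF assms])

lemma hbar_weight_ge: "weight_ge a F \<Longrightarrow> weight_ge (a + 2 * n) (hbar n F)"
  by (auto simp: weight_ge_def hbar_def)

lemma formal_functions_formal_space:
  assumes "F \<in> formal_functions V" shows "F \<in> formal_space V"
proof -
  \<comment> \<open>Neither g nor the length is negative, so g is at most w; the absolute value is a
    crude upper bound.\<close>
  have "weight_support F w \<subseteq> {0..\<bar>w\<bar>}" for w
  proof
    fix g assume "g \<in> weight_support F w"
    then obtain vs where vs: "int (length vs) + 2 * g = w" "F g vs \<noteq> 0"
      by (auto simp: weight_support_def)
    have "\<not> g < 0"
    proof
      assume "g < 0"
      then have "F g = 0" using assms by (simp add: formal_functions_def)
      then show False using vs(2) by simp
    qed
    then show "g \<in> {0..\<bar>w\<bar>}" using vs(1) by auto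
  qed
  then have "finite (weight_support F w)" for w
    by (rule finite_subset) simp
  then show ?thesis using assms by (simp add: formal_space_iff formal_functions_def)
qed

context graded_space
begin

text \<open>The arguments are distributed over the two factors, so polynomial degrees add. Only the
  lengths are of interest: the vectors themselves may be altered by \<open>parity\<close> and by the
  even and odd parts.\<close>

lemma prod_form_nonzero:
  assumes "prod_form V F H vs \<noteq> 0"
  shows "\<exists>xs ys. length xs + length ys = length vs \<and> F xs \<noteq> 0 \<and> H ys \<noteq> 0"
  using assms
proof (induction vs arbitrary: F H)
  case Nil
  then show ?case by (intro exI[of _ "[]"]) auto
next
  case (Cons v vs)
  from Cons.prems consider "prod_form V (pd v F) H vs \<noteq> 0"
    | "prod_form V F (pd (even_part V v) H) vs \<noteq> 0"
    | "prod_form V (sgn_form V F) (pd (odd_part V v) H) vs \<noteq> 0" by fastforce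
  then show ?case
  proof cases
    case 1
    from Cons.IH[OF this] obtain xs ys where
      "length xs + length ys = length vs" "F (v # xs) \<noteq> 0" "H ys \<noteq> 0" by (auto simp: pd_def)
    then show ?thesis by (intro exI[of _ "v # xs"] exI[of _ ys]) auto
  next
    case 2
    from Cons.IH[OF this] obtain xs ys where
      "length xs + length ys = length vs" "F xs \<noteq> 0" "H (even_part V v # ys) \<noteq> 0" by (auto simp: pd_def)
    then show ?thesis by (intro exI[of _ xs] exI[of _ "even_part V v # ys"]) auto
  next
    case 3
    from Cons.IH[OF this] obtain xs ys where
      "length xs + length ys = length vs" "F (map (parity V) xs) \<noteq> 0" "H (odd_part V v # ys) \<noteq> 0"
      by (auto simp: pd_def sgn_form_def)
    then show ?thesis by (intro exI[of _ "map (parity V) xs"] exI[of _ "odd_part V v # ys"]) auto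
  qed
qed

lemma formal_mult_nonzero:
  assumes "formal_mult V F H g vs \<noteq> 0"
  obtains h xs ys where "length xs + length ys = length vs" "F h xs \<noteq> 0" "H (g - h) ys \<noteq> 0"
proof -
  obtain h where "prod_form V (F h) (H (g - h)) vs \<noteq> 0"
    using assms unfolding formal_mult_def by (metis (mono_tags, lifting) sum.neutral)
  from prod_form_nonzero[OF this] that show thesis by blast
qed

lemma formal_mult_weight_ge:
  assumes "weight_ge a F" "weight_ge b H" shows "weight_ge (a + b) (formal_mult V F H)"
  unfolding weight_ge_def
proof (intro allI impI, rule ccontr)
  fix g and vs :: "'v list"
  assume w: "int (length vs) + 2 * g < a + b" and nz: "formal_mult V F H g vs \<noteq> 0"
  obtain h xs ys where *: "length xs + length ys = length vs" "F h xs \<noteq> 0" "H (g - h) ys \<noteq> 0"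
    by (rule formal_mult_nonzero[OF nz])
  from weight_geD[OF assms(1) *(2)] weight_geD[OF assms(2) *(3)] *(1) w show False by simp
qed

text \<open>The lower bounds a and b leave finitely many ways to split a weight w between the
  factors, and each weight of a factor contains finitely many powers of hbar.\<close>

lemma formal_mult_formal_space:
  assumes F: "F \<in> formal_space V" "weight_ge a F" and H: "H \<in> formal_space V" "weight_ge b H"
  shows "formal_mult V F H \<in> formal_space V"
proof -
  \<comment> \<open>The pairs of powers of hbar, one from each factor, that can contribute in weight
    w.\<close>
  define P where "P w = (\<Union>w1\<in>{a..w - b}. weight_support F w1 \<times> weight_support H (w - w1))" for w
  have finP: "finite (P w)" for w
    unfolding P_def using F H by (auto simp: formal_space_iff)
  have P: "(h, g - h) \<in> P (int (length vs) + 2 * g)"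
    if "length xs + length ys = length vs" "F h xs \<noteq> 0" "H (g - h) ys \<noteq> 0" for h g and vs xs ys :: "'v list"
  proof -
    have eq: "int (length vs) + 2 * g - (int (length xs) + 2 * h) = int (length ys) + 2 * (g - h)"
      using that(1) by simp
    have "(h, g - h) \<in> weight_support F (int (length xs) + 2 * h)
        \<times> weight_support H (int (length vs) + 2 * g - (int (length xs) + 2 * h))"
      unfolding eq by (intro SigmaI weight_support_mem that)
    moreover have "int (length xs) + 2 * h \<in> {a..int (length vs) + 2 * g - b}"
      using weight_geD[OF F(2) that(2)] weight_geD[OF H(2) that(3)] eq by simp
    ultimately show ?thesis unfolding P_def by blast
  qed
  have "formal_mult V F H g \<in> Sym V" for g
  proof (rule Sym_locally)
    fix n
    let ?X = "fst ` P (int n + 2 * g)"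
    show "\<exists>L\<in>Sym V. \<forall>vs. length vs = n \<longrightarrow> formal_mult V F H g vs = L vs"
    proof (intro bexI allI impI)
      show "(\<Sum>h\<in>?X. prod_form V (F h) (H (g - h))) \<in> Sym V"
        using F H by (intro Sym_sum Sym_prod_form formal_space_Sym)
      fix vs :: "'v list" assume n: "length vs = n"
      have "formal_mult V F H g vs = (\<Sum>h\<in>?X. prod_form V (F h) (H (g - h)) vs)"
        unfolding formal_mult_def
      proof (rule sum.mono_neutral_left)
        show "{h. prod_form V (F h) (H (g - h)) vs \<noteq> 0} \<subseteq> ?X"
        proof
          fix h assume "h \<in> {h. prod_form V (F h) (H (g - h)) vs \<noteq> 0}"
          then obtain xs ys where "length xs + length ys = length vs" "F h xs \<noteq> 0" "H (g - h) ys \<noteq> 0"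
            using prod_form_nonzero by blast
          from P[OF this] n show "h \<in> ?X" by force
        qed
      qed (use finP in auto)
      then show "formal_mult V F H g vs = (\<Sum>h\<in>?X. prod_form V (F h) (H (g - h))) vs"
        by (simp add: sum_form_apply)
    qed
  qed
  moreover have "finite (weight_support (formal_mult V F H) w)" for w
  proof (rule finite_surj[OF finP[of w]])
    show "weight_support (formal_mult V F H) w \<subseteq> (\<lambda>(h, h'). h + h') ` P w"
    proof
      fix g assume "g \<in> weight_support (formal_mult V F H) w"
      then obtain vs where vs: "int (length vs) + 2 * g = w" "formal_mult V F H g vs \<noteq> 0"
        by (auto simp: weight_support_def)
      obtain h xs ys where "length xs + length ys = length vs" "F h xs \<noteq> 0" "H (g - h) ys \<noteq> 0"
        by (rule formal_mult_nonzero[OF vs(2)])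
      from P[OF this] show "g \<in> (\<lambda>(h, h'). h + h') ` P w"
        unfolding vs(1) by (intro image_eqI[of _ _ "(h, g - h)"]) auto
    qed
  qed
  ultimately show ?thesis by (simp add: formal_space_iff)
qed

lemma formal_power_formal_space:
  assumes "F \<in> formal_space V" "weight_ge 1 F"
  shows "formal_power V F m \<in> formal_space V \<and> weight_ge (int m) (formal_power V F m)"
proof (induction m)
  case 0
  have "weight_support (const_hbar unit_form :: 'v formal) w \<subseteq> {0}" for w
    by (auto simp: weight_support_def const_hbar_def split: if_splits)
  then have "finite (weight_support (const_hbar unit_form :: 'v formal) w)" for w
    by (rule finite_subset) simp
  moreover have "(const_hbar unit_form :: 'v formal) g \<in> Sym V" for g
    by (simp add: const_hbar_def Sym_unit_form Sym_zero)
  moreover have "weight_ge 0 (const_hbar unit_form :: 'v formal)"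
    by (auto simp: weight_ge_def const_hbar_def unit_form_def)
  ultimately show ?case by (simp add: formal_power_def formal_space_iff)
next
  case (Suc m)
  have "formal_power V F (Suc m) = formal_mult V F (formal_power V F m)"
    by (simp add: formal_power_def)
  then show ?case
    using Suc formal_mult_formal_space[OF assms, of "formal_power V F m" "int m"]
      formal_mult_weight_ge[OF assms(2), of "int m" "formal_power V F m"] by (simp add: add.commute)
qed

text \<open>The m-th power has weight at least m, so in weight w the exponential series stops at m =
  w.\<close>

lemma formal_exp_formal_space:
  assumes "F \<in> formal_space V" "weight_ge 1 F"
  shows "formal_exp V F \<in> formal_space V"
proof -
  let ?p = "formal_power V F"
  note fp = formal_power_formal_space[OF assms, THEN conjunct1]
    and wp = formal_power_formal_space[OF assms, THEN conjunct2]
  have exp: "formal_exp V F g vs = (\<Sum>m\<le>nat w. 1 / fact m * ?p m g vs)"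
    if "int (length vs) + 2 * g = w" for g vs w
  proof -
    have "?p m g vs = 0" if "m \<notin> {..nat w}" for m
    proof (rule ccontr)
      assume "?p m g vs \<noteq> 0"
      from weight_geD[OF wp this] show False
        using that \<open>int (length vs) + 2 * g = w\<close> by auto
    qed
    then show ?thesis
      unfolding formal_exp_def by (subst suminf_finite[where N = "{..nat w}"]) auto
  qed
  have "formal_exp V F g \<in> Sym V" for g
  proof (rule Sym_locally)
    fix n
    show "\<exists>L\<in>Sym V. \<forall>vs. length vs = n \<longrightarrow> formal_exp V F g vs = L vs"
    proof (intro bexI allI impI)
      show "(\<Sum>m\<le>nat (int n + 2 * g). (\<lambda>vs. 1 / fact m * ?p m g vs)) \<in> Sym V"
        by (intro Sym_sum Sym_scale formal_space_Sym[OF fp])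
    qed (simp only: sum_form_apply exp)
  qed
  moreover have "finite (weight_support (formal_exp V F) w)" for w
  proof (rule finite_subset)
    show "weight_support (formal_exp V F) w \<subseteq> (\<Union>m\<in>{..nat w}. weight_support (?p m) w)"
    proof
      fix g assume "g \<in> weight_support (formal_exp V F) w"
      then obtain vs where vs: "int (length vs) + 2 * g = w" "formal_exp V F g vs \<noteq> 0"
        by (auto simp: weight_support_def)
      then obtain m where "m \<le> nat w" "?p m g vs \<noteq> 0"
        unfolding exp[OF vs(1)] by (metis (mono_tags, lifting) atMost_iff mult_zero_right sum.neutral)
      with vs(1) weight_support_mem[of "?p m" g vs]
      show "g \<in> (\<Union>m\<in>{..nat w}. weight_support (?p m) w)" by auto
    qed
    show "finite (\<Union>m\<in>{..nat w}. weight_support (?p m) w)"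
      using fp by (auto simp: formal_space_iff)
  qed
  ultimately show ?thesis by (simp add: formal_space_iff)
qed

end

section \<open>The differential Q + hbar Delta and its square\<close>

context dg_symplectic
begin

lemma BV_uminus: "BV V \<omega> (- F) = - BV V \<omega> F"
  using BV_scaled[of "-1" F] by (simp add: fun_Compl_def)

lemma BV_minus: "BV V \<omega> (F - H) = BV V \<omega> F - BV V \<omega> H"
  using BV_plus[of F "- H"] by (simp add: BV_uminus)

lemma BV_0: "BV V \<omega> 0 = 0"
  using BV_minus[of 0 0] by simp

lemma Q_op_minus: "Q_op V q (F - H) = Q_op V q F - Q_op V q H"
  by (simp add: Q_op_eq)

lemma Q_op_plus: "Q_op V q (F + H) = Q_op V q F + Q_op V q H"
  by (simp add: Q_op_eq)

lemma Q_hbar_BV_apply: "Q_hbar_BV V \<omega> q F g = Q_op V q (F g) + BV V \<omega> (F (g - 1))"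
  by (simp add: Q_hbar_BV_def hbar_def)

lemma Q_hbar_BV_minus: "Q_hbar_BV V \<omega> q (F - H) = Q_hbar_BV V \<omega> q F - Q_hbar_BV V \<omega> q H"
  by (rule ext) (simp add: Q_hbar_BV_apply Q_op_minus BV_minus)

lemma Q_hbar_BV_square:
  assumes "finite B0" "span B0 = (UNIV :: 'v set)" and F: "\<And>g. F g \<in> Sym V"
  shows "Q_hbar_BV V \<omega> q (Q_hbar_BV V \<omega> q F) = 0"
  by (rule ext) (simp add: Q_hbar_BV_apply Q_op_plus BV_plus BV_BV[OF assms(1,2) F]
      BV_Q_op[OF assms(1,2) Sym_multilinear[OF F]] Q_op_Q_op[OF Sym_multilinear[OF F]])

lemma hbar_BV_half: "BV_half V \<omega> q (hbar 1 F) = Q_hbar_BV V \<omega> q F"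
  by (intro ext) (simp add: BV_half_def hbar_def Q_hbar_BV_def)

lemma BV_half_eq_0: "Q_hbar_BV V \<omega> q F = 0 \<Longrightarrow> BV_half V \<omega> q F = 0"
  by (simp add: BV_half_def hbar_def fun_eq_iff)

end

section \<open>The resolvent of hbar Delta K and the perturbed homotopy\<close>

context cyclic_sdr
begin

lemma K_op_uminus: "K_op V q k (- F) = - K_op V q k F"
  using K_op_scaled[of "-1" F] by (simp add: fun_Compl_def)

lemma K_op_minus: "K_op V q k (F - H) = K_op V q k F - K_op V q k H"
  using K_op_plus[of F "- H"] by (simp add: K_op_uminus)

lemma K_op_0: "K_op V q k 0 = 0"
  using K_op_minus[of 0 0] by simp

abbreviation BV_K :: "'v form \<Rightarrow> 'v form" where
  "BV_K F \<equiv> BV V \<omega> (K_op V q k F)"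

abbreviation hbar_BV_K :: "'v formal \<Rightarrow> 'v formal" where
  "hbar_BV_K H \<equiv> hbar 1 (coeffwise (BV V \<omega>) (coeffwise (K_op V q k) H))"

text \<open>The series in \<open>P_pert\<close> before P is applied; it is kept apart because the
  homotopy applies K, and not only P, to it.\<close>

definition resolvent :: "'v formal \<Rightarrow> 'v formal" where
  "resolvent F g vs = (\<Sum>m. (-1) ^ m * (hbar_BV_K ^^ m) F g vs)"

lemma P_pert_resolvent: "P_pert V \<omega> q i k F = coeffwise (pullback i) (resolvent F)"
  by (simp add: P_pert_def resolvent_def pullback_def fun_eq_iff)

lemma hbar_BV_K_apply: "hbar_BV_K H g = BV_K (H (g - 1))"
  by (simp add: hbar_def)

lemma BV_K_cong:
  assumes "\<And>us. length us = length vs + 2 \<Longrightarrow> F us = H us"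
  shows "BV_K F vs = BV_K H vs"
  by (rule BV_cong, rule K_op_cong) (use assms in auto)

lemma BV_K_nonzero:
  assumes "BV_K F vs \<noteq> 0" shows "\<exists>us. length us = length vs + 2 \<and> F us \<noteq> 0"
proof (rule ccontr)
  assume "\<not> ?thesis"
  then have "BV_K F vs = BV_K 0 vs" by (intro BV_K_cong) auto
  then show False using assms by (simp add: K_op_0 V.BV_0)
qed

lemma BV_K_sum: "BV_K (\<Sum>m\<in>M. (\<lambda>vs. r m * f m vs)) = (\<Sum>m\<in>M. (\<lambda>vs. r m * BV_K (f m) vs))"
  by (induction M rule: infinite_finite_induct)
    (simp_all only: sum.infinite sum.empty sum.insert not_False_eq_True
      K_op_0 V.BV_0 K_op_plus V.BV_plus K_op_scaled V.BV_scaled)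

lemma hbar_BV_K_power_Suc_apply: "(hbar_BV_K ^^ Suc m) F g = BV_K ((hbar_BV_K ^^ m) F (g - 1))"
  unfolding funpow.simps comp_apply by (rule hbar_BV_K_apply)

lemma hbar_BV_K_power_nonzero:
  "(hbar_BV_K ^^ m) F g vs \<noteq> 0 \<Longrightarrow> \<exists>us. length us = length vs + 2 * m \<and> F (g - int m) us \<noteq> 0"
proof (induction m arbitrary: g vs)
  case 0 then show ?case by auto
next
  case (Suc m)
  then have "BV_K ((hbar_BV_K ^^ m) F (g - 1)) vs \<noteq> 0"
    unfolding hbar_BV_K_power_Suc_apply by blast
  from BV_K_nonzero[OF this] obtain us where
    us: "length us = length vs + 2" "(hbar_BV_K ^^ m) F (g - 1) us \<noteq> 0" by blast
  from Suc.IH[OF us(2)] us(1) show ?case by (auto simp: algebra_simps)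
qed

lemma hbar_BV_K_power_Sym:
  assumes F: "\<And>g. F g \<in> Sym V" shows "(hbar_BV_K ^^ m) F g \<in> Sym V"
proof (induction m arbitrary: g)
  case 0 then show ?case using F by simp
next
  case (Suc m)
  show ?case unfolding hbar_BV_K_power_Suc_apply by (intro V.Sym_BV Sym_K_op Suc)
qed

context
  fixes F
  assumes F: "F \<in> formal_space V"
begin

text \<open>The m-th term reads F at power g - m and length n + 2 m, all in the same weight. Once g
  - m drops below the least power of hbar in that weight, nothing is left.\<close>

lemma hbar_BV_K_power_eventually_zero:
  obtains N where "\<And>m vs. N \<le> m \<Longrightarrow> length vs = n \<Longrightarrow> (hbar_BV_K ^^ m) F g vs = 0"
proof -
  obtain b where b: "\<And>h us. F h us \<noteq> 0 \<Longrightarrow> int (length us) + 2 * h = int n + 2 * g \<Longrightarrow> b \<le> h"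
    by (rule formal_space_lower_bound[OF F, of "int n + 2 * g"]) blast
  have "(hbar_BV_K ^^ m) F g vs = 0" if m: "nat (g - b) + 1 \<le> m" and n: "length vs = n" for m vs
  proof (rule ccontr)
    assume "(hbar_BV_K ^^ m) F g vs \<noteq> 0"
    from hbar_BV_K_power_nonzero[OF this] obtain us where
      us: "length us = n + 2 * m" "F (g - int m) us \<noteq> 0" using n by auto
    from b[OF us(2)] us(1) m show False by simp
  qed
  then show thesis using that by blast
qed

lemma resolvent_eq_sum:
  assumes "\<And>m vs. N \<le> m \<Longrightarrow> length vs = n \<Longrightarrow> (hbar_BV_K ^^ m) F g vs = 0" "length vs = n"
  shows "resolvent F g vs = (\<Sum>m<N. (\<lambda>vs. (-1) ^ m * (hbar_BV_K ^^ m) F g vs)) vs"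
  unfolding resolvent_def sum_form_apply
  by (rule suminf_finite) (use assms in auto)

text \<open>No term changes the weight or lowers the least power of hbar found in it, so the lower
  bound for F also serves here; an upper bound holds because lengths are not negative.\<close>

lemma resolvent_formal_space: "resolvent F \<in> formal_space V"
proof -
  have "resolvent F g \<in> Sym V" for g
  proof (rule V.Sym_locally)
    fix n
    obtain N where N: "\<And>m vs. N \<le> m \<Longrightarrow> length vs = n \<Longrightarrow> (hbar_BV_K ^^ m) F g vs = 0"
      by (rule hbar_BV_K_power_eventually_zero) blast
    show "\<exists>L\<in>Sym V. \<forall>vs. length vs = n \<longrightarrow> resolvent F g vs = L vs"
    proof (intro bexI allI impI)
      show "(\<Sum>m<N. (\<lambda>vs. (-1) ^ m * (hbar_BV_K ^^ m) F g vs)) \<in> Sym V"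
        by (intro V.Sym_sum V.Sym_scale hbar_BV_K_power_Sym formal_space_Sym[OF F])
    qed (rule resolvent_eq_sum[OF N])
  qed
  moreover have "finite (weight_support (resolvent F) w)" for w
  proof -
    obtain b where b: "\<And>h us. F h us \<noteq> 0 \<Longrightarrow> int (length us) + 2 * h = w \<Longrightarrow> b \<le> h"
      by (rule formal_space_lower_bound[OF F, of w]) blast
    have "weight_support (resolvent F) w \<subseteq> {b..\<bar>w\<bar>}"
    proof
      fix g assume "g \<in> weight_support (resolvent F) w"
      then obtain vs where vs: "int (length vs) + 2 * g = w" "resolvent F g vs \<noteq> 0"
        by (auto simp: weight_support_def)
      obtain m where "(hbar_BV_K ^^ m) F g vs \<noteq> 0"
      proof (rule ccontr)
        assume "\<not> thesis"
        then have "(hbar_BV_K ^^ m) F g vs = 0" for m using that by blast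
        then show False using vs(2) by (simp only: resolvent_def mult_zero_right suminf_zero)
      qed
      from hbar_BV_K_power_nonzero[OF this] obtain us where
        us: "length us = length vs + 2 * m" "F (g - int m) us \<noteq> 0" by blast
      from b[OF us(2)] us(1) vs(1) show "g \<in> {b..\<bar>w\<bar>}" by auto
    qed
    then show ?thesis by (rule finite_subset) simp
  qed
  ultimately show ?thesis by (simp add: formal_space_iff)
qed

text \<open>The geometric series identity, obtained by truncating both sides and matching
  terms.\<close>

lemma resolvent_equation: "resolvent F g + BV_K (resolvent F (g - 1)) = F g"
proof (rule ext)
  fix vs :: "'v list"
  let ?n = "length vs"
  let ?p = "\<lambda>m. (hbar_BV_K ^^ m) F"
  obtain N1 where N1: "\<And>m vs. N1 \<le> m \<Longrightarrow> length vs = ?n \<Longrightarrow> ?p m g vs = 0"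
    by (rule hbar_BV_K_power_eventually_zero[of ?n g]) blast
  obtain N2 where N2: "\<And>m vs. N2 \<le> m \<Longrightarrow> length vs = ?n + 2 \<Longrightarrow> ?p m (g - 1) vs = 0"
    by (rule hbar_BV_K_power_eventually_zero[of "?n + 2" "g - 1"]) blast
  \<comment> \<open>Two thresholds are needed: Delta reads the resolvent at length n + 2 and power g
    - 1. The first sum is cut at \<open>Suc N\<close>, so that after splitting off m = 0 it matches
    the second.\<close>
  define N where "N = max N1 N2"
  have "resolvent F g vs = (\<Sum>m<Suc N. (\<lambda>vs. (-1) ^ m * ?p m g vs)) vs"
    by (rule resolvent_eq_sum[of _ ?n]) (use N1 in \<open>auto simp: N_def\<close>)
  also have "\<dots> = F g vs - (\<Sum>m<N. (-1) ^ m * ?p (Suc m) g vs)"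
    unfolding sum_form_apply sum.lessThan_Suc_shift by (simp add: sum_negf del: funpow.simps(2))
  finally have 1: "resolvent F g vs = F g vs - (\<Sum>m<N. (-1) ^ m * ?p (Suc m) g vs)" .
  have "BV_K (resolvent F (g - 1)) vs = BV_K (\<Sum>m<N. (\<lambda>vs. (-1) ^ m * ?p m (g - 1) vs)) vs"
    by (rule BV_K_cong, rule resolvent_eq_sum[of _ "?n + 2"]) (use N2 in \<open>auto simp: N_def\<close>)
  also have "\<dots> = (\<Sum>m<N. (-1) ^ m * ?p (Suc m) g vs)"
    by (simp only: BV_K_sum sum_form_apply hbar_BV_K_power_Suc_apply)
  finally show "(resolvent F g + BV_K (resolvent F (g - 1))) vs = F g vs"
    using 1 by simp
qed

end

lemma perturbation_homotopy:
  assumes fin: "finite B0" "span B0 = (UNIV :: 'v set)"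
    and F: "F \<in> formal_space V" and closed: "Q_hbar_BV V \<omega> q F = 0"
  shows "F - coeffwise (pullback p) (P_pert V \<omega> q i k F)
    = Q_hbar_BV V \<omega> q (coeffwise (K_op V q k) (resolvent F))"
proof -
  define G where "G = resolvent F"
  let ?Q = "Q_op V q" and ?\<Delta> = "BV V \<omega>" and ?K = "K_op V q k"
  let ?IP = "\<lambda>H. pullback p (pullback i H)"
  define M where "M = (\<lambda>g. ?K (?Q (G g)))"
  have G: "G \<in> formal_space V" unfolding G_def by (rule resolvent_formal_space[OF F])
  note GS = formal_space_Sym[OF G] and ml = V.Sym_multilinear
  have eq: "F g = G g + ?\<Delta> (?K (G (g - 1)))" for g
    using resolvent_equation[OF F, of g] by (simp add: G_def)
  have htpy: "?Q (?K (G g)) = G g - ?IP (G g) - M g" for g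
    using Q_K_homotopy[OF ml[OF GS], of g] by (simp add: M_def algebra_simps)
  \<comment> \<open>Apply Q to F = G + hbar Delta K G. Closedness turns Q F into - hbar Delta F, and
    Delta F = Delta G as Delta squares to zero. Anticommuting Q past Delta produces Q K G, which the
    homotopy formula replaces.\<close>
  have QG: "?Q (G g) = - ?\<Delta> (?IP (G (g - 1))) - ?\<Delta> (M (g - 1))" for g
  proof -
    have 1: "?\<Delta> (F (g - 1)) = ?\<Delta> (G (g - 1))"
      unfolding eq V.BV_plus V.BV_BV[OF fin Sym_K_op[OF GS]] by simp
    have 2: "?Q (F g) = - ?\<Delta> (F (g - 1))"
      using closed V.Q_hbar_BV_apply[of F g] by (simp add: eq_neg_iff_add_eq_0)
    have 3: "?Q (G g) = ?Q (F g) + ?\<Delta> (?Q (?K (G (g - 1))))"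
      unfolding eq[of g] V.Q_op_plus V.BV_Q_op[OF fin ml[OF Sym_K_op[OF GS]]] by simp
    show ?thesis
      unfolding 3 2 1 htpy V.BV_minus by simp
  qed
  have Mrec: "M g = - ?K (?\<Delta> (M (g - 1)))" for g
  proof -
    have PS: "pullback i (G h) \<in> Sym U" for h by (rule i.Sym_pullback[OF GS])
    have "?K (?\<Delta> (?IP (G (g - 1)))) = 0"
      unfolding BV_pullback_p[OF fin U.Sym_multilinear[OF PS]]
      by (rule K_op_pullback_p[OF U.Sym_multilinear[OF U.Sym_BV[OF PS]]])
    then show ?thesis
      unfolding M_def[THEN fun_cong, of g] QG K_op_minus K_op_uminus by simp
  qed
  have "M = 0"
  proof (rule formal_space_no_descent)
    show "M \<in> formal_space V"
    \<comment> \<open>Q and K change neither the length nor the power of hbar, so both shifts are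
      zero.\<close>
    proof (rule formal_space_shift[OF G, of _ _ 0 0])
      show "M g \<in> Sym V" for g unfolding M_def by (intro Sym_K_op V.Sym_Q_op GS)
      show "\<exists>us. length us = length vs + 0 \<and> G (g - 0) us \<noteq> 0" if "M g vs \<noteq> 0" for g vs
      proof (rule ccontr)
        assume "\<not> ?thesis"
        then have "\<And>us. length us = length vs \<Longrightarrow> G g us = 0" by auto
        then have "?Q (G g) us = 0" if "length us = length vs" for us
          using that V.derivation_degree_zero[of "length vs" "G g" us q] by (simp add: V.Q_op_eq)
        then have "M g vs = ?K 0 vs" unfolding M_def by (intro K_op_cong) simp
        then show False using that by (simp add: K_op_0)
      qed
    qed
    show "\<exists>us. length us = length vs + 2 \<and> M (g - 1) us \<noteq> 0" if "M g vs \<noteq> 0" for g vs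
    proof (rule ccontr)
      assume "\<not> ?thesis"
      then have "\<And>us. length us = length vs + 2 \<Longrightarrow> M (g - 1) us = 0" by auto
      then have "?\<Delta> (M (g - 1)) us = ?\<Delta> 0 us" if "length us = length vs" for us
        using that by (intro BV_cong) simp
      then have "?K (?\<Delta> (M (g - 1))) vs = ?K 0 vs" by (intro K_op_cong) (simp add: V.BV_0)
      then show False using that Mrec[of g] by (simp add: K_op_0)
    qed
  qed
  \<comment> \<open>With M = 0, Q K G is G - I P G, and hbar Delta K G is F - G by the resolvent
    equation; the sum is F - I P G.\<close>
  then show ?thesis
    unfolding P_pert_resolvent G_def[symmetric]
    by (intro ext) (simp add: V.Q_hbar_BV_apply eq htpy)
qed

end

section \<open>From the perturbed homotopy to half-densities\<close>

theorem proposition4p7: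
  fixes V :: "int \<Rightarrow> 'v::real_vector set" and \<omega> :: "'v \<Rightarrow> 'v \<Rightarrow> real" and q :: "'v \<Rightarrow> 'v"
    and U :: "int \<Rightarrow> 'u::real_vector set" and \<omega>U :: "'u \<Rightarrow> 'u \<Rightarrow> real" and qU :: "'u \<Rightarrow> 'u"
    and p :: "'v \<Rightarrow> 'u" and i :: "'u \<Rightarrow> 'v" and k :: "'v \<Rightarrow> 'v"
    and S_int :: "'v formal" and W :: "'u formal"
  assumes "\<exists>B :: 'v set. finite B \<and> span B = UNIV"
    and "dg_symplectic V \<omega> q" and "dg_symplectic U \<omega>U qU"
    and "cyclic_sdr V \<omega> q U \<omega>U qU p i k"
    and "quantum_master_action V \<omega> q (S_free V \<omega> q + S_int)"
    and "W \<in> formal_space U" and "weight_ge 3 W"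
    and "formal_exp U (hbar (-1) W) = P_pert V \<omega> q i k (formal_exp V (hbar (-1) S_int))"
  shows "homotopic V \<omega> q
    (exp_action V \<omega> q (S_free V \<omega> q + S_int))
    (exp_action V \<omega> q (S_free V \<omega> q + coeffwise (pullback p) W))"
proof -
  interpret cyclic_sdr V \<omega> q U \<omega>U qU p i k by (rule assms(4))
  obtain B0 :: "'v set" where fin: "finite B0" "span B0 = UNIV" using assms(1) by blast
  let ?F = "formal_exp V (hbar (-1) S_int)" and ?D = "Q_hbar_BV V \<omega> q"
  let ?H = "coeffwise (pullback p) (P_pert V \<omega> q i k ?F)"
  let ?X = "coeffwise (K_op V q k) (resolvent ?F)"
  obtain "S_int \<in> formal_functions V" "weight_ge 3 S_int" and closed: "?D ?F = 0"
    using assms(5) unfolding quantum_master_action_def by auto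
  \<comment> \<open>Division by hbar lowers the weight by 2, so \<open>S_int\<close> divided by hbar
    has weight at least 1, as the exponential requires.\<close>
  then have F: "?F \<in> formal_space V"
    using hbar_weight_ge[of 3 S_int "-1"]
    by (intro V.formal_exp_formal_space hbar_formal_space formal_functions_formal_space) simp_all
  note G = resolvent_formal_space[OF F]
  have X: "?X \<in> formal_space V"
  proof (rule formal_space_shift[OF G, of _ _ 0 0])
    show "K_op V q k (resolvent ?F g) \<in> Sym V" for g by (intro Sym_K_op formal_space_Sym[OF G])
    show "\<exists>us. length us = length vs + 0 \<and> resolvent ?F (g - 0) us \<noteq> 0"
      if "K_op V q k (resolvent ?F g) vs \<noteq> 0" for g vs
      using K_op_cong[of vs "resolvent ?F g" 0] that by (force simp: K_op_0)
  qed
  have H: "?H \<in> formal_space V"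
  proof (rule formal_space_shift[OF G, of _ _ 0 0])
    show "pullback p (P_pert V \<omega> q i k ?F g) \<in> Sym V" for g
      unfolding P_pert_resolvent by (intro p.Sym_pullback i.Sym_pullback formal_space_Sym[OF G])
    show "\<exists>us. length us = length vs + 0 \<and> resolvent ?F (g - 0) us \<noteq> 0"
      if "pullback p (P_pert V \<omega> q i k ?F g) vs \<noteq> 0" for g vs
      using that unfolding P_pert_resolvent pullback_def by (intro exI[of _ "map i (map p vs)"]) auto
  qed
  have htpy: "?F - ?H = ?D ?X" by (rule perturbation_homotopy[OF fin F closed])
  \<comment> \<open>The homotopy formula exhibits \<open>?H\<close> as a closed element minus an
    exact one.\<close>
  have "?D ?H = ?D (?F - ?D ?X)" by (simp flip: htpy)
  also have "\<dots> = 0"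
    unfolding V.Q_hbar_BV_minus closed V.Q_hbar_BV_square[OF fin formal_space_Sym[OF X]] by simp
  finally have closedH: "?D ?H = 0" .
  have "exp_action V \<omega> q (S_free V \<omega> q + S_int) = ?F"
    by (simp add: exp_action_def)
  moreover have "exp_action V \<omega> q (S_free V \<omega> q + coeffwise (pullback p) W) = ?H"
  proof -
    have "hbar (-1) (coeffwise (pullback p) W) = coeffwise (pullback p) (hbar (-1) W)"
      by (simp add: hbar_def fun_eq_iff)
    then show ?thesis
      by (simp add: exp_action_def p.formal_exp_pullback assms(8))
  qed
  \<comment> \<open>\<open>BV_half\<close> contains the factor 1/hbar, so the primitive for it is
    hbar K G.\<close>
  moreover have "?F - ?H = BV_half V \<omega> q (hbar 1 ?X)"
    by (simp only: V.hbar_BV_half htpy)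
  ultimately show ?thesis
    unfolding homotopic_def half_densities_def
    using F H closed closedH V.BV_half_eq_0 hbar_formal_space[OF X] by auto
qed

end
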